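(* Let $\mathcal S$ be a system of dimension $N$ satisfying Axioms I–V. Then there is a mapping $z\mapsto\bar z$ of the elements of $\mathcal S$ to $\mathbb{C}P^{N-1}$ such that the Born Rule $$x(y)=|\hat x^*\cdot\hat y|^2$$ holds for every pair of elements $x,y\in\mathcal S$, where $\hat z=\bar z/|\bar z|$ is a unit vector in $\mathbb C^N$ of homogeneous coordinates representing $\bar z$ and $\hat x^*\cdot\hat y=\sum_{i=1}^N \overline{\hat x_i}\,\hat y_i$.
   Context: Setting: $\mathcal S$ is a set with a function $p:\mathcal S\times\mathcal S\to[0,1]$; write $x(y)=p(x,y)$ and identify an element $u\in\mathcal S$ with the function $u(\cdot)$ on $\mathcal S$. Elements $u,v$ are orthogonal, $u\perp v$, if $u(v)=0$. Put $d(x,y)=\sup_{z\in\mathcal S}|x(z)-y(z)|$. A frame in a subset $\mathcal S^*\subseteq\mathcal S$ is a maximal set of mutually orthogonal elements of $\mathcal S^*$. Axiom I: for all $w,z\in\mathcal S$, $w(z)=1$ if and only if $w=z$, and $w(z)=z(w)$ (so $d$ is a metric). Axiom II: $\mathcal S$ is compact in the metric $d$ (so all frames are finite). Axiom III: for every $a\in\mathcal S$ and every frame $\{x_1,x_2,\dots\}$ in $\mathcal S$, $\sum_j a(x_j)=1$. Axiom IV: given any two distinct $a,b\in\mathcal S$ there exist orthogonal $c,c'\in\mathcal S$ and a number $0<\alpha<1$ such that $a(c)\,c+a(c')\,c'=\alpha a+(1-\alpha)b$ as functions on $\mathcal S$. Subspaces: if $x_1,\dots,x_n$ are mutually orthogonal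 elements, the subspace they span is $\{z\in\mathcal S:\sum_{j=1}^n x_j(z)=1\}$. Under Axioms I–III all frames in a subspace have the same number of elements, called its dimension; $\mathcal S$ itself is a subspace, and its dimension $N$ is the number of elements of any frame in $\mathcal S$. Axiom V ("the purities of the mixed states resulting from random measurements of a pure qubit state are uniformly distributed"): Under Axioms I–IV each two-dimensional subspace $\mathcal P$ is identified, by a bijection $x\mapsto X$, with a unit sphere $S^R\subset\mathbb R^{R+1}$ for some integer $R\ge 1$, in such a way that $x(y)=\cos^2\frac12 XY$, where $XY$ is the angle at the center of the sphere between $X$ and $Y$. For $x,y\in\mathcal P$, with $y'$ the unique element of $\mathcal P$ orthogonal to $y$, measuring $x$ in the frame $\{y,y'\}$ produces the mixed state $x(y)y+(1-x(y))y'$, whose purity is $\delta=|2x(y)-1|$. Axiom V states that for every two-dimensional subspace $\mathcal P$ and every $x\in\mathcal P$, if $y$ is random with respect to the uniform (rotation-invariant) probability measure on the sphere identified with $\mathcal P$, then $\delta$ is uniformly distributed on $[0,1]$. *)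

theory Defs
  imports "HOL-Probability.Probability"
begin

text \<open>A system is a carrier \<open>S\<close> with \<open>p :: 'a \<Rightarrow> 'a \<Rightarrow> real\<close>; the number \<open>x(y)\<close> is
  \<open>p x y\<close>, and the function identified with \<open>u\<close> is \<open>p u\<close> restricted to \<open>S\<close>.
  Values of \<open>p\<close> outside \<open>S \<times> S\<close> are never used.\<close>

definition probability_function :: "'a set \<Rightarrow> ('a \<Rightarrow> 'a \<Rightarrow> real) \<Rightarrow> bool" where
  "probability_function S p \<longleftrightarrow> (\<forall>x\<in>S. \<forall>y\<in>S. p x y \<in> {0..1})"

definition orthogonal_states :: "('a \<Rightarrow> 'a \<Rightarrow> real) \<Rightarrow> 'a \<Rightarrow> 'a \<Rightarrow> bool" where
  "orthogonal_states p u v \<longleftrightarrow> p u v = 0"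

definition mutually_orthogonal :: "('a \<Rightarrow> 'a \<Rightarrow> real) \<Rightarrow> 'a set \<Rightarrow> bool" where
  "mutually_orthogonal p F \<longleftrightarrow> pairwise (orthogonal_states p) F"

definition frame_in :: "('a \<Rightarrow> 'a \<Rightarrow> real) \<Rightarrow> 'a set \<Rightarrow> 'a set \<Rightarrow> bool" where
  "frame_in p T F \<longleftrightarrow> F \<subseteq> T \<and> mutually_orthogonal p F \<and>
     (\<forall>G. F \<subseteq> G \<and> G \<subseteq> T \<and> mutually_orthogonal p G \<longrightarrow> G = F)"

text \<open>Set to 0 off \<open>S\<close> because \<^locale>\<open>Metric_space\<close> wants a nonnegative symmetric function on
  the whole type.\<close>

definition state_dist :: "'a set \<Rightarrow> ('a \<Rightarrow> 'a \<Rightarrow> real) \<Rightarrow> 'a \<Rightarrow> 'a \<Rightarrow> real" where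
  "state_dist S p x y = (if x \<in> S \<and> y \<in> S then (SUP z\<in>S. \<bar>p x z - p y z\<bar>) else 0)"

definition axiom_I :: "'a set \<Rightarrow> ('a \<Rightarrow> 'a \<Rightarrow> real) \<Rightarrow> bool" where
  "axiom_I S p \<longleftrightarrow> (\<forall>w\<in>S. \<forall>z\<in>S. (p w z = 1 \<longleftrightarrow> w = z) \<and> p w z = p z w)"

lemma Metric_space_state_dist:
  assumes p: "probability_function S p" and I: "axiom_I S p"
  shows "Metric_space S (state_dist S p)"
proof -
  have bnd: "bdd_above ((\<lambda>z. \<bar>p x z - p y z\<bar>) ` S)" if "x \<in> S" "y \<in> S" for x y
  proof (rule bdd_aboveI2)
    fix z assume "z \<in> S"
    then have "p x z \<in> {0..1}" "p y z \<in> {0..1}"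
      using p that unfolding probability_function_def by blast+
    then show "\<bar>p x z - p y z\<bar> \<le> 1" by auto
  qed
  have upper: "\<bar>p x z - p y z\<bar> \<le> state_dist S p x y" if "x \<in> S" "y \<in> S" "z \<in> S" for x y z
    using that bnd[of x y] by (auto simp: state_dist_def intro: cSUP_upper)
  show ?thesis
  proof
    show nonneg: "0 \<le> state_dist S p x y" for x y
      using upper[of x y x] by (cases "x \<in> S \<and> y \<in> S") (force, auto simp: state_dist_def)
    show "state_dist S p x y = state_dist S p y x" for x y
      by (simp add: state_dist_def abs_minus_commute)
    show "state_dist S p x y = 0 \<longleftrightarrow> x = y" if "x \<in> S" "y \<in> S" for x y
    proof
      assume "state_dist S p x y = 0"
      then have "p x x = p y x" using upper[of x y x] that by simp
      then show "x = y" using I that unfolding axiom_I_def by metis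
    qed (use that in \<open>auto simp: state_dist_def intro!: cSUP_const\<close>)
    show "state_dist S p x z \<le> state_dist S p x y + state_dist S p y z"
      if "x \<in> S" "y \<in> S" "z \<in> S" for x y z
    proof -
      have "(SUP w\<in>S. \<bar>p x w - p z w\<bar>) \<le> state_dist S p x y + state_dist S p y z"
      proof (rule cSUP_least)
        show "S \<noteq> {}" using that by auto
        fix w assume "w \<in> S"
        then show "\<bar>p x w - p z w\<bar> \<le> state_dist S p x y + state_dist S p y z"
          using upper[of x y w] upper[of y z w] that by linarith
      qed
      then show ?thesis using that by (simp add: state_dist_def)
    qed
  qed
qed

definition axiom_II :: "'a set \<Rightarrow> ('a \<Rightarrow> 'a \<Rightarrow> real) \<Rightarrow> bool" where
  "axiom_II S p \<longleftrightarrow> compact_space (Metric_space.mtopology S (state_dist S p))"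

definition axiom_III :: "'a set \<Rightarrow> ('a \<Rightarrow> 'a \<Rightarrow> real) \<Rightarrow> bool" where
  "axiom_III S p \<longleftrightarrow> (\<forall>a\<in>S. \<forall>F. frame_in p S F \<longrightarrow> (p a has_sum 1) F)"

definition axiom_IV :: "'a set \<Rightarrow> ('a \<Rightarrow> 'a \<Rightarrow> real) \<Rightarrow> bool" where
  "axiom_IV S p \<longleftrightarrow> (\<forall>a\<in>S. \<forall>b\<in>S. a \<noteq> b \<longrightarrow>
     (\<exists>c\<in>S. \<exists>c'\<in>S. \<exists>\<alpha>. orthogonal_states p c c' \<and> 0 < \<alpha> \<and> \<alpha> < 1 \<and>
        (\<forall>z\<in>S. p a c * p c z + p a c' * p c' z = \<alpha> * p a z + (1 - \<alpha>) * p b z)))"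

definition is_subspace :: "'a set \<Rightarrow> ('a \<Rightarrow> 'a \<Rightarrow> real) \<Rightarrow> 'a set \<Rightarrow> bool" where
  "is_subspace S p P \<longleftrightarrow> (\<exists>F. finite F \<and> F \<subseteq> S \<and> mutually_orthogonal p F \<and>
     P = {z\<in>S. (\<Sum>x\<in>F. p x z) = 1})"

definition has_dimension :: "('a \<Rightarrow> 'a \<Rightarrow> real) \<Rightarrow> 'a set \<Rightarrow> nat \<Rightarrow> bool" where
  "has_dimension p P n \<longleftrightarrow> (\<exists>F. frame_in p P F) \<and>
     (\<forall>F. frame_in p P F \<longrightarrow> finite F \<and> card F = n)"

text \<open>The unit sphere of \<open>\<real>\<^bsup>R+1\<^esup>\<close> is the carrier of \<^const>\<open>nsphere\<close>: sequences
  \<open>X\<close> with \<open>X i = 0\<close> for \<open>i > R\<close> and \<open>(\<Sum>i\<le>R. (X i)\<^sup>2) = 1\<close>.\<close>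

abbreviation unit_sphere :: "nat \<Rightarrow> (nat \<Rightarrow> real) set" where
  "unit_sphere R \<equiv> topspace (nsphere R)"

definition central_angle :: "nat \<Rightarrow> (nat \<Rightarrow> real) \<Rightarrow> (nat \<Rightarrow> real) \<Rightarrow> real" where
  "central_angle R X Y = arccos (\<Sum>i\<le>R. X i * Y i)"

definition orthogonal_mat :: "nat \<Rightarrow> (nat \<Rightarrow> nat \<Rightarrow> real) \<Rightarrow> bool" where
  "orthogonal_mat n A \<longleftrightarrow> (\<forall>i<n. \<forall>j<n. (\<Sum>k<n. A k i * A k j) = (if i = j then 1 else 0))"

definition apply_mat :: "nat \<Rightarrow> (nat \<Rightarrow> nat \<Rightarrow> real) \<Rightarrow> (nat \<Rightarrow> real) \<Rightarrow> nat \<Rightarrow> real" where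
  "apply_mat n A X = (\<lambda>i. if i < n then (\<Sum>j<n. A i j * X j) else 0)"

text \<open>For \<open>R \<ge> 1\<close> there is exactly one such \<open>M\<close>, and it is also the only probability measure
  invariant under the proper rotations, which already act transitively on the sphere.\<close>

definition uniform_sphere_measure :: "nat \<Rightarrow> (nat \<Rightarrow> real) measure \<Rightarrow> bool" where
  "uniform_sphere_measure R M \<longleftrightarrow> prob_space M \<and> space M = unit_sphere R \<and>
     sets M = sets (restrict_space borel (unit_sphere R)) \<and>
     (\<forall>A. orthogonal_mat (Suc R) A \<longrightarrow> distr M M (apply_mat (Suc R) A) = M)"

definition sphere_identification ::
    "('a \<Rightarrow> 'a \<Rightarrow> real) \<Rightarrow> 'a set \<Rightarrow> nat \<Rightarrow> ('a \<Rightarrow> nat \<Rightarrow> real) \<Rightarrow> bool" where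
  "sphere_identification p P R \<phi> \<longleftrightarrow> bij_betw \<phi> P (unit_sphere R) \<and>
     (\<forall>x\<in>P. \<forall>y\<in>P. p x y = (cos (central_angle R (\<phi> x) (\<phi> y) / 2))\<^sup>2)"

definition measured_purity :: "('a \<Rightarrow> 'a \<Rightarrow> real) \<Rightarrow> 'a \<Rightarrow> 'a \<Rightarrow> real" where
  "measured_purity p x y = \<bar>2 * p x y - 1\<bar>"

text \<open>That every two-dimensional subspace has a sphere identification is a consequence of the
  first four axioms, so it is not assumed here: the axiom only constrains the identifications.
  For a given \<open>P\<close> they have the same \<open>R\<close> and differ by orthogonal maps, so the condition does
  not depend on the choice of \<open>\<phi>\<close>.\<close>

definition axiom_V :: "'a set \<Rightarrow> ('a \<Rightarrow> 'a \<Rightarrow> real) \<Rightarrow> bool" where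
  "axiom_V S p \<longleftrightarrow>
     (\<forall>P R \<phi>. is_subspace S p P \<and> has_dimension p P 2 \<and> 1 \<le> R \<and> sphere_identification p P R \<phi> \<longrightarrow>
        (\<exists>M. uniform_sphere_measure R M \<and>
           (\<forall>x\<in>P. distr M borel (\<lambda>Y. measured_purity p x (inv_into P \<phi> Y))
                    = uniform_measure lborel {0..1})))"

text \<open>With \<open>CARD('n) = N\<close> this is \<open>\<complex>P\<^bsup>N-1\<^esup>\<close>; a point is the set of its homogeneous
  coordinate vectors.\<close>

definition complex_projective_space :: "(complex ^ 'n) set set" where
  "complex_projective_space = (- {0}) // {(u, v). \<exists>c. c \<noteq> 0 \<and> v = c *s u}"

definition hermitian_dot :: "complex ^ 'n \<Rightarrow> complex ^ 'n \<Rightarrow> complex" where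
  "hermitian_dot u v = (\<Sum>i\<in>UNIV. cnj (u $ i) * v $ i)"

definition unit_representative :: "complex ^ 'n \<Rightarrow> complex ^ 'n" where
  "unit_representative u = u /\<^sub>R norm u"

end

theory Submission
  imports Defs
begin

text \<open>Axiom IV evaluated at \<open>c\<close>, \<open>a\<close> and \<open>b\<close> forces \<open>\<alpha> = 1/2\<close>: midpoints of two states are diagonalised by a
  pair of orthogonal states at half the angle. Iterating this near a maximum shows that an
  observable (a linear combination of the functions \<open>p x\<close>) which is maximal on a two-dimensional
  subspace at \<open>a\<close> equals \<open>f(a) p(a, \<cdot>) + f(a') p(a', \<cdot>)\<close> there. With compactness this yields a
  spectral theorem, so that two-dimensional subspaces are Bloch spheres, and Axiom V determines their
  dimension: the second moments of the \<open>R + 1\<close> coordinates are all \<open>1/3\<close> and add up to 1, so \<open>R = 2\<close>.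

  Now fix a frame with a distinguished element \<open>e\<close>. The observables vanishing at \<open>e\<close> and on
  \<open>e\<^sup>\<bottom>\<close> form a real space of dimension \<open>2(N - 1)\<close>, whose unit sphere is partitioned into
  the equators of the Bloch spheres through \<open>e\<close> and \<open>u\<close>, for \<open>u \<in> e\<^sup>\<bottom>\<close> (a Hopf fibration). The
  number \<open>p u u'\<close> is the squared length of the projection of any unit vector of the fibre of \<open>u'\<close>
  to the plane of the fibre of \<open>u\<close>, and this isoclinicity forces all these planes to be complex lines once
  some of the coordinates have been conjugated. The Born rule on \<open>e\<^sup>\<bottom>\<close> follows, and the
  decomposition of a state along \<open>e\<close> and \<open>e\<^sup>\<bottom>\<close> extends it to all states.\<close>

section \<open>Frames and planes\<close>

text \<open>The model behind the coordinates: for a state with amplitudes z_j, the j-th tangent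
  coordinate at \<open>e\<close> is the density matrix entry conj(z_e) z_j. Since |z_e|^2 is
  \<open>p z e\<close>, fixing the phase by z_e >= 0 recovers the whole vector from these entries.
  The obstacle is orientation. The isometries of a Bloch sphere include reflections, so in each
  plane through \<open>e\<close> and another frame element the imaginary direction is determined
  only up to sign, independently for each element. With the wrong signs the fibres are real planes
  that are not complex lines. Comparing every coordinate with one reference coordinate decides which
  ones to conjugate. Compactness enters in two ways: it supplies the maxima of observables, and it
  makes every set of pairwise perpendicular Bloch directions finite.\<close>

locale transition_system =
  fixes S :: "'a set" and p :: "'a \<Rightarrow> 'a \<Rightarrow> real" and N :: nat
  assumes prob: "probability_function S p"
    and axI: "axiom_I S p"
    and axII: "axiom_II S p"
    and axIII: "axiom_III S p"
    and axIV: "axiom_IV S p"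
    and dim: "has_dimension p S N"
begin

lemma p_nonneg: "x \<in> S \<Longrightarrow> y \<in> S \<Longrightarrow> 0 \<le> p x y"
  and p_le_1: "x \<in> S \<Longrightarrow> y \<in> S \<Longrightarrow> p x y \<le> 1"
  using prob by (auto simp: probability_function_def)

lemma p_sym: "x \<in> S \<Longrightarrow> y \<in> S \<Longrightarrow> p x y = p y x"
  and p_eq_1_iff: "x \<in> S \<Longrightarrow> y \<in> S \<Longrightarrow> p x y = 1 \<longleftrightarrow> x = y"
  and p_self [simp]: "x \<in> S \<Longrightarrow> p x x = 1"
  using axI by (auto simp: axiom_I_def)

abbreviation orth :: "'a set \<Rightarrow> bool" where
  "orth F \<equiv> mutually_orthogonal p F"

lemma orth_iff: "orth F \<longleftrightarrow> (\<forall>x\<in>F. \<forall>y\<in>F. x \<noteq> y \<longrightarrow> p x y = 0)"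
  by (auto simp: mutually_orthogonal_def pairwise_def orthogonal_states_def)

lemma orth_subset: "orth F \<Longrightarrow> G \<subseteq> F \<Longrightarrow> orth G"
  by (auto simp: orth_iff)

lemma orth_insert:
  "\<lbrakk>orth F; F \<subseteq> S; x \<in> S; \<And>y. y \<in> F \<Longrightarrow> p x y = 0\<rbrakk> \<Longrightarrow> orth (insert x F)"
  by (auto simp: orth_iff) (metis p_sym subsetD)

text \<open>Orthogonality is tested on pairs, so it survives unions of chains, and Zorn's lemma
  gives a maximal extension. Its size is fixed by \<open>dim\<close>, its sums by Axiom III.\<close>

lemma frame_ext:
  assumes "G \<subseteq> S" "orth G"
  obtains F where "G \<subseteq> F" "F \<subseteq> S" "orth F" "finite F" "card F = N"
    "\<And>a. a \<in> S \<Longrightarrow> (\<Sum>x\<in>F. p a x) = 1"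
proof -
  let ?A = "{F. G \<subseteq> F \<and> F \<subseteq> S \<and> orth F}"
  have "\<exists>M\<in>?A. \<forall>X\<in>?A. M \<subseteq> X \<longrightarrow> X = M"
  proof (rule subset_Zorn_nonempty)
    show "?A \<noteq> {}" using assms by auto
    fix \<C> assume C: "\<C> \<noteq> {}" "subset.chain ?A \<C>"
    have "orth (\<Union>\<C>)"
      unfolding orth_iff
    proof (intro ballI impI)
      fix x y assume "x \<in> \<Union>\<C>" "y \<in> \<Union>\<C>" "x \<noteq> y"
      then obtain X Y where XY: "x \<in> X" "y \<in> Y" "X \<in> \<C>" "Y \<in> \<C>" by auto
      then have "X \<subseteq> Y \<or> Y \<subseteq> X" using C(2) by (auto simp: subset_chain_def)
      moreover have "orth X" "orth Y" using XY C(2) by (auto simp: subset_chain_def)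
      ultimately show "p x y = 0" using XY \<open>x \<noteq> y\<close> by (auto simp: orth_iff)
    qed
    moreover have "G \<subseteq> \<Union>\<C>" "\<Union>\<C> \<subseteq> S" using C unfolding subset_chain_def by fast+
    ultimately show "\<Union>\<C> \<in> ?A" by simp
  qed
  then obtain F where F: "F \<in> ?A" and max: "\<forall>X\<in>?A. F \<subseteq> X \<longrightarrow> X = F" by (rule bexE)
  have fr: "frame_in p S F"
    unfolding frame_in_def
  proof (intro conjI allI impI)
    fix X assume "F \<subseteq> X \<and> X \<subseteq> S \<and> orth X"
    then show "X = F" using F(1) by (intro max[rule_format]) auto
  qed (use F(1) in auto)
  have fin: "finite F" "card F = N" using dim fr by (auto simp: has_dimension_def)
  show thesis
  proof (rule that[of F])
    fix a assume "a \<in> S"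
    then have "(p a has_sum 1) F" using axIII fr by (auto simp: axiom_III_def)
    then have "infsum (p a) F = 1" by (rule infsumI)
    then show "(\<Sum>x\<in>F. p a x) = 1" using fin by simp
  qed (use F fin in auto)
qed

text \<open>Counting replaces maximality: an orthogonal set of \<open>N\<close> states already
  exhausts the frame that extends it.\<close>

lemma frame_sum:
  assumes "F \<subseteq> S" "orth F" "finite F" "card F = N" "a \<in> S"
  shows "(\<Sum>x\<in>F. p a x) = 1"
proof -
  obtain F' where F': "F \<subseteq> F'" "F' \<subseteq> S" "orth F'" "finite F'" "card F' = N"
    "\<And>a. a \<in> S \<Longrightarrow> (\<Sum>x\<in>F'. p a x) = 1"
    using frame_ext[OF assms(1,2)] by blast
  have "F = F'" using F' assms by (metis card_subset_eq)
  then show ?thesis using F' assms by simp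
qed

lemma orth_sum_le:
  assumes "F \<subseteq> S" "orth F" "a \<in> S"
  shows "finite F \<and> card F \<le> N \<and> (\<Sum>x\<in>F. p a x) \<le> 1"
proof -
  obtain F' where F': "F \<subseteq> F'" "F' \<subseteq> S" "orth F'" "finite F'" "card F' = N"
    "\<And>a. a \<in> S \<Longrightarrow> (\<Sum>x\<in>F'. p a x) = 1"
    using frame_ext[OF assms(1,2)] by blast
  have "(\<Sum>x\<in>F. p a x) \<le> (\<Sum>x\<in>F'. p a x)"
    using F' assms by (intro sum_mono2) (auto intro: p_nonneg)
  then show ?thesis using F' assms by (auto intro: finite_subset card_mono)
qed

definition plane :: "'a \<Rightarrow> 'a \<Rightarrow> 'a set" where
  "plane c c' = {z \<in> S. p c z + p c' z = 1}"

lemma planeD: "z \<in> plane c c' \<Longrightarrow> z \<in> S" "z \<in> plane c c' \<Longrightarrow> p c z + p c' z = 1"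
  by (auto simp: plane_def)

lemma orth_neq: "x \<in> S \<Longrightarrow> p x y = 0 \<Longrightarrow> x \<noteq> y"
  using p_self by fastforce

lemma plane_ends:
  assumes "c \<in> S" "c' \<in> S" "p c c' = 0"
  shows "c \<in> plane c c'" "c' \<in> plane c c'"
  using assms p_sym[of c c'] by (auto simp: plane_def)

text \<open>Bessel's inequality for \<open>f\<close>, \<open>c\<close>, \<open>c'\<close>: the last
  two already use up the total weight of \<open>z\<close>.\<close>

lemma plane_orth:
  assumes "c \<in> S" "c' \<in> S" "p c c' = 0" "z \<in> plane c c'" "f \<in> S" "p f c = 0" "p f c' = 0"
  shows "p f z = 0"
proof -
  have n: "c \<noteq> c'" "f \<noteq> c" "f \<noteq> c'" using assms orth_neq by auto
  have z: "z \<in> S" using planeD assms by auto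
  have "orth {f, c, c'}" using assms p_sym by (auto simp: orth_iff)
  then have "p z f + (p z c + p z c') \<le> 1"
    using orth_sum_le[of "{f,c,c'}" z] assms n z by simp
  moreover have "p z c + p z c' = 1" using planeD[OF assms(4)] p_sym assms by simp
  moreover have "0 \<le> p z f" using p_nonneg z assms by auto
  ultimately show ?thesis using p_sym z assms by simp
qed

text \<open>Both sides stand for the projector to one plane. The rest \<open>G\<close> of a frame
  containing \<open>c\<close>, \<open>c'\<close> is orthogonal to \<open>d\<close>,
  \<open>d'\<close> by assumption, so the pairs can be exchanged inside the frame, and both frames
  have total weight 1.\<close>

lemma pair_unit:
  assumes "c \<in> S" "c' \<in> S" "p c c' = 0" "d \<in> S" "d' \<in> S" "p d d' = 0"
    and *: "\<And>f. f \<in> S \<Longrightarrow> p f c = 0 \<Longrightarrow> p f c' = 0 \<Longrightarrow> p f d = 0 \<and> p f d' = 0"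
    and z: "z \<in> S"
  shows "p c z + p c' z = p d z + p d' z"
proof -
  have n: "c \<noteq> c'" "d \<noteq> d'" using assms orth_neq by auto
  have "orth {c, c'}" using assms p_sym by (auto simp: orth_iff)
  then obtain F where F: "{c,c'} \<subseteq> F" "F \<subseteq> S" "orth F" "finite F" "card F = N"
    "\<And>a. a \<in> S \<Longrightarrow> (\<Sum>x\<in>F. p a x) = 1"
    using frame_ext[of "{c,c'}"] assms by auto
  define G where "G = F - {c,c'}"
  have GF: "F = insert c (insert c' G)" "c \<notin> G" "c' \<notin> G" "finite G" "G \<subseteq> S"
    using F by (auto simp: G_def)
  have G0: "p g d = 0 \<and> p g d' = 0" if "g \<in> G" for g
    using that F GF by (intro *) (auto simp: orth_iff)
  have dn: "d \<notin> G" "d' \<notin> G" using G0 GF orth_neq by blast+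
  have "orth (insert d' G)"
    by (rule orth_insert) (use F GF G0 assms p_sym in \<open>auto intro: orth_subset\<close>)
  then have o: "orth (insert d (insert d' G))"
    by (rule orth_insert) (use F GF G0 assms p_sym in \<open>auto intro: orth_subset\<close>)
  have card: "card (insert d (insert d' G)) = N"
    using F(5) GF n dn by simp
  have "(\<Sum>x\<in>insert d (insert d' G). p z x) = 1"
    by (rule frame_sum) (use o card GF assms in auto)
  moreover have "(\<Sum>x\<in>insert c (insert c' G). p z x) = 1"
    using F(6)[OF z] GF by simp
  ultimately have "p z c + p z c' = p z d + p z d'"
    using GF n dn by simp
  then show ?thesis using p_sym z assms by simp
qed

text \<open>The rest of a frame through \<open>c\<close>, \<open>c'\<close> together with
  \<open>x\<close> has \<open>N - 1\<close> elements; the one state that completes it is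
  \<open>x'\<close>.\<close>

lemma plane_complement:
  assumes "c \<in> S" "c' \<in> S" "p c c' = 0" "x \<in> plane c c'"
  obtains x' where "x' \<in> plane c c'" "p x x' = 0" "\<And>z. z \<in> S \<Longrightarrow> p x z + p x' z = p c z + p c' z"
proof -
  have n: "c \<noteq> c'" using assms orth_neq by auto
  have x: "x \<in> S" using planeD assms by auto
  have "orth {c, c'}" using assms p_sym by (auto simp: orth_iff)
  then obtain F where F: "{c,c'} \<subseteq> F" "F \<subseteq> S" "orth F" "finite F" "card F = N"
    "\<And>a. a \<in> S \<Longrightarrow> (\<Sum>x\<in>F. p a x) = 1"
    using frame_ext[of "{c,c'}"] assms by auto
  define G where "G = F - {c,c'}"
  have GF: "F = insert c (insert c' G)" "c \<notin> G" "c' \<notin> G" "finite G" "G \<subseteq> S"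
    using F by (auto simp: G_def)
  have cN: "N = card G + 2" using F(5) GF n by simp
  have G0: "p g x = 0" if "g \<in> G" for g
    by (rule plane_orth[OF assms]) (use that F GF in \<open>auto simp: orth_iff\<close>)
  have xn: "x \<notin> G" using G0 GF orth_neq by blast
  have "orth (insert x G)"
    by (rule orth_insert) (use F GF G0 x p_sym in \<open>auto intro: orth_subset\<close>)
  then obtain F2 where F2: "insert x G \<subseteq> F2" "F2 \<subseteq> S" "orth F2" "finite F2" "card F2 = N"
    "\<And>a. a \<in> S \<Longrightarrow> (\<Sum>x\<in>F2. p a x) = 1"
    using frame_ext[of "insert x G"] GF x by auto
  have "card (F2 - insert x G) = 1"
    using F2 cN xn GF by (subst card_Diff_subset) auto
  then obtain x' where x': "F2 - insert x G = {x'}" by (auto simp: card_1_singleton_iff)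
  then have F2e: "F2 = insert x (insert x' G)" "x' \<notin> insert x G" "x' \<in> S" using F2 by auto
  have s: "p x z + p x' z = p c z + p c' z" if z: "z \<in> S" for z
  proof -
    have "(\<Sum>y\<in>insert x (insert x' G). p z y) = 1" using F2(6)[OF z] F2e by simp
    moreover have "(\<Sum>x\<in>insert c (insert c' G). p z x) = 1"
      using F(6)[OF z] GF by simp
    ultimately have "p z c + p z c' = p z x + p z x'"
      using GF n F2e(2) xn by auto
    then show ?thesis using p_sym z assms x F2e by simp
  qed
  have o: "p x x' = 0" using F2(3) F2e by (auto simp: orth_iff)
  have "x' \<in> plane c c'"
    using s[of x'] o F2e by (auto simp: plane_def)
  then show thesis using that o s by blast
qed

text \<open>Evaluation at \<open>c\<close> and \<open>c'\<close> shows that \<open>a\<close> and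
  \<open>b\<close> have the same weights there; evaluation at \<open>a\<close> then yields
  \<open>(2 * p a c - 1)^2 = p a b\<close>. With p a b = cos^2(t/2) this is p a c = cos^2(t/4):
  \<open>c\<close> bisects the arc from \<open>a\<close> to \<open>b\<close>.\<close>

lemma midpoint:
  assumes ab: "a \<in> S" "b \<in> S" "a \<noteq> b"
  obtains c c' where "c \<in> S" "c' \<in> S" "p c c' = 0" "p a c = (1 + sqrt (p a b)) / 2"
    "\<And>z. z \<in> S \<Longrightarrow> (p a z + p b z) / 2
        = (1 + sqrt (p a b)) / 2 * p c z + (1 - sqrt (p a b)) / 2 * p c' z"
    "a \<in> plane c c'" "b \<in> plane c c'"
proof -
  obtain c c' \<alpha> where c: "c \<in> S" "c' \<in> S" "p c c' = 0" "0 < \<alpha>" "\<alpha> < 1"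
    and eq: "\<And>z. z \<in> S \<Longrightarrow> p a c * p c z + p a c' * p c' z = \<alpha> * p a z + (1 - \<alpha>) * p b z"
    using axIV[unfolded axiom_IV_def orthogonal_states_def, rule_format, OF ab] by blast
  have c'c: "p c' c = 0" using c p_sym by auto
  have bc: "p b c = p a c" "p b c' = p a c'"
  proof -
    have "p a c = \<alpha> * p a c + (1 - \<alpha>) * p b c" using eq[of c] c c'c by simp
    then have "(1 - \<alpha>) * p b c = (1 - \<alpha>) * p a c" by (simp add: algebra_simps)
    then show "p b c = p a c" using c by simp
    have "p a c' = \<alpha> * p a c' + (1 - \<alpha>) * p b c'" using eq[of c'] c by simp
    then have "(1 - \<alpha>) * p b c' = (1 - \<alpha>) * p a c'" by (simp add: algebra_simps)
    then show "p b c' = p a c'" using c by simp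
  qed
  have ea: "p a c * p a c + p a c' * p a c' = \<alpha> + (1 - \<alpha>) * p a b"
    using eq[of a] ab c p_sym by simp
  have eb: "p a c * p a c + p a c' * p a c' = \<alpha> * p a b + (1 - \<alpha>)"
    using eq[of b] ab c p_sym[of c b] p_sym[of c' b] bc by simp
  have ne: "p a b \<noteq> 1" using p_eq_1_iff ab by simp
  have "(2 * \<alpha> - 1) * (1 - p a b) = 0" using ea eb by (simp add: algebra_simps)
  then have al: "\<alpha> = 1/2" using ne by simp
  have n: "c \<noteq> c'" using c orth_neq by auto
  have "orth {c, c'}" using c p_sym by (auto simp: orth_iff)
  then obtain F where F: "{c,c'} \<subseteq> F" "F \<subseteq> S" "orth F" "finite F" "card F = N"
    "\<And>a. a \<in> S \<Longrightarrow> (\<Sum>x\<in>F. p a x) = 1"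
    using frame_ext[of "{c,c'}"] c by auto
  \<comment> \<open>At a frame element outside the pair the left side of Axiom IV vanishes, while
    the right side is a positive combination of nonnegative numbers.\<close>
  have rest: "p a f = 0" if "f \<in> F - {c,c'}" for f
  proof -
    have "p c f = 0" "p c' f = 0" "f \<in> S" using F that by (auto simp: orth_iff)
    then have "p a f + p b f = 0" using eq[of f] al by simp
    then show ?thesis using p_nonneg[of a f] p_nonneg[of b f] ab \<open>f \<in> S\<close> by linarith
  qed
  have "(\<Sum>x\<in>F. p a x) = (\<Sum>x\<in>{c,c'}. p a x)"
    using F rest by (intro sum.mono_neutral_right) auto
  then have s1: "p a c + p a c' = 1" using F(6)[of a] ab n by simp
  have pl: "a \<in> plane c c'" "b \<in> plane c c'"
    using s1 bc ab c p_sym[of c a] p_sym[of c' a] p_sym[of c b] p_sym[of c' b] by (auto simp: plane_def)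
  then have pl': "a \<in> plane c' c" "b \<in> plane c' c" by (auto simp: plane_def)
  have "(2 * p a c - 1)^2 = p a b"
  proof -
    have "p a c' = 1 - p a c" using s1 by simp
    then have "p a c * p a c + (1 - p a c) * (1 - p a c) = 1/2 + 1/2 * p a b" using ea al by simp
    then show ?thesis by (simp add: power2_eq_square algebra_simps)
  qed
  then have sq: "\<bar>2 * p a c - 1\<bar> = sqrt (p a b)" by (metis real_sqrt_abs)
  have eq2: "(p a z + p b z) / 2 = p a c * p c z + p a c' * p c' z" if "z \<in> S" for z
    using eq[OF that] al by simp
  \<comment> \<open>The sign of \<open>2 * p a c - 1\<close> only decides which of \<open>c\<close>,
    \<open>c'\<close> is the one closer to \<open>a\<close>.\<close>
  show thesis
  proof (cases "2 * p a c - 1 \<ge> 0")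
    case True
    then have e: "p a c = (1 + sqrt (p a b)) / 2" "p a c' = (1 - sqrt (p a b)) / 2"
      using sq s1 by (auto simp: field_simps)
    show thesis
      by (rule that[OF c(1-3) e(1) eq2[unfolded e] pl])
  next
    case False
    then have e: "p a c' = (1 + sqrt (p a b)) / 2" "p a c = (1 - sqrt (p a b)) / 2"
      using sq s1 by (auto simp: field_simps)
    have "(p a z + p b z) / 2
        = (1 + sqrt (p a b)) / 2 * p c' z + (1 - sqrt (p a b)) / 2 * p c z" if "z \<in> S" for z
      using eq2[OF that, unfolded e] by simp
    then show thesis
      by (rule that[OF c(2,1) c'c e(1) _ pl'])
  qed
qed

text \<open>Inductive, because every transfer from states to observables, of linear identities as
  well as of continuity, is an induction over the formation of linear combinations.\<close>

inductive observable :: "('a \<Rightarrow> real) \<Rightarrow> bool" where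
  state: "x \<in> S \<Longrightarrow> observable (p x)"
| add: "observable f \<Longrightarrow> observable g \<Longrightarrow> observable (\<lambda>z. f z + g z)"
| scale: "observable f \<Longrightarrow> observable (\<lambda>z. r * f z)"

lemma observable_uminus: "observable f \<Longrightarrow> observable (\<lambda>z. - f z)"
  using scale[of f "-1"] by simp

lemma observable_diff: "observable f \<Longrightarrow> observable g \<Longrightarrow> observable (\<lambda>z. f z - g z)"
  using add[of f "\<lambda>z. - g z"] observable_uminus by simp

lemma observable_divide: "observable f \<Longrightarrow> observable (\<lambda>z. f z / r)"
  using scale[of f "1/r"] by simp

lemma observable_linear:
  assumes "observable f" "a \<in> S" "b \<in> S" "c \<in> S" "d \<in> S"
    and "\<And>h. h \<in> S \<Longrightarrow> \<alpha> * p a h + \<beta> * p b h = \<gamma> * p c h + \<delta> * p d h"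
  shows "\<alpha> * f a + \<beta> * f b = \<gamma> * f c + \<delta> * f d"
  using assms(1)
proof induction
  case (state x)
  then show ?case using assms(6)[of x] assms p_sym[of x] by simp
next
  case (add f g)
  then show ?case by (simp add: algebra_simps)
next
  case (scale f r)
  then have "r * (\<alpha> * f a + \<beta> * f b) = r * (\<gamma> * f c + \<delta> * f d)" by simp
  then show ?case by (simp add: algebra_simps)
qed

lemma observable_pair_sum:
  assumes "observable f" "a \<in> S" "b \<in> S" "c \<in> S" "d \<in> S"
    and "\<And>h. h \<in> S \<Longrightarrow> p a h + p b h = p c h + p d h"
  shows "f a + f b = f c + f d"
  using observable_linear[OF assms(1-5), of 1 1 1 1] assms(6) by simp

end

section \<open>Observables on planes\<close>

context transition_system begin

text \<open>\<open>c\<close> lies at half the angle of \<open>x\<close> from \<open>a\<close>. The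
  partner \<open>c'\<close> of \<open>midpoint\<close> is eliminated by
  \<open>f c + f c' = f a + f a'\<close>, valid because both pairs span the same plane.\<close>

lemma plane_halving:
  assumes a: "a \<in> S" "a' \<in> S" "p a a' = 0" and x: "x \<in> plane a a'" "x \<noteq> a"
  obtains c where "c \<in> plane a a'" "p a c = (1 + sqrt (p a x)) / 2"
    "\<And>f. observable f \<Longrightarrow> (f a + f x) / 2
        = (1 + sqrt (p a x)) / 2 * f c + (1 - sqrt (p a x)) / 2 * (f a + f a' - f c)"
proof -
  have xS: "x \<in> S" using x planeD by auto
  have ne: "a \<noteq> x" using x by simp
  obtain c c' where c: "c \<in> S" "c' \<in> S" "p c c' = 0" "p a c = (1 + sqrt (p a x)) / 2"
    and eq: "\<And>z. z \<in> S \<Longrightarrow> (p a z + p x z) / 2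
        = (1 + sqrt (p a x)) / 2 * p c z + (1 - sqrt (p a x)) / 2 * p c' z"
    by (rule midpoint[OF a(1) xS ne]) (rule that)
  have "p a x \<noteq> 1" using p_eq_1_iff a xS x by auto
  then have lt: "sqrt (p a x) < 1" "0 \<le> sqrt (p a x)"
    using p_le_1[OF a(1) xS] p_nonneg[OF a(1) xS] by auto
  have un: "p a z + p a' z = p c z + p c' z" if z: "z \<in> S" for z
  proof (rule pair_unit[OF a c(1-3) _ z])
    fix f assume f: "f \<in> S" "p f a = 0" "p f a' = 0"
    have "p f x = 0" by (rule plane_orth[OF a x(1) f])
    then have "(1 + sqrt (p a x)) / 2 * p c f + (1 - sqrt (p a x)) / 2 * p c' f = 0"
      using eq[OF f(1)] f p_sym a xS by simp
    moreover have "0 \<le> (1 + sqrt (p a x)) / 2 * p c f" "0 \<le> (1 - sqrt (p a x)) / 2 * p c' f"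
      using p_nonneg c f lt by auto
    ultimately have "(1 + sqrt (p a x)) / 2 * p c f = 0" "(1 - sqrt (p a x)) / 2 * p c' f = 0"
      by linarith+
    then show "p f c = 0 \<and> p f c' = 0" using lt p_sym c f by auto
  qed
  show thesis
  proof (rule that[of c])
    show "c \<in> plane a a'" using un[of c] c(1-3) p_sym[of c' c] by (simp add: plane_def)
    show "p a c = (1 + sqrt (p a x)) / 2" by fact
    fix f assume f: "observable f"
    have "1/2 * f a + 1/2 * f x = (1 + sqrt (p a x)) / 2 * f c + (1 - sqrt (p a x)) / 2 * f c'"
    proof (rule observable_linear[OF f a(1) xS c(1,2)])
      fix h assume "h \<in> S"
      then show "1/2 * p a h + 1/2 * p x h
        = (1 + sqrt (p a x)) / 2 * p c h + (1 - sqrt (p a x)) / 2 * p c' h"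
        using eq[of h] by (simp add: add_divide_distrib)
    qed
    moreover have "f a + f a' = f c + f c'"
      by (rule observable_pair_sum[OF f a(1,2) c(1,2) un])
    ultimately show "(f a + f x) / 2
        = (1 + sqrt (p a x)) / 2 * f c + (1 - sqrt (p a x)) / 2 * (f a + f a' - f c)"
      by (simp add: field_simps)
  qed
qed

text \<open>Write p a z as cos^2(t/2). The difference \<open>g\<close> of the two sides vanishes at
  \<open>a\<close> and \<open>a'\<close>, and under repeated halving of t it stays proportional to
  sin t, hence is of first order at \<open>a\<close>. Maximality at \<open>a\<close> leaves room
  only for second order, so a positive value is impossible.\<close>

lemma observable_on_plane_le:
  assumes a: "a \<in> S" "a' \<in> S" "p a a' = 0" and f: "observable f"
    and max: "\<And>x. x \<in> plane a a' \<Longrightarrow> f x \<le> f a"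
    and x: "x \<in> plane a a'"
  shows "f x \<le> f a * p a x + f a' * p a' x"
proof (rule ccontr)
  assume neg: "\<not> ?thesis"
  define g where "g z = f z - f a * p a z - f a' * p a' z" for z
  define D where "D = f a - f a'"
  have D0: "0 \<le> D" using max[OF plane_ends(2)[OF a]] by (simp add: D_def)
  have aa: "p a' a = 0" using a p_sym by auto
  have gobs: "observable g"
    unfolding g_def using f a by (intro observable_diff observable.intros)
  have g0: "g a = 0" "g a' = 0" using a aa by (auto simp: g_def)
  have gle: "g z \<le> D * (1 - p a z)" if "z \<in> plane a a'" for z
  proof -
    have "p a' z = 1 - p a z" using planeD(2)[OF that] by simp
    show ?thesis unfolding g_def D_def \<open>p a' z = 1 - p a z\<close> using max[OF that] by (simp add: algebra_simps)
  qed
  \<comment> \<open>Positivity of \<open>g z\<close> keeps \<open>z\<close> away from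
    \<open>a\<close>, so that halving applies, and from \<open>a'\<close>, so that
    \<open>sqrt (p a z)\<close> is nonzero.\<close>
  have step: "\<exists>c. c \<in> plane a a' \<and> p a c = (1 + sqrt (p a z)) / 2 \<and> g c = g z / (2 * sqrt (p a z))"
    if z: "z \<in> plane a a'" "g z > 0" for z
  proof -
    have zS: "z \<in> S" using z planeD by auto
    have "z \<noteq> a" "z \<noteq> a'" using z g0 by auto
    then have "p a' z \<noteq> 1" using p_eq_1_iff[of a' z] a zS by auto
    then have p0: "p a z > 0" using planeD[OF z(1)] p_nonneg[OF a(1) zS] by linarith
    obtain c where c: "c \<in> plane a a'" "p a c = (1 + sqrt (p a z)) / 2"
      and eq: "\<And>f. observable f \<Longrightarrow> (f a + f z) / 2
        = (1 + sqrt (p a z)) / 2 * f c + (1 - sqrt (p a z)) / 2 * (f a + f a' - f c)"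
      using plane_halving[OF a z(1) \<open>z \<noteq> a\<close>] by blast
    have "g z / 2 = sqrt (p a z) * g c" using eq[OF gobs] g0 by (simp add: field_simps)
    then have "g c = g z / (2 * sqrt (p a z))" using p0 by (simp add: field_simps)
    then show ?thesis using c by blast
  qed
  \<comment> \<open>Halving preserves the ratio \<open>g\<^sup>2 / (p a (1 - p a))\<close>, while \<open>gle\<close> forces it to tend to 0.\<close>
  define Q where "Q n z \<longleftrightarrow> z \<in> plane a a' \<and> g z > 0 \<and> 1 - p a z \<le> (1/2)^n
     \<and> (g z)^2 * (p a x * (1 - p a x)) = (g x)^2 * (p a z * (1 - p a z))" for n z
  have "\<exists>z. Q n z" for n
  proof (induction n)
    case 0
    have "Q 0 x" using neg x p_nonneg[OF a(1)] planeD[OF x] by (auto simp: Q_def g_def)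
    then show ?case by blast
  next
    case (Suc n)
    then obtain z where z: "Q n z" by blast
    then have zp: "z \<in> plane a a'" "g z > 0" by (auto simp: Q_def)
    then have zS: "z \<in> S" using planeD by auto
    obtain c where c: "c \<in> plane a a'" "p a c = (1 + sqrt (p a z)) / 2" "g c = g z / (2 * sqrt (p a z))"
      using step[OF zp] by blast
    have "z \<noteq> a'" using zp g0 by auto
    then have "p a' z \<noteq> 1" using p_eq_1_iff[of a' z] a zS by auto
    then have p0: "p a z > 0" using planeD[OF zp(1)] p_nonneg[OF a(1) zS] by linarith
    define s where "s = sqrt (p a z)"
    have s: "s > 0" "s \<le> 1" "p a z = s * s" using p0 p_le_1[OF a(1) zS] by (auto simp: s_def)
    have pc: "1 - p a c = (1 - s) / 2" "p a c = (1 + s) / 2" "g c = g z / (2 * s)"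
      using c by (auto simp: s_def field_simps)
    have "s * s \<le> s" using s by (simp add: mult_left_le)
    then have "1 - p a c \<le> (1 - p a z) / 2" using pc s by simp
    also have "\<dots> \<le> (1/2)^Suc n" using z by (simp add: Q_def)
    finally have 1: "1 - p a c \<le> (1/2)^Suc n" .
    have e: "(g z)^2 * (p a x * (1 - p a x)) = (g x)^2 * (s * s * (1 - s * s))"
      using z s by (simp add: Q_def)
    have "(g c)^2 * (p a x * (1 - p a x)) = ((g z)^2 * (p a x * (1 - p a x))) / (4 * s^2)"
      using pc by (simp add: power_divide power_mult_distrib)
    also have "\<dots> = (g x)^2 * (s * s * (1 - s * s)) / (4 * s^2)" using e by simp
    also have "\<dots> = (g x)^2 * (p a c * (1 - p a c))"
      unfolding pc(1) unfolding pc(2) using s by (simp add: field_simps power2_eq_square)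
    finally have e2: "(g c)^2 * (p a x * (1 - p a x)) = (g x)^2 * (p a c * (1 - p a c))" .
    have "g c > 0" using pc(3) zp s by simp
    then have "Q (Suc n) c" unfolding Q_def using c(1) 1 e2 by blast
    then show ?case by blast
  qed
  then obtain Z where Z: "\<And>n. Q n (Z n)" by metis
  have gx: "g x > 0" using neg by (simp add: g_def)
  \<comment> \<open>Squaring \<open>gle\<close>, inserting the invariant ratio and dividing by
    \<open>1 - p a ?z\<close> leaves a right side that still tends to 0.\<close>
  have bound: "(g x)^2 * (1 - (1/2)^n) \<le> D^2 * (1/2)^n" for n
  proof -
    let ?z = "Z n"
    have z: "?z \<in> plane a a'" "g ?z > 0" "1 - p a ?z \<le> (1/2)^n"
       "(g ?z)^2 * (p a x * (1 - p a x)) = (g x)^2 * (p a ?z * (1 - p a ?z))" using Z[of n] by (auto simp: Q_def)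
    have zS: "?z \<in> S" using z planeD by auto
    have xS: "x \<in> S" using x planeD by auto
    have pz: "0 \<le> p a ?z" "p a ?z \<le> 1" using p_nonneg p_le_1 a zS by auto
    have px: "0 \<le> p a x" "p a x \<le> 1" using p_nonneg p_le_1 a xS by auto
    have "?z \<noteq> a" using z g0 by auto
    then have z1: "1 - p a ?z > 0" using p_eq_1_iff[OF a(1) zS] pz by fastforce
    have "(g ?z)^2 \<le> (D * (1 - p a ?z))^2" using gle[OF z(1)] z(2) by (intro power_mono) auto
    moreover have "p a x * (1 - p a x) \<le> 1" using px by (intro mult_le_one) auto
    ultimately have "(g ?z)^2 * (p a x * (1 - p a x)) \<le> (D * (1 - p a ?z))^2 * 1"
      using px by (intro mult_mono) auto
    then have "(1 - p a ?z) * ((g x)^2 * p a ?z) \<le> (1 - p a ?z) * (D^2 * (1 - p a ?z))"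
      using z(4) by (simp add: power2_eq_square algebra_simps)
    then have "(g x)^2 * p a ?z \<le> D^2 * (1 - p a ?z)" using z1 by simp
    moreover have "D^2 * (1 - p a ?z) \<le> D^2 * (1/2)^n" using z(3) by (intro mult_left_mono) auto
    moreover have "(g x)^2 * (1 - (1/2)^n) \<le> (g x)^2 * p a ?z" using z(3) by (intro mult_left_mono) auto
    ultimately show ?thesis by linarith
  qed
  have "(\<lambda>n. (g x)^2 * (1 - (1/2)^n)) \<longlonglongrightarrow> (g x)^2 * (1 - 0)"
    by (intro tendsto_intros LIMSEQ_power_zero) auto
  moreover have "(\<lambda>n. D^2 * (1/2)^n) \<longlonglongrightarrow> D^2 * 0"
    by (intro tendsto_intros LIMSEQ_power_zero) auto
  ultimately have "(g x)^2 * (1 - 0) \<le> D^2 * 0"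
    by (rule LIMSEQ_le) (use bound in blast)
  then show False using gx by simp
qed

text \<open>The upper bound at the antipode \<open>x'\<close> is the lower bound at
  \<open>x\<close>, because \<open>f\<close> has the same sum over all orthogonal pairs of the
  plane.\<close>

lemma observable_on_plane:
  assumes a: "a \<in> S" "a' \<in> S" "p a a' = 0" and f: "observable f"
    and max: "\<And>x. x \<in> plane a a' \<Longrightarrow> f x \<le> f a"
    and x: "x \<in> plane a a'"
  shows "f x = f a * p a x + f a' * p a' x"
proof (rule antisym)
  show "f x \<le> f a * p a x + f a' * p a' x"
    by (rule observable_on_plane_le[OF a f max x])
  obtain x' where x': "x' \<in> plane a a'" "\<And>z. z \<in> S \<Longrightarrow> p x z + p x' z = p a z + p a' z"
    using plane_complement[OF a x] by blast
  have S: "x \<in> S" "x' \<in> S" using x x' planeD by auto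
  have "f x' \<le> f a * p a x' + f a' * p a' x'"
    by (rule observable_on_plane_le[OF a f max x'(1)])
  moreover have "f x + f x' = f a + f a'"
    by (rule observable_pair_sum[OF f S a(1,2) x'(2)])
  moreover have "p a x' = 1 - p a x" "p a' x' = 1 - p a' x"
    using x'(2)[of a] x'(2)[of a'] p_sym a S by auto
  ultimately show "f a * p a x + f a' * p a' x \<le> f x"
    by (simp add: algebra_simps)
qed

lemma observable_on_plane_min:
  assumes a: "a \<in> S" "a' \<in> S" "p a a' = 0" and f: "observable f"
    and min: "\<And>x. x \<in> plane a a' \<Longrightarrow> f a \<le> f x"
    and x: "x \<in> plane a a'"
  shows "f x = f a * p a x + f a' * p a' x"
proof -
  have "- f x = (- f a) * p a x + (- f a') * p a' x"
    by (rule observable_on_plane[OF a observable_uminus[OF f] _ x]) (use min in simp)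
  then show ?thesis by simp
qed

text \<open>\<open>p f\<close> attains its least value 0 at \<open>a\<close>, so it is diagonal in
  \<open>a\<close>, \<open>a'\<close>: a state orthogonal to \<open>a\<close> sees only the
  component of \<open>x\<close> along \<open>a'\<close>.\<close>

lemma plane_transfer:
  assumes a: "a \<in> S" "a' \<in> S" "p a a' = 0" "x \<in> plane a a'" "f \<in> S" "p f a = 0"
  shows "p f x = p f a' * p a' x"
proof -
  have "p f x = p f a * p a x + p f a' * p a' x"
    by (rule observable_on_plane_min[OF a(1-3) observable.state[OF a(5)] _ a(4)])
      (use a p_nonneg planeD in auto)
  then show ?thesis using a by simp
qed

text \<open>The last conclusion places \<open>a'\<close> in the span of \<open>a\<close> and
  \<open>b\<close>. It comes from \<open>plane_transfer\<close>, since \<open>b\<close> differs from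
  \<open>a\<close> and so has positive weight at \<open>a'\<close>.\<close>

lemma plane_through:
  assumes "a \<in> S" "b \<in> S" "a \<noteq> b"
  obtains a' where "a' \<in> S" "p a a' = 0" "b \<in> plane a a'"
    "\<And>f. f \<in> S \<Longrightarrow> p f a = 0 \<Longrightarrow> p f b = 0 \<Longrightarrow> p f a' = 0"
proof -
  obtain c c' where c: "c \<in> S" "c' \<in> S" "p c c' = 0" "a \<in> plane c c'" "b \<in> plane c c'"
    by (rule midpoint[OF assms]) (rule that)
  obtain a' where a': "a' \<in> plane c c'" "p a a' = 0" "\<And>z. z \<in> S \<Longrightarrow> p a z + p a' z = p c z + p c' z"
    using plane_complement[OF c(1-4)] by blast
  have S: "a' \<in> S" using a' planeD by auto
  have b: "b \<in> plane a a'" using a' planeD[OF c(5)] by (auto simp: plane_def)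
  show thesis
  proof (rule that[OF S a'(2) b])
    fix f assume f: "f \<in> S" "p f a = 0" "p f b = 0"
    have "p a b \<noteq> 1" using p_eq_1_iff assms by auto
    then have "p a' b \<noteq> 0" using planeD[OF b] by linarith
    then show "p f a' = 0" using plane_transfer[OF assms(1) S a'(2) b f(1,2)] f(3) by simp
  qed
qed

text \<open>Gram-Schmidt: \<open>y\<close> is the normalised projection of \<open>z\<close> to the
  complement of \<open>G\<close>. A new element \<open>g\<close> is split off in the plane through
  \<open>g\<close> and the previous projection, where \<open>plane_transfer\<close> rescales all
  probabilities by one factor.\<close>

lemma projection:
  assumes "finite G" "G \<subseteq> S" "orth G" "z \<in> S" "(\<Sum>g\<in>G. p z g) < 1"
  shows "\<exists>y\<in>S. (\<forall>g\<in>G. p g y = 0) \<and>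
    (\<forall>f\<in>S. (\<forall>g\<in>G. p g f = 0) \<longrightarrow> p z f = (1 - (\<Sum>g\<in>G. p z g)) * p y f)"
  using assms
proof (induction G)
  case empty
  then show ?case by (intro bexI[of _ z]) auto
next
  case (insert g G)
  have gS: "g \<in> S" "G \<subseteq> S" and oG: "orth G" and gG: "\<And>h. h \<in> G \<Longrightarrow> p h g = 0"
    using insert by (auto simp: orth_iff)
  have zg: "0 \<le> p z g" using p_nonneg insert gS by auto
  have sum: "(\<Sum>h\<in>insert g G. p z h) = p z g + (\<Sum>h\<in>G. p z h)" using insert by simp
  define s where "s = 1 - (\<Sum>h\<in>G. p z h)"
  have s: "p z g < s" using sum insert.prems by (simp add: s_def)
  have "(\<Sum>h\<in>G. p z h) < 1" using sum zg insert.prems(4) by linarith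
  then obtain y where y: "y \<in> S" "\<forall>h\<in>G. p h y = 0"
    and yp: "\<forall>f\<in>S. (\<forall>h\<in>G. p h f = 0) \<longrightarrow> p z f = s * p y f"
    using insert.IH[OF gS(2) oG insert.prems(3)] unfolding s_def by blast
  have zg_eq: "p z g = s * p y g" using yp gS(1) gG by blast
  \<comment> \<open>If \<open>g\<close> were the previous projection, it would carry the whole
    remaining weight \<open>s\<close>, and nothing would be left to project.\<close>
  have yg: "g \<noteq> y" using zg_eq s gS by auto
  obtain y' where y': "y' \<in> S" "p g y' = 0" "y \<in> plane g y'"
    "\<And>f. f \<in> S \<Longrightarrow> p f g = 0 \<Longrightarrow> p f y = 0 \<Longrightarrow> p f y' = 0"
    by (rule plane_through[OF gS(1) y(1) yg]) (rule that)
  have yy: "s * p y' y = s - p z g"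
  proof -
    have "p y' y = 1 - p y g" using planeD(2)[OF y'(3)] p_sym[OF gS(1) y(1)] by simp
    then show ?thesis using zg_eq by (simp add: right_diff_distrib)
  qed
  show ?case
  proof (intro bexI[of _ y'] conjI ballI impI)
    show "p h y' = 0" if "h \<in> insert g G" for h
    proof (cases "h = g")
      case False
      then have "h \<in> G" "h \<in> S" using that gS by auto
      then show ?thesis using y'(4) gG y(2) by blast
    qed (use y' in simp)
    fix f assume f: "f \<in> S" "\<forall>h\<in>insert g G. p h f = 0"
    have "p f y = p f y' * p y' y"
      using plane_transfer[OF gS(1) y'(1-3) f(1)] f p_sym gS by simp
    then have "p z f = (s * p y' y) * p f y'"
      using yp f p_sym[OF f(1) y(1)] by simp
    then show "p z f = (1 - (\<Sum>h\<in>insert g G. p z h)) * p y' f"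
      unfolding yy sum p_sym[OF f(1) y'(1)] by (simp add: s_def)
  qed (use y' in auto)
qed

end

section \<open>Bloch spheres\<close>

context transition_system begin

section \<open>Continuity, compactness and the spectral theorem on a plane\<close>

lemma state_dist_ge:
  assumes "x \<in> S" "y \<in> S" "z \<in> S"
  shows "\<bar>p x z - p y z\<bar> \<le> state_dist S p x y"
proof -
  have "bdd_above ((\<lambda>z. \<bar>p x z - p y z\<bar>) ` S)"
  proof (rule bdd_aboveI2)
    fix w assume "w \<in> S"
    then show "\<bar>p x w - p y w\<bar> \<le> 1"
      using p_nonneg[of x w] p_nonneg[of y w] p_le_1[of x w] p_le_1[of y w] assms by linarith
  qed
  then have "\<bar>p x z - p y z\<bar> \<le> (SUP z\<in>S. \<bar>p x z - p y z\<bar>)"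
    using assms by (intro cSUP_upper)
  then show ?thesis using assms by (simp add: state_dist_def)
qed

abbreviation state_topology :: "'a topology" where
  "state_topology \<equiv> Metric_space.mtopology S (state_dist S p)"

text \<open>By symmetry \<open>p x z\<close> is the value of the function \<open>z\<close> at the
  point \<open>x\<close>, so it is 1-Lipschitz for the metric.\<close>

lemma observable_continuous: "observable f \<Longrightarrow> continuous_map state_topology euclideanreal f"
proof (induction rule: observable.induct)
  interpret Metric_space S "state_dist S p" by (rule Metric_space_state_dist[OF prob axI])
  case (state x)
  show ?case
    unfolding continuous_map_from_metric
  proof (intro conjI ballI allI impI)
    fix a U assume a: "a \<in> S" and "openin euclideanreal U \<and> p x a \<in> U"
    then obtain e where e: "e > 0" "\<And>y. dist y (p x a) < e \<Longrightarrow> y \<in> U"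
      unfolding open_openin[symmetric] open_dist by blast
    have "p x z \<in> U" if "z \<in> S" "state_dist S p a z < e" for z
      using state_dist_ge[OF a that(1) state] that p_sym[OF a state] p_sym[OF that(1) state]
      by (intro e(2)) (simp add: dist_real_def)
    then show "\<exists>r>0. \<forall>z. z \<in> S \<and> state_dist S p a z < r \<longrightarrow> p x z \<in> U"
      using e(1) by blast
  qed simp
next
  case (add f g)
  then show ?case by (intro continuous_map_add)
next
  case (scale f r)
  then show ?case by (intro continuous_map_real_mult_left)
qed

lemma state_topspace: "topspace state_topology = S"
  using Metric_space.topspace_mtopology[OF Metric_space_state_dist[OF prob axI]] .

lemma compact_attains_max:
  assumes C: "closedin state_topology C" "C \<noteq> {}" and f: "observable f"
  obtains x where "x \<in> C" "\<And>y. y \<in> C \<Longrightarrow> f y \<le> f x"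
proof -
  have "compactin state_topology C"
    using axII C(1) unfolding axiom_II_def by (rule closedin_compact_space)
  then have "compactin euclideanreal (f ` C)"
    using observable_continuous[OF f] by (rule image_compactin)
  then have "compact (f ` C)" by simp
  then obtain m where "m \<in> f ` C" "\<forall>y\<in>f ` C. y \<le> m"
    using compact_attains_sup[of "f ` C"] C(2) by auto
  then show thesis using that by auto
qed

lemma observable_attains_max:
  assumes "observable f" "S \<noteq> {}"
  obtains x where "x \<in> S" "\<And>y. y \<in> S \<Longrightarrow> f y \<le> f x"
proof (rule compact_attains_max[OF _ assms(2,1)])
  show "closedin state_topology S" using state_topspace by (metis closedin_topspace)
qed (rule that)

lemma plane_closed:
  assumes "a \<in> S" "a' \<in> S"
  shows "closedin state_topology (plane a a')"
proof -
  have "observable (\<lambda>z. p a z + p a' z)" by (intro observable.intros assms)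
  then have "closedin state_topology {z \<in> topspace state_topology. p a z + p a' z \<in> {1}}"
    by (intro closedin_continuous_map_preimage[OF observable_continuous]) auto
  then show ?thesis by (simp add: plane_def state_topspace)
qed

text \<open>Evaluation at \<open>x\<close> separates \<open>x\<close> from \<open>y\<close> by 1/2,
  which total boundedness allows only finitely often. For Bloch directions this makes the sphere
  finite-dimensional.\<close>

lemma separated_finite:
  assumes "B \<subseteq> S" and sep: "\<And>x y. x \<in> B \<Longrightarrow> y \<in> B \<Longrightarrow> x \<noteq> y \<Longrightarrow> p x y \<le> 1/2"
  shows "finite B"
proof -
  interpret Metric_space S "state_dist S p" by (rule Metric_space_state_dist[OF prob axI])
  have "mtotally_bounded S"
    using axII compactin_imp_mtotally_bounded[of S] by (simp add: axiom_II_def compact_space_def)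
  then obtain K where K: "finite K" "K \<subseteq> S" "S \<subseteq> (\<Union>x\<in>K. mball x (1/4))"
    unfolding mtotally_bounded_def by (meson zero_less_divide_1_iff zero_less_numeral)
  have "\<forall>x\<in>B. \<exists>k\<in>K. x \<in> mball k (1/4)" using K assms by blast
  then obtain h where h: "\<And>x. x \<in> B \<Longrightarrow> h x \<in> K \<and> x \<in> mball (h x) (1/4)" by metis
  have "inj_on h B"
  proof (rule inj_onI, rule ccontr)
    fix x y assume xy: "x \<in> B" "y \<in> B" "h x = h y" "x \<noteq> y"
    have S: "x \<in> S" "y \<in> S" "h y \<in> S" using xy assms h K by auto
    have "state_dist S p x y \<le> state_dist S p x (h y) + state_dist S p (h y) y"
      by (rule triangle) (use S in auto)
    also have "\<dots> < 1/4 + 1/4"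
      using h[OF xy(1)] h[OF xy(2)] xy(3) commute[of x "h y"] by simp
    finally have "state_dist S p x y < 1/2" by simp
    moreover have "1/2 \<le> \<bar>p x x - p y x\<bar>"
      using sep[OF xy(2,1)] xy(4) S by simp
    ultimately show False using state_dist_ge[OF S(1,2,1)] by linarith
  qed
  moreover have "h ` B \<subseteq> K" using h by auto
  ultimately show ?thesis using K(1) by (metis finite_imageD finite_subset)
qed

lemma plane_cong:
  assumes "\<And>z. z \<in> S \<Longrightarrow> p y z + p y' z = p a z + p a' z"
  shows "plane y y' = plane a a'"
  using assms by (auto simp: plane_def)

text \<open>A maximum of \<open>f\<close> on the compact plane is one eigenstate, and its antipode
  is the other.\<close>

lemma plane_spectral:
  assumes a: "a \<in> S" "a' \<in> S" "p a a' = 0" and f: "observable f"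
  obtains y y' where "y \<in> plane a a'" "y' \<in> plane a a'" "p y y' = 0"
    "\<And>z. z \<in> S \<Longrightarrow> p y z + p y' z = p a z + p a' z"
    "\<And>x. x \<in> plane a a' \<Longrightarrow> f x = f y * p y x + f y' * p y' x"
proof -
  obtain y where y: "y \<in> plane a a'" "\<And>z. z \<in> plane a a' \<Longrightarrow> f z \<le> f y"
    using compact_attains_max[OF plane_closed[OF a(1,2)] _ f] plane_ends[OF a] by blast
  obtain y' where y': "y' \<in> plane a a'" "p y y' = 0" "\<And>z. z \<in> S \<Longrightarrow> p y z + p y' z = p a z + p a' z"
    using plane_complement[OF a y(1)] by blast
  have eq: "plane y y' = plane a a'" by (rule plane_cong) (rule y'(3))
  show thesis
  proof (rule that[OF y(1) y'(1,2,3)])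
    fix x assume "x \<in> plane a a'"
    then show "f x = f y * p y x + f y' * p y' x"
      using y(2) eq by (intro observable_on_plane[OF planeD(1)[OF y(1)] planeD(1)[OF y'(1)] y'(2) f]) auto
  qed
qed

text \<open>The value 1/2 means a central angle of 90 degrees: this is a maximal orthonormal system
  of directions on the Bloch sphere, not a set of orthogonal states.\<close>

definition bloch_basis :: "'a \<Rightarrow> 'a \<Rightarrow> 'a set \<Rightarrow> bool" where
  "bloch_basis a a' B \<longleftrightarrow> finite B \<and> B \<subseteq> plane a a' \<and>
     (\<forall>x\<in>B. \<forall>y\<in>B. x \<noteq> y \<longrightarrow> p x y = 1/2) \<and>
     (\<forall>z\<in>plane a a'. (\<forall>x\<in>B. p x z = 1/2) \<longrightarrow> False)"

lemma bloch_basis_exists: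
  assumes a: "a \<in> S" "a' \<in> S" "p a a' = 0"
  obtains B where "bloch_basis a a' B" "a \<in> B"
proof -
  let ?A = "{B. a \<in> B \<and> B \<subseteq> plane a a' \<and> (\<forall>x\<in>B. \<forall>y\<in>B. x \<noteq> y \<longrightarrow> p x y = 1/2)}"
  have "\<exists>M\<in>?A. \<forall>X\<in>?A. M \<subseteq> X \<longrightarrow> X = M"
  proof (rule subset_Zorn_nonempty)
    have "{a} \<in> ?A" using plane_ends[OF a] by auto
    then show "?A \<noteq> {}" by blast
    fix \<C> assume C: "\<C> \<noteq> {}" "subset.chain ?A \<C>"
    have "p x y = 1/2" if xy: "x \<in> \<Union>\<C>" "y \<in> \<Union>\<C>" "x \<noteq> y" for x y
    proof -
      obtain X Y where XY: "x \<in> X" "y \<in> Y" "X \<in> \<C>" "Y \<in> \<C>" using xy by auto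
      then have "X \<subseteq> Y \<or> Y \<subseteq> X" using C(2) by (auto simp: subset_chain_def)
      then have "\<exists>Z\<in>\<C>. x \<in> Z \<and> y \<in> Z" using XY by blast
      then show ?thesis using C(2) xy(3) unfolding subset_chain_def by blast
    qed
    moreover have "a \<in> \<Union>\<C>" "\<Union>\<C> \<subseteq> plane a a'" using C unfolding subset_chain_def by fast+
    ultimately show "\<Union>\<C> \<in> ?A" by simp
  qed
  then obtain B where B: "B \<in> ?A" and max: "\<forall>X\<in>?A. B \<subseteq> X \<longrightarrow> X = B" by (rule bexE)
  have BS: "B \<subseteq> S" using B planeD(1) by blast
  have fin: "finite B"
    by (rule separated_finite[OF BS]) (use B in auto)
  have full: False if z: "z \<in> plane a a'" "\<forall>x\<in>B. p x z = 1/2" for z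
  proof -
    have zS: "z \<in> S" using planeD(1) z by blast
    have "\<forall>x\<in>B. p z x = 1/2" using z(2) BS p_sym[OF zS] by (metis subsetD)
    then have "insert z B \<in> ?A" using B z by simp
    from max[rule_format, OF this] have "z \<in> B" by blast
    then show False using z(2) p_self[OF zS] by force
  qed
  have B3: "a \<in> B" "B \<subseteq> plane a a'" "\<forall>x\<in>B. \<forall>y\<in>B. x \<noteq> y \<longrightarrow> p x y = 1/2"
    using B by simp_all
  have "bloch_basis a a' B"
    unfolding bloch_basis_def by (intro conjI fin B3(2,3)) (use full in blast)
  then show thesis using that B3(1) by simp
qed

text \<open>2 cos^2(t/2) - 1 = cos t: the inner product of the two Bloch vectors.\<close>

definition bloch :: "'a \<Rightarrow> 'a \<Rightarrow> real" where
  "bloch x y = 2 * p x y - 1"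

text \<open>On the plane the constant 1 equals \<open>p a z + p a' z\<close>, which turns the affine
  expression into a linear one.\<close>

lemma bloch_observable:
  assumes a: "a \<in> S" "a' \<in> S" and x: "x \<in> S"
  obtains f where "observable f" "\<And>z. z \<in> plane a a' \<Longrightarrow> f z = bloch x z"
proof (rule that)
  show "observable (\<lambda>z. 2 * p x z - (p a z + p a' z))"
    by (intro observable_diff observable.intros a x)
  show "\<And>z. z \<in> plane a a' \<Longrightarrow> 2 * p x z - (p a z + p a' z) = bloch x z"
    by (auto simp: bloch_def planeD(2))
qed

text \<open>A combination of Bloch functions changes sign at antipodes, so its two eigenvalues are
  opposite and its spectral form collapses to a multiple of one \<open>bloch y\<close>. This
  replaces addition of vectors in the space around the sphere.\<close>

lemma bloch_combination:
  assumes a: "a \<in> S" "a' \<in> S" "p a a' = 0" and "finite B" "B \<subseteq> plane a a'" "x \<in> plane a a'"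
  obtains k y where "y \<in> plane a a'"
    "\<And>z. z \<in> plane a a' \<Longrightarrow> r * bloch x z + (\<Sum>b\<in>B. s b * bloch b z) = k * bloch y z"
proof -
  have BS: "B \<subseteq> S" using assms planeD(1) by blast
  have "\<exists>f. observable f \<and> (\<forall>z\<in>plane a a'. f z = r * bloch x z + (\<Sum>b\<in>B. s b * bloch b z))"
    using \<open>finite B\<close> BS
  proof (induction B)
    case empty
    obtain f where "observable f" "\<And>z. z \<in> plane a a' \<Longrightarrow> f z = bloch x z"
      using bloch_observable[OF a(1,2) planeD(1)[OF assms(6)]] by blast
    then show ?case using observable.scale[of f r] by (intro exI[of _ "\<lambda>z. r * f z"]) auto
  next
    case (insert b B)
    then obtain f where f: "observable f"
      "\<forall>z\<in>plane a a'. f z = r * bloch x z + (\<Sum>b\<in>B. s b * bloch b z)" by auto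
    have "b \<in> S" using insert by auto
    then obtain g where g: "observable g" "\<And>z. z \<in> plane a a' \<Longrightarrow> g z = bloch b z"
      using bloch_observable[OF a(1,2)] by blast
    have "observable (\<lambda>z. f z + s b * g z)" using f g by (intro observable.intros)
    then show ?case using f(2) g(2) insert(1,2)
      by (intro exI[of _ "\<lambda>z. f z + s b * g z"]) auto
  qed
  then obtain f where f: "observable f"
    "\<And>z. z \<in> plane a a' \<Longrightarrow> f z = r * bloch x z + (\<Sum>b\<in>B. s b * bloch b z)" by blast
  obtain y y' where y: "y \<in> plane a a'" "y' \<in> plane a a'" "p y y' = 0"
    "\<And>z. z \<in> S \<Longrightarrow> p y z + p y' z = p a z + p a' z"
    "\<And>x. x \<in> plane a a' \<Longrightarrow> f x = f y * p y x + f y' * p y' x"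
    by (rule plane_spectral[OF a f(1)]) (rule that)
  have S: "y \<in> S" "y' \<in> S" using y planeD by auto
  have bl': "bloch w y' = - bloch w y" if "w \<in> plane a a'" for w
    using y(4)[of w] planeD[OF that] p_sym[OF _ S(1), of w] p_sym[OF _ S(2), of w]
    by (simp add: bloch_def)
  have "f y' = - f y"
  proof -
    have "(\<Sum>b\<in>B. s b * bloch b y') = (\<Sum>b\<in>B. - (s b * bloch b y))"
      using assms(5) bl' by (intro sum.cong) auto
    then show ?thesis
      unfolding f(2)[OF y(1)] f(2)[OF y(2)] bl'[OF assms(6)] by (simp add: sum_negf)
  qed
  then have fz: "f z = f y * bloch y z" if "z \<in> plane a a'" for z
  proof -
    have "p y' z = 1 - p y z" using y(4)[OF planeD(1)[OF that]] planeD(2)[OF that] by linarith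
    show ?thesis
      unfolding y(5)[OF that] \<open>f y' = - f y\<close> \<open>p y' z = 1 - p y z\<close> bloch_def
      by (simp add: algebra_simps)
  qed
  show thesis
  proof (rule that[OF y(1), of "f y"])
    fix z assume z: "z \<in> plane a a'"
    show "r * bloch x z + (\<Sum>b\<in>B. s b * bloch b z) = f y * bloch y z"
      using f(2)[OF z] fz[OF z] by simp
  qed
qed

lemma bloch_sym: "x \<in> S \<Longrightarrow> y \<in> S \<Longrightarrow> bloch x y = bloch y x"
  by (simp add: bloch_def p_sym)

lemma bloch_basis_values:
  assumes "bloch_basis a a' B" "x \<in> B" "y \<in> B"
  shows "bloch x y = (if x = y then 1 else 0)"
proof -
  have "x \<in> S" using assms planeD(1) by (auto simp: bloch_basis_def)
  moreover have "p x y = 1/2" if "x \<noteq> y" using assms that unfolding bloch_basis_def by blast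
  ultimately show ?thesis by (cases "x = y") (simp_all add: bloch_def)
qed

lemma bloch_basis_sum:
  assumes "bloch_basis a a' B" "b \<in> B"
  shows "(\<Sum>c\<in>B. s c * bloch c b) = s b"
proof -
  have "(\<Sum>c\<in>B. s c * bloch c b) = (\<Sum>c\<in>B. if c = b then s c else 0)"
    using bloch_basis_values[OF assms(1) _ assms(2)] by (intro sum.cong) auto
  then show ?thesis using assms by (simp add: bloch_basis_def)
qed

text \<open>Subtracting all coordinates from \<open>bloch x\<close> leaves a multiple of some
  \<open>bloch y\<close> that vanishes on \<open>B\<close>. If the factor were nonzero,
  \<open>y\<close> would be a further direction, against maximality.\<close>

lemma bloch_expansion:
  assumes a: "a \<in> S" "a' \<in> S" "p a a' = 0" and B: "bloch_basis a a' B"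
    and x: "x \<in> plane a a'" and z: "z \<in> plane a a'"
  shows "bloch x z = (\<Sum>b\<in>B. bloch x b * bloch b z)"
proof -
  have Bf: "finite B" "B \<subseteq> plane a a'" using B by (auto simp: bloch_basis_def)
  obtain k y where y: "y \<in> plane a a'"
    and k: "\<And>z. z \<in> plane a a' \<Longrightarrow> 1 * bloch x z + (\<Sum>b\<in>B. - bloch x b * bloch b z) = k * bloch y z"
    by (rule bloch_combination[OF a Bf x]) (rule that)
  have "k * bloch y b = 0" if b: "b \<in> B" for b
  proof -
    have "b \<in> plane a a'" using b Bf by blast
    from k[OF this] show ?thesis using bloch_basis_sum[OF B b, of "\<lambda>b. - bloch x b"] by simp
  qed
  have "k = 0"
  proof (rule ccontr)
    assume "k \<noteq> 0"
    then have "\<forall>b\<in>B. bloch y b = 0" using \<open>\<And>b. b \<in> B \<Longrightarrow> k * bloch y b = 0\<close> by simp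
    have "\<forall>b\<in>B. p b y = 1/2"
    proof
      fix b assume b: "b \<in> B"
      have "b \<in> S" "y \<in> S" using b Bf y planeD(1) by blast+
      moreover have "bloch y b = 0" using b \<open>\<forall>b\<in>B. bloch y b = 0\<close> by blast
      then have "p y b = 1/2" by (simp add: bloch_def)
      ultimately show "p b y = 1/2" using p_sym by metis
    qed
    then show False using B y unfolding bloch_basis_def by blast
  qed
  then show ?thesis using k[OF z] by (simp add: sum_negf)
qed

text \<open>The combination with coefficients \<open>s\<close> is \<open>k * bloch y\<close>.
  Parseval gives \<open>k^2 = 1\<close>, and for \<open>k = -1\<close> the antipode of
  \<open>y\<close> is the answer.\<close>

lemma bloch_surjective:
  assumes a: "a \<in> S" "a' \<in> S" "p a a' = 0" and B: "bloch_basis a a' B"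
    and s: "(\<Sum>b\<in>B. (s b)\<^sup>2) = 1"
  obtains x where "x \<in> plane a a'" "\<And>b. b \<in> B \<Longrightarrow> bloch x b = s b"
proof -
  have Bf: "finite B" "B \<subseteq> plane a a'" using B by (auto simp: bloch_basis_def)
  \<comment> \<open>The term with coefficient 0 only fits the sum to the format of
    \<open>bloch_combination\<close>.\<close>
  obtain k y where y: "y \<in> plane a a'"
    and k: "\<And>z. z \<in> plane a a' \<Longrightarrow> 0 * bloch a z + (\<Sum>b\<in>B. s b * bloch b z) = k * bloch y z"
    by (rule bloch_combination[OF a Bf plane_ends(1)[OF a]]) (rule that)
  have yS: "y \<in> S" using y planeD by auto
  have sb: "s b = k * bloch y b" if "b \<in> B" for b
  proof -
    have "b \<in> plane a a'" using that Bf by blast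
    from k[OF this] show ?thesis using bloch_basis_sum[OF B that, of s] by simp
  qed
  have bsy: "bloch b y = bloch y b" if "b \<in> B" for b
    using that Bf planeD(1) bloch_sym yS by blast
  have "1 = (\<Sum>b\<in>B. k^2 * (bloch y b * bloch b y))"
    unfolding s[symmetric] using sb bsy by (intro sum.cong) (auto simp: power2_eq_square)
  also have "\<dots> = k^2 * bloch y y"
    unfolding bloch_expansion[OF a B y y] by (simp add: sum_distrib_left)
  finally have "k^2 = 1" using yS by (simp add: bloch_def)
  then consider "k = 1" | "k = -1" by (auto simp: power2_eq_1_iff)
  then show thesis
  proof cases
    case 1
    then show ?thesis using that[OF y] sb by simp
  next
    case 2
    obtain y' where y': "y' \<in> plane a a'" "p y y' = 0" "\<And>z. z \<in> S \<Longrightarrow> p y z + p y' z = p a z + p a' z"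
      by (rule plane_complement[OF a y]) (rule that)
    have "bloch y' b = s b" if "b \<in> B" for b
    proof -
      have "b \<in> plane a a'" using that Bf by auto
      then have "p y b + p y' b = 1" using y'(3)[of b] planeD[of b a a'] by simp
      then show ?thesis using sb[OF that] 2 by (simp add: bloch_def)
    qed
    then show ?thesis using that[OF y'(1)] by blast
  qed
qed

text \<open>A single direction is not maximal, since the midpoint of \<open>a\<close> and
  \<open>a'\<close> is perpendicular to \<open>a\<close>. This provides the condition
  \<open>1 \<le> R\<close> in Axiom V.\<close>

lemma bloch_basis_card:
  assumes a: "a \<in> S" "a' \<in> S" "p a a' = 0" and B: "bloch_basis a a' B" "a \<in> B"
  shows "2 \<le> card B"
proof -
  have ne: "a \<noteq> a'" using a orth_neq by auto
  obtain c c' where c: "c \<in> S" "c' \<in> S" "p c c' = 0" "p a c = (1 + sqrt (p a a')) / 2"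
     "a \<in> plane c c'" "a' \<in> plane c c'"
    by (rule midpoint[OF a(1,2) ne]) (rule that)
  have pc: "p a c = 1/2" using c a by simp
  have "p a z + p a' z = p c z + p c' z" if "z \<in> S" for z
    by (rule pair_unit[OF c(1-3) a _ that, symmetric]) (use plane_orth[OF c(1-3)] c in auto)
  from this[OF c(1)] have cpl: "c \<in> plane a a'"
    using c(1) c(3) p_sym[OF c(2,1)] by (simp add: plane_def)
  have "B \<noteq> {a}"
  proof
    assume "B = {a}"
    then show False using B(1) cpl pc unfolding bloch_basis_def by blast
  qed
  then obtain b where b: "b \<in> B" "b \<noteq> a" using B(2) by blast
  have "card {a, b} \<le> card B" using B b by (intro card_mono) (auto simp: bloch_basis_def)
  then show ?thesis using b by simp
qed

end

section \<open>The dimension of the Bloch spheres\<close>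

lemma second_moment_uniform:
  "(\<integral>t. t\<^sup>2 \<partial>uniform_measure lborel {0..1}) = (1/3 :: real)"
proof -
  have "uniform_measure lborel {0..1::real} = density lborel (\<lambda>x. ennreal (indicator {0..1} x))"
    unfolding uniform_measure_def by (simp add: ennreal_indicator divide_ennreal_def)
  then have "(\<integral>t. t\<^sup>2 \<partial>uniform_measure lborel {0..1}) = (\<integral>t. indicator {0..1} t *\<^sub>R (t::real)\<^sup>2 \<partial>lborel)"
    by (simp add: integral_density)
  also have "\<dots> = (\<integral>t. t\<^sup>2 * indicator {0..1::real} t \<partial>lborel)"
    by (simp add: mult.commute)
  also have "\<dots> = 1/3"
    using integral_power[of 0 1 2] by simp
  finally show ?thesis .
qed

lemma unit_sphere_iff:
  "Y \<in> unit_sphere R \<longleftrightarrow> (\<forall>i>R. Y i = 0) \<and> (\<Sum>i\<le>R. (Y i)\<^sup>2) = 1"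
  by (auto simp: nsphere_def topspace_Euclidean_space)

lemma sphere_second_moments:
  assumes M: "prob_space M" "space M = unit_sphere R"
    "sets M = sets (restrict_space borel (unit_sphere R))"
    and unif: "\<And>i. i \<le> R \<Longrightarrow> distr M borel (\<lambda>Y. \<bar>Y i\<bar>) = uniform_measure lborel {0..1}"
  shows "R = 2"
proof -
  interpret prob_space M by (rule M(1))
  have meas: "(\<lambda>Y. Y i) \<in> borel_measurable M" for i
  proof -
    have "(\<lambda>Y::nat \<Rightarrow> real. Y i) \<in> borel_measurable borel"
      by (intro borel_measurable_continuous_onI continuous_on_product_coordinates)
    then have "(\<lambda>Y. Y i) \<in> borel_measurable (restrict_space borel (unit_sphere R))"
      by (rule measurable_restrict_space1)
    then show ?thesis using measurable_cong_sets[OF M(3) refl] by blast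
  qed
  have bd: "integrable M (\<lambda>Y. (Y i)\<^sup>2)" if "i \<le> R" for i
  proof (rule integrable_const_bound[of _ 1])
    show "AE Y in M. norm ((Y i)\<^sup>2) \<le> 1"
    proof (rule AE_I2)
      fix Y assume "Y \<in> space M"
      then have s: "(\<Sum>i\<le>R. (Y i)\<^sup>2) = 1" using M(2) unit_sphere_iff by auto
      have "(Y i)\<^sup>2 \<le> (\<Sum>i\<le>R. (Y i)\<^sup>2)"
        using that by (intro member_le_sum) auto
      then show "norm ((Y i)\<^sup>2) \<le> 1" using s by simp
    qed
  qed (use meas in measurable)
  have each: "(\<integral>Y. (Y i)\<^sup>2 \<partial>M) = 1/3" if "i \<le> R" for i
  proof -
    have "(\<integral>t. t\<^sup>2 \<partial>distr M borel (\<lambda>Y. \<bar>Y i\<bar>)) = (\<integral>Y. \<bar>Y i\<bar>\<^sup>2 \<partial>M)"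
      using meas by (intro integral_distr) auto
    then show ?thesis using unif[OF that] second_moment_uniform by simp
  qed
  have "(1::real) = (\<integral>Y. 1 \<partial>M)" using prob_space by simp
  also have "\<dots> = (\<integral>Y. (\<Sum>i\<le>R. (Y i)\<^sup>2) \<partial>M)"
    by (rule Bochner_Integration.integral_cong) (use M(2) unit_sphere_iff in auto)
  also have "\<dots> = (\<Sum>i\<le>R. (\<integral>Y. (Y i)\<^sup>2 \<partial>M))"
    using bd by (intro Bochner_Integration.integral_sum) auto
  also have "\<dots> = (\<Sum>i\<le>R. 1/3)" using each by (intro sum.cong) auto
  also have "\<dots> = real (Suc R) / 3" by simp
  finally show ?thesis by simp
qed

context transition_system begin

section \<open>Planes as instances of Axiom V\<close>

lemma plane_is_subspace:
  assumes "a \<in> S" "a' \<in> S" "p a a' = 0"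
  shows "is_subspace S p (plane a a')"
proof -
  have n: "a \<noteq> a'" using assms orth_neq by auto
  have "orth {a, a'}" using assms p_sym[OF assms(2,1)] by (simp add: orth_iff)
  moreover have "plane a a' = {z\<in>S. (\<Sum>x\<in>{a,a'}. p x z) = 1}" using n by (simp add: plane_def)
  ultimately show ?thesis unfolding is_subspace_def using assms by (intro exI[of _ "{a,a'}"]) simp
qed

text \<open>Every orthogonal pair in the plane has the same sum as \<open>a\<close>,
  \<open>a'\<close>, which is 1 on the plane, so no third orthogonal state fits in.\<close>

lemma plane_has_dimension:
  assumes a: "a \<in> S" "a' \<in> S" "p a a' = 0"
  shows "has_dimension p (plane a a') 2"
proof -
  have full: False if xy: "x \<in> plane a a'" "y \<in> plane a a'" "p x y = 0" and w: "w \<in> plane a a'" "p w x = 0" "p w y = 0" for x y w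
  proof -
    have S: "x \<in> S" "y \<in> S" "w \<in> S" using xy w planeD by auto
    have "p a w + p a' w = p x w + p y w"
      by (rule pair_unit[OF a S(1,2) xy(3) _ S(3)]) (use plane_orth[OF a xy(1)] plane_orth[OF a xy(2)] in blast)
    then show False using planeD(2)[OF w(1)] w p_sym[OF S(3,1)] p_sym[OF S(3,2)] by simp
  qed
  have two: "frame_in p (plane a a') F" if F: "F = {x, y}" "x \<in> plane a a'" "y \<in> plane a a'" "p x y = 0" for F x y
    unfolding frame_in_def
  proof (intro conjI allI impI)
    have S: "x \<in> S" "y \<in> S" using F planeD by auto
    show "F \<subseteq> plane a a'" using F by auto
    show "orth F" using F p_sym[OF S(2,1)] by (simp add: orth_iff)
    fix G assume G: "F \<subseteq> G \<and> G \<subseteq> plane a a' \<and> orth G"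
    have False if "w \<in> G" "w \<notin> F" for w
      using full[OF F(2,3,4), of w] that G F(1) unfolding orth_iff by blast
    then show "G = F" using G by blast
  qed
  have "finite F \<and> card F = 2" if F: "frame_in p (plane a a') F" for F
  proof -
    have F1: "F \<subseteq> plane a a'" "orth F"
      and F2: "\<And>G. F \<subseteq> G \<Longrightarrow> G \<subseteq> plane a a' \<Longrightarrow> orth G \<Longrightarrow> G = F"
      using F unfolding frame_in_def by auto
    have "F \<noteq> {}"
    proof
      assume "F = {}"
      then have "{a} = F" using plane_ends[OF a] by (intro F2) (auto simp: orth_iff)
      then show False using \<open>F = {}\<close> by simp
    qed
    then obtain x where x: "x \<in> F" by blast
    have xp: "x \<in> plane a a'" using x F1 by blast
    then obtain x' where x': "x' \<in> plane a a'" "p x x' = 0" by (rule plane_complement[OF a]) (rule that)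
    have S: "x \<in> S" "x' \<in> S" using xp x' planeD by auto
    have "F \<noteq> {x}"
    proof
      assume Fx: "F = {x}"
      have "{x, x'} = F"
        using Fx xp x' p_sym[OF S(2,1)] by (intro F2) (auto simp: orth_iff)
      then show False using Fx x' orth_neq[OF S(1) x'(2)] by auto
    qed
    then obtain y where y: "y \<in> F" "y \<noteq> x" using x by blast
    have yp: "y \<in> plane a a'" using y F1 by blast
    have oF: "p v w = 0" if "v \<in> F" "w \<in> F" "v \<noteq> w" for v w
      using F1(2) that by (simp add: orth_iff)
    have xy: "p x y = 0" using oF[OF x y(1)] y(2) by simp
    have "w \<in> {x, y}" if w: "w \<in> F" for w
    proof (rule ccontr)
      assume "w \<notin> {x, y}"
      then have "p w x = 0" "p w y = 0" using oF[OF w x] oF[OF w y(1)] by auto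
      then show False using full[OF xp yp xy] w F1(1) by blast
    qed
    then have "F = {x, y}" using x y(1) by blast
    then show ?thesis using y by simp
  qed
  moreover have "frame_in p (plane a a') {a, a'}"
    by (rule two[OF refl plane_ends[OF a] a(3)])
  ultimately show ?thesis unfolding has_dimension_def by blast
qed

text \<open>Coordinates in a Bloch basis form a sphere identification. Measuring the basis state
  \<open>h i\<close> in the frame given by the point \<open>Y\<close> has purity equal to the
  absolute value of \<open>Y i\<close>, so Axiom V makes this absolute value uniform for every
  coordinate.\<close>

lemma plane_bloch_card:
  assumes a: "a \<in> S" "a' \<in> S" "p a a' = 0" and V: "axiom_V S p"
    and B: "bloch_basis a a' B" "a \<in> B"
  shows "card B = 3"
proof -
  define P where "P = plane a a'"
  have Bf: "finite B" "B \<subseteq> P" using B by (auto simp: bloch_basis_def P_def)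
  have PS: "x \<in> S" if "x \<in> P" for x using that planeD by (auto simp: P_def)
  \<comment> \<open>The sphere S^R sits in \<open>R + 1\<close> coordinates, one for each element of
    \<open>B\<close>.\<close>
  define R where "R = card B - 1"
  have cB: "card B = Suc R" "1 \<le> R" using bloch_basis_card[OF a B] by (auto simp: R_def)
  obtain h where h: "bij_betw h {..R} B"
    using finite_same_card_bij[of "{..R}" B] Bf cB by auto
  define \<phi> where "\<phi> x i = (if i \<le> R then bloch x (h i) else 0)" for x i
  have hB: "h i \<in> B" if "i \<le> R" for i using h that by (auto simp: bij_betw_def)
  have inner: "(\<Sum>i\<le>R. \<phi> x i * \<phi> y i) = bloch x y" if xy: "x \<in> P" "y \<in> P" for x y
  proof -
    have "(\<Sum>i\<le>R. \<phi> x i * \<phi> y i) = (\<Sum>i\<le>R. bloch x (h i) * bloch (h i) y)"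
    proof (rule sum.cong[OF refl])
      fix i assume "i \<in> {..R}"
      then have "h i \<in> S" "i \<le> R" using hB Bf PS by auto
      then show "\<phi> x i * \<phi> y i = bloch x (h i) * bloch (h i) y"
        using bloch_sym[OF PS[OF xy(2)]] by (simp add: \<phi>_def)
    qed
    also have "\<dots> = (\<Sum>b\<in>B. bloch x b * bloch b y)"
      by (rule sum.reindex_bij_betw[OF h])
    also have "\<dots> = bloch x y"
      using bloch_expansion[OF a B(1)] xy by (simp add: P_def)
    finally show ?thesis .
  qed
  have range: "-1 \<le> bloch x y \<and> bloch x y \<le> 1" if "x \<in> P" "y \<in> P" for x y
    using p_nonneg[OF PS[OF that(1)] PS[OF that(2)]] p_le_1[OF PS[OF that(1)] PS[OF that(2)]]
    by (simp add: bloch_def)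
  have angle: "p x y = (cos (central_angle R (\<phi> x) (\<phi> y) / 2))\<^sup>2" if "x \<in> P" "y \<in> P" for x y
  proof -
    have "cos (2 * (central_angle R (\<phi> x) (\<phi> y) / 2)) = bloch x y"
      using range[OF that] inner[OF that] by (simp add: central_angle_def)
    then show ?thesis unfolding cos_double_cos by (simp add: bloch_def)
  qed
  have bij: "bij_betw \<phi> P (unit_sphere R)"
    unfolding bij_betw_def
  proof
    show "inj_on \<phi> P"
    proof (rule inj_onI)
      fix x y assume xy: "x \<in> P" "y \<in> P" "\<phi> x = \<phi> y"
      have "bloch x y = bloch x x" using inner[OF xy(1,2)] inner[OF xy(1,1)] xy(3) by simp
      then show "x = y" using p_eq_1_iff[OF PS[OF xy(1)] PS[OF xy(2)]] p_self[OF PS[OF xy(1)]]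
        by (simp add: bloch_def)
    qed
    show "\<phi> ` P = unit_sphere R"
    proof
      show "\<phi> ` P \<subseteq> unit_sphere R"
      proof
        fix Y assume "Y \<in> \<phi> ` P"
        then obtain x where x: "x \<in> P" "Y = \<phi> x" by blast
        have "(\<Sum>i\<le>R. (\<phi> x i)\<^sup>2) = 1"
          using inner[OF x(1,1)] p_self[OF PS[OF x(1)]] by (simp add: power2_eq_square bloch_def)
        then show "Y \<in> unit_sphere R" unfolding unit_sphere_iff using x by (simp add: \<phi>_def)
      qed
      show "unit_sphere R \<subseteq> \<phi> ` P"
      proof
        fix Y assume "Y \<in> unit_sphere R"
        then have Y: "\<And>i. i > R \<Longrightarrow> Y i = 0" "(\<Sum>i\<le>R. (Y i)\<^sup>2) = 1" by (auto simp: unit_sphere_iff)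
        define s where "s b = Y (inv_into {..R} h b)" for b
        have sh: "s (h i) = Y i" if "i \<le> R" for i
          using that h by (simp add: s_def bij_betw_def inv_into_f_f)
        have "(\<Sum>b\<in>B. (s b)\<^sup>2) = (\<Sum>i\<le>R. (s (h i))\<^sup>2)"
          by (rule sum.reindex_bij_betw[OF h, symmetric])
        also have "\<dots> = 1" using sh Y(2) by simp
        finally obtain x where "x \<in> plane a a'" and x2: "\<And>b. b \<in> B \<Longrightarrow> bloch x b = s b"
          by (rule bloch_surjective[OF a B(1)]) (rule that)
        then have x1: "x \<in> P" by (simp add: P_def)
        have "\<phi> x i = Y i" for i
          using x2[OF hB] sh Y(1) by (simp add: \<phi>_def)
        then have "\<phi> x = Y" by (rule ext)
        then show "Y \<in> \<phi> ` P" using x1 by (intro image_eqI[of _ _ x]) simp_all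
      qed
    qed
  qed
  have sid: "sphere_identification p P R \<phi>"
    unfolding sphere_identification_def using bij angle by blast
  have "is_subspace S p P" "has_dimension p P 2"
    unfolding P_def by (rule plane_is_subspace[OF a] plane_has_dimension[OF a])+
  then obtain M where M: "uniform_sphere_measure R M"
    "\<And>x. x \<in> P \<Longrightarrow> distr M borel (\<lambda>Y. measured_purity p x (inv_into P \<phi> Y)) = uniform_measure lborel {0..1}"
    using V sid cB(2) unfolding axiom_V_def by blast
  have "R = 2"
  proof (rule sphere_second_moments)
    show "prob_space M" "space M = unit_sphere R"
      "sets M = sets (restrict_space borel (unit_sphere R))"
      using M(1) unfolding uniform_sphere_measure_def by blast+
    fix i assume i: "i \<le> R"
    have hi: "h i \<in> P" using hB[OF i] Bf by blast
    have "distr M borel (\<lambda>Y. \<bar>Y i\<bar>) = distr M borel (\<lambda>Y. measured_purity p (h i) (inv_into P \<phi> Y))"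
    proof (rule distr_cong[OF refl refl])
      fix Y assume "Y \<in> space M"
      then have Y: "Y \<in> \<phi> ` P" using \<open>space M = unit_sphere R\<close> bij by (simp add: bij_betw_def)
      let ?y = "inv_into P \<phi> Y"
      have y: "?y \<in> P" "\<phi> ?y = Y" using Y by (auto simp: inv_into_into f_inv_into_f)
      have "\<phi> ?y i = bloch ?y (h i)" using i by (simp add: \<phi>_def)
      then have "Y i = bloch ?y (h i)" unfolding y(2) .
      also have "\<dots> = bloch (h i) ?y" by (rule bloch_sym[OF PS[OF y(1)] PS[OF hi]])
      finally show "\<bar>Y i\<bar> = measured_purity p (h i) ?y"
        by (simp add: measured_purity_def bloch_def)
    qed
    then show "distr M borel (\<lambda>Y. \<bar>Y i\<bar>) = uniform_measure lborel {0..1}"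
      using M(2)[OF hi] by simp
  qed
  then show ?thesis using cB by simp
qed

end

section \<open>Coordinates on planes and the tangent space of a state\<close>

context transition_system begin

text \<open>Splitting off the other elements of a frame projects \<open>z\<close> to the plane. If
  those already carry the full weight, \<open>p z\<close> is 0 on the plane and \<open>t = 0\<close>
  serves with an arbitrary \<open>y\<close>.\<close>

lemma plane_projection:
  assumes c: "c \<in> S" "c' \<in> S" "p c c' = 0" and z: "z \<in> S"
  obtains t y where "y \<in> plane c c'" "\<And>f. f \<in> plane c c' \<Longrightarrow> p z f = t * p y f"
proof -
  have n: "c \<noteq> c'" using c orth_neq by auto
  have o: "orth {c, c'}" "{c, c'} \<subseteq> S" using c p_sym[OF c(2,1)] by (auto simp: orth_iff)
  obtain F where F: "{c,c'} \<subseteq> F" "F \<subseteq> S" "orth F" "finite F"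
    "\<And>a. a \<in> S \<Longrightarrow> (\<Sum>x\<in>F. p a x) = 1"
    by (rule frame_ext[OF o(2,1)]) (rule that)
  define G where "G = F - {c,c'}"
  have G: "finite G" "G \<subseteq> S" "orth G" "F = insert c (insert c' G)" "c \<notin> G" "c' \<notin> G"
    using F orth_subset[OF F(3)] by (auto simp: G_def)
  have sum: "p a c + p a c' + (\<Sum>g\<in>G. p a g) = 1" if "a \<in> S" for a
    using F(5)[OF that] G n by simp
  have Gc: "p g c = 0" "p g c' = 0" if "g \<in> G" for g
    using F(1,3) that by (auto simp: G_def orth_iff)
  have Gf: "p g f = 0" if "g \<in> G" "f \<in> plane c c'" for f g
    using plane_orth[OF c that(2)] Gc[OF that(1)] G(2) that(1) by blast
  show thesis
  proof (cases "(\<Sum>g\<in>G. p z g) < 1")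
    case True
    obtain y where y: "y \<in> S" "\<And>g. g \<in> G \<Longrightarrow> p g y = 0"
      "\<And>f. f \<in> S \<Longrightarrow> \<forall>g\<in>G. p g f = 0 \<Longrightarrow> p z f = (1 - (\<Sum>g\<in>G. p z g)) * p y f"
    proof -
      obtain y where "y \<in> S" "\<forall>g\<in>G. p g y = 0"
        "\<forall>f\<in>S. (\<forall>g\<in>G. p g f = 0) \<longrightarrow> p z f = (1 - (\<Sum>g\<in>G. p z g)) * p y f"
        using projection[OF G(1-3) z True] by (elim bexE conjE)
      then show thesis by (intro that) blast+
    qed
    have "p y g = 0" if "g \<in> G" for g 
    proof -
      have "g \<in> S" using G(2) that by blast
      from p_sym[OF y(1) this] show ?thesis using y(2)[OF that] by simp
    qed
    then have "(\<Sum>g\<in>G. p y g) = 0" by simp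
    then have "p c y + p c' y = 1" using sum[OF y(1)] p_sym[OF y(1) c(1)] p_sym[OF y(1) c(2)] by simp
    then have yp: "y \<in> plane c c'" using y(1) by (simp add: plane_def)
    show ?thesis
    proof (rule that[OF yp y(3)])
      fix f assume f: "f \<in> plane c c'"
      show "f \<in> S" by (rule planeD(1)[OF f])
      show "\<forall>g\<in>G. p g f = 0" using Gf[OF _ f] by simp
    qed
  next
    case False
    then have "p z c = 0" "p z c' = 0"
      using sum[OF z] p_nonneg[OF z c(1)] p_nonneg[OF z c(2)] by linarith+
    then have "p z f = 0 * p c f" if "f \<in> plane c c'" for f
      using plane_orth[OF c that z] by simp
    then show ?thesis by (rule that[OF plane_ends(1)[OF c]])
  qed
qed

text \<open>Half the Bloch coordinate along \<open>f\<close> of the projection of \<open>h\<close> to the plane of \<open>a\<close> and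
  \<open>a'\<close>, multiplied by the weight \<open>p h a + p h a'\<close> of that projection.\<close>

definition offset :: "'a \<Rightarrow> 'a \<Rightarrow> 'a \<Rightarrow> 'a \<Rightarrow> real" where
  "offset a a' f h = p h f - (p h a + p h a') / 2"

text \<open>In the model, with f = (a + a')/sqrt 2 and g = (a + i a')/sqrt 2, the two offsets of
  \<open>h\<close> are the real and imaginary part of conj(h_a) h_a'. The quantified clauses are the
  Born rule against states of the plane, the vanishing determinant of the density matrix compressed
  to the plane, and the realisation of every phase on the equator.\<close>

definition plane_axes :: "'a \<Rightarrow> 'a \<Rightarrow> 'a \<Rightarrow> 'a \<Rightarrow> bool" where
  "plane_axes a a' f g \<longleftrightarrow> f \<in> plane a a' \<and> g \<in> plane a a' \<and>
     p f a = 1/2 \<and> p g a = 1/2 \<and> p f g = 1/2 \<and>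
     (\<forall>h\<in>S. \<forall>x\<in>plane a a'. p h x = p h a * p a x + p h a' * p a' x
        + 2 * (offset a a' f h * offset a a' f x + offset a a' g h * offset a a' g x)) \<and>
     (\<forall>h\<in>S. (offset a a' f h)\<^sup>2 + (offset a a' g h)\<^sup>2 = p h a * p h a') \<and>
     (\<forall>\<alpha> \<beta>. \<alpha>\<^sup>2 + \<beta>\<^sup>2 = 1 \<longrightarrow>
        (\<exists>x\<in>plane a a'. p x a = 1/2 \<and> offset a a' f x = \<alpha> / 2 \<and> offset a a' g x = \<beta> / 2))"

text \<open>A Bloch basis through \<open>a\<close> has three elements \<open>a\<close>,
  \<open>f\<close>, \<open>g\<close>. Expansion in it gives the formulas for states of the plane; a
  general \<open>h\<close> is replaced by its projection, so that all terms scale with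
  \<open>t\<close>, or with its square in the quadratic identity.\<close>

lemma plane_axes_exist:
  assumes a: "a \<in> S" "a' \<in> S" "p a a' = 0" and V: "axiom_V S p"
  obtains f g where "plane_axes a a' f g"
proof -
  obtain B where B: "bloch_basis a a' B" "a \<in> B" by (rule bloch_basis_exists[OF a]) (rule that)
  have "card B = 3" by (rule plane_bloch_card[OF a V B])
  then have "card (B - {a}) = 2" using B by (simp add: bloch_basis_def)
  then obtain f g where fg: "B - {a} = {f, g}" "f \<noteq> g" by (meson card_2_iff)
  have Be: "B = {a, f, g}" "a \<noteq> f" "a \<noteq> g" using fg B(2) by auto
  have pl: "a \<in> plane a a'" "f \<in> plane a a'" "g \<in> plane a a'"
    using B(1) Be(1) by (auto simp: bloch_basis_def)
  then have S: "f \<in> S" "g \<in> S" using planeD by auto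
  have half: "\<And>x y. x \<in> B \<Longrightarrow> y \<in> B \<Longrightarrow> x \<noteq> y \<Longrightarrow> p x y = 1/2"
    using B(1) unfolding bloch_basis_def by blast
  have h: "p f a = 1/2" "p g a = 1/2" "p f g = 1/2"
    by (rule half; use Be fg(2) in auto)+
  have plx: "p a' x = 1 - p a x" "p x a' = 1 - p x a" "x \<in> S" if "x \<in> plane a a'" for x
  proof -
    show x: "x \<in> S" by (rule planeD(1)[OF that])
    show "p a' x = 1 - p a x" using planeD(2)[OF that] by linarith
    then show "p x a' = 1 - p x a" using p_sym[OF x a(1)] p_sym[OF x a(2)] by simp
  qed
  have ex: "bloch x z = bloch x a * bloch a z + bloch x f * bloch f z + bloch x g * bloch g z"
    if "x \<in> plane a a'" "z \<in> plane a a'" for x z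
    using bloch_expansion[OF a B(1) that] Be fg(2) by simp
  have off: "offset a a' f x = bloch x f / 2" "offset a a' g x = bloch x g / 2" if "x \<in> plane a a'" for x
    using plx[OF that] by (auto simp: offset_def bloch_def field_simps)
  have i0: "p y x = p y a * p a x + p y a' * p a' x
        + 2 * (offset a a' f y * offset a a' f x + offset a a' g y * offset a a' g x)"
    if y: "y \<in> plane a a'" and x: "x \<in> plane a a'" for x y
  proof -
    have "bloch f x = bloch x f" "bloch g x = bloch x g"
      using bloch_sym S plx(3)[OF x] by auto
    then have "bloch y x = bloch y a * bloch a x + bloch y f * bloch x f + bloch y g * bloch x g"
      using ex[OF y x] by simp
    then show ?thesis
      unfolding off[OF x] off[OF y] plx(1)[OF x] plx(2)[OF y]
      by (simp add: bloch_def field_simps)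
  qed
  have proj: "\<exists>t y. y \<in> plane a a' \<and> (\<forall>x\<in>plane a a'. p h x = t * p y x)
      \<and> offset a a' f h = t * offset a a' f y \<and> offset a a' g h = t * offset a a' g y" if hS: "h \<in> S" for h
  proof -
    obtain t y where y: "y \<in> plane a a'" "\<And>x. x \<in> plane a a' \<Longrightarrow> p h x = t * p y x"
      by (rule plane_projection[OF a hS]) (rule that)
    have "offset a a' f h = t * offset a a' f y" "offset a a' g h = t * offset a a' g y"
      unfolding offset_def y(2)[OF pl(1)] y(2)[OF pl(2)] y(2)[OF pl(3)] y(2)[OF plane_ends(2)[OF a]]
      by (simp_all add: algebra_simps)
    then show ?thesis using y by blast
  qed
  have i: "p h x = p h a * p a x + p h a' * p a' x
        + 2 * (offset a a' f h * offset a a' f x + offset a a' g h * offset a a' g x)"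
    if hS: "h \<in> S" and x: "x \<in> plane a a'" for h x
  proof -
    obtain t y where y: "y \<in> plane a a'" "\<And>x. x \<in> plane a a' \<Longrightarrow> p h x = t * p y x"
      "offset a a' f h = t * offset a a' f y" "offset a a' g h = t * offset a a' g y"
      using proj[OF hS] by blast
    show ?thesis
      unfolding y(3,4) y(2)[OF x] y(2)[OF pl(1)] y(2)[OF plane_ends(2)[OF a]] i0[OF y(1) x]
      by (simp add: algebra_simps)
  qed
  have ii: "(offset a a' f h)\<^sup>2 + (offset a a' g h)\<^sup>2 = p h a * p h a'" if hS: "h \<in> S" for h
  proof -
    obtain t y where y: "y \<in> plane a a'" "\<And>x. x \<in> plane a a' \<Longrightarrow> p h x = t * p y x"
      "offset a a' f h = t * offset a a' f y" "offset a a' g h = t * offset a a' g y"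
      using proj[OF hS] by blast
    have yS: "y \<in> S" using planeD y(1) by auto
    \<comment> \<open>The normalisation \<open>p y y = 1\<close> is the equation of the
      sphere.\<close>
    have "1 = p y a * p y a + (1 - p y a) * (1 - p y a)
        + 2 * (offset a a' f y * offset a a' f y + offset a a' g y * offset a a' g y)"
      using i0[OF y(1) y(1)] unfolding plx(1,2)[OF y(1)] p_sym[OF a(1) yS] p_self[OF yS] .
    then have "(offset a a' f y)\<^sup>2 + (offset a a' g y)\<^sup>2 = p y a * p y a'"
      unfolding plx(2)[OF y(1)] by (simp add: power2_eq_square algebra_simps)
    then show ?thesis
      unfolding y(3,4) y(2)[OF pl(1)] y(2)[OF plane_ends(2)[OF a]]
      by (simp add: power_mult_distrib power2_eq_square mult.assoc mult.left_commute
          flip: distrib_left)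
  qed
  have iii: "\<exists>x\<in>plane a a'. p x a = 1/2 \<and> offset a a' f x = \<alpha> / 2 \<and> offset a a' g x = \<beta> / 2"
    if "\<alpha>\<^sup>2 + \<beta>\<^sup>2 = 1" for \<alpha> \<beta>
  proof -
    define s where "s b = (if b = a then 0 else if b = f then \<alpha> else \<beta>)" for b
    have "(\<Sum>b\<in>B. (s b)\<^sup>2) = 1" using that Be fg(2) by (simp add: s_def)
    then obtain x where x: "x \<in> plane a a'" "\<And>b. b \<in> B \<Longrightarrow> bloch x b = s b"
      by (rule bloch_surjective[OF a B(1)]) (rule that)
    have "bloch x a = 0" "bloch x f = \<alpha>" "bloch x g = \<beta>"
      using x(2)[of a] x(2)[of f] x(2)[of g] Be fg(2) by (auto simp: s_def)
    then show ?thesis using x(1) off[OF x(1)] by (intro bexI[of _ x]) (auto simp: bloch_def)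
  qed
  have "plane_axes a a' f g"
    unfolding plane_axes_def by (intro conjI ballI allI impI pl h i ii iii)
  then show thesis by (rule that)
qed

section \<open>Linear functionals on observables, and tangent observables\<close>

lemma observable_annihilator:
  assumes "observable f"
    and "\<And>x. x \<in> S \<Longrightarrow> \<Phi> (p x) = 0"
    and "\<And>f g. \<Phi> (\<lambda>z. f z + g z) = \<Phi> f + \<Phi> g"
    and "\<And>r f. \<Phi> (\<lambda>z. r * f z) = r * \<Phi> f"
  shows "\<Phi> f = (0::real)"
  using assms(1) by induction (simp_all add: assms(2-4))

lemma observable_sum:
  assumes "finite A" "S \<noteq> {}" "\<And>i. i \<in> A \<Longrightarrow> observable (f i)"
  shows "observable (\<lambda>z. \<Sum>i\<in>A. f i z)"
  using assms(1,3)
proof (induction A)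
  case empty
  obtain s where "s \<in> S" using assms(2) by blast
  then have "observable (\<lambda>z. 0 * p s z)" by (intro observable.intros)
  then show ?case by simp
next
  case (insert i A)
  then have "observable (\<lambda>z. f i z + (\<Sum>i\<in>A. f i z))" by (intro observable.add) auto
  then show ?case using insert by simp
qed

lemma observable_offset:
  assumes "a \<in> S" "a' \<in> S" "f \<in> S"
  obtains h where "observable h" "\<And>z. z \<in> S \<Longrightarrow> h z = offset a a' f z"
proof (rule that)
  show "observable (\<lambda>z. p f z - (p a z + p a' z) / 2)"
    by (intro observable_diff observable_divide observable.intros assms)
  show "\<And>z. z \<in> S \<Longrightarrow> p f z - (p a z + p a' z) / 2 = offset a a' f z"
    unfolding offset_def using assms p_sym by metis
qed

text \<open>In the model these are the expectation functions of the operators |a><w| + |w><a| with w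
  orthogonal to a, the derivatives of the projector at \<open>a\<close>.\<close>

definition tangent :: "'a \<Rightarrow> ('a \<Rightarrow> real) \<Rightarrow> bool" where
  "tangent a v \<longleftrightarrow> observable v \<and> v a = 0 \<and> (\<forall>h\<in>S. p h a = 0 \<longrightarrow> v h = 0)"

lemma tangent_uminus: "tangent a v \<Longrightarrow> tangent a (\<lambda>z. - v z)"
  by (simp add: tangent_def observable_uminus)

text \<open>Since \<open>v\<close> vanishes at \<open>a\<close> and at \<open>u\<close>, its values
  at the maximum \<open>y\<close> and at the antipode \<open>y'\<close> cancel. The diagonal form in
  \<open>y\<close>, \<open>y'\<close>, read at \<open>a\<close>, then puts \<open>a\<close> halfway
  between them.\<close>

lemma tangent_max:
  assumes v: "tangent a v" and a: "a \<in> S" and z: "z \<in> S" "0 < v z"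
  obtains y y' u where "u \<in> S" "p a u = 0" "y \<in> plane a u" "y' \<in> plane a u" "p y y' = 0"
    "p y a = 1/2" "p y' a = 1/2" "\<And>z. z \<in> S \<Longrightarrow> p y z + p y' z = p a z + p u z"
    "\<And>z. z \<in> S \<Longrightarrow> v z \<le> v y" "0 < v y" "v y' = - v y"
proof -
  have vo: "observable v" "v a = 0" and v0: "\<And>h. h \<in> S \<Longrightarrow> p h a = 0 \<Longrightarrow> v h = 0"
    using v by (auto simp: tangent_def)
  have "S \<noteq> {}" using a by blast
  from observable_attains_max[OF vo(1) this]
  obtain y where y: "y \<in> S" "\<And>z. z \<in> S \<Longrightarrow> v z \<le> v y" by blast
  have pos: "0 < v y" using z y(2)[OF z(1)] by linarith
  then have ne: "a \<noteq> y" using vo(2) by auto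
  obtain u where u: "u \<in> S" "p a u = 0" "y \<in> plane a u"
    by (rule plane_through[OF a y(1) ne]) (rule that)
  obtain y' where y': "y' \<in> plane a u" "p y y' = 0" "\<And>z. z \<in> S \<Longrightarrow> p y z + p y' z = p a z + p u z"
    by (rule plane_complement[OF a u]) (rule that)
  have S: "y' \<in> S" using planeD y' by auto
  have "v u = 0" using v0[OF u(1)] u(2) p_sym[OF a u(1)] by simp
  moreover have "v y + v y' = v a + v u"
    by (rule observable_pair_sum[OF vo(1) y(1) S a u(1) y'(3)])
  ultimately have neg: "v y' = - v y" using vo(2) by simp
  have apl: "a \<in> plane y y'"
    using plane_cong[of y y' a u, OF y'(3)] plane_ends(1)[OF a u(1,2)] by simp
  have "v a = v y * p y a + v y' * p y' a"
    by (rule observable_on_plane[OF y(1) S y'(2) vo(1) _ apl]) (rule y(2), rule planeD(1))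
  then have "v y * p y a = v y * p y' a" using neg vo(2) by simp
  then have "p y a = p y' a" using pos by simp
  moreover have "p y a + p y' a = 1" using y'(3)[OF a] p_self[OF a] u(2) p_sym[OF a u(1)] by simp
  ultimately have "p y a = 1/2" "p y' a = 1/2" by linarith+
  then show thesis by (rule that[OF u y'(1,2) _ _ y'(3) y(2) pos neg])
qed

text \<open>A tangent observable has rank two: \<open>y\<close> and \<open>y'\<close> are
  eigenstates with opposite values, and a state orthogonal to both is orthogonal to
  \<open>a\<close>, hence a zero of \<open>v\<close>. An arbitrary \<open>w\<close> is resolved
  along \<open>y\<close>, and the remainder \<open>b\<close> along \<open>y'\<close>.\<close>

lemma tangent_structure:
  assumes v: "tangent a v" and a: "a \<in> S" and z: "z \<in> S" "0 < v z"
  obtains \<kappa> y y' u where "0 < \<kappa>" "u \<in> S" "p a u = 0" "y \<in> plane a u" "y' \<in> plane a u" "p y y' = 0"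
    "p y a = 1/2" "p y' a = 1/2" "\<And>z. z \<in> S \<Longrightarrow> p y z + p y' z = p a z + p u z"
    "\<And>z. z \<in> S \<Longrightarrow> v z = \<kappa> * (p y z - p y' z)"
proof -
  have vo: "observable v" and v0: "\<And>h. h \<in> S \<Longrightarrow> p h a = 0 \<Longrightarrow> v h = 0"
    using v by (auto simp: tangent_def)
  obtain y y' u where y: "u \<in> S" "p a u = 0" "y \<in> plane a u" "y' \<in> plane a u" "p y y' = 0"
    "p y a = 1/2" "p y' a = 1/2" "\<And>z. z \<in> S \<Longrightarrow> p y z + p y' z = p a z + p u z"
    "\<And>z. z \<in> S \<Longrightarrow> v z \<le> v y" "0 < v y" "v y' = - v y"
    by (rule tangent_max[OF v a z]) (rule that)
  have S: "y \<in> S" "y' \<in> S" using y(3,4) planeD by auto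
  have y'y: "p y' y = 0" using y(5) p_sym[OF S] by simp
  have apl: "a \<in> plane y y'"
    using plane_cong[of y y' a u, OF y(8)] plane_ends(1)[OF a y(1,2)] by simp
  \<comment> \<open>The maximum \<open>- v q\<close> of the negative is itself the value
    \<open>v q'\<close>, so it cannot exceed \<open>v y\<close>.\<close>
  have min: "v y' \<le> v w" if w: "w \<in> S" for w
  proof -
    have "0 < - v y'" using y(10,11) by simp
    then obtain q q' r where q: "r \<in> S" "p a r = 0" "q \<in> plane a r" "q' \<in> plane a r"
      "\<And>z. z \<in> S \<Longrightarrow> - v z \<le> - v q" "- v q' = - (- v q)"
      by (rule tangent_max[OF tangent_uminus[OF v] a S(2)]) (rule that)
    have "- v q \<le> v y" using y(9)[of q'] q(4,6) planeD by force
    then show ?thesis using q(5)[OF w] y(11) by linarith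
  qed
  have val: "v w = v y * (p y w - p y' w)" if w: "w \<in> S" for w
  proof (cases "w = y")
    case True
    then show ?thesis using p_self[OF S(1)] y'y by simp
  next
    case False
    then have ne: "y \<noteq> w" by simp
    obtain b where b: "b \<in> S" "p y b = 0" "w \<in> plane y b"
      by (rule plane_through[OF S(1) w ne]) (rule that)
    have 1: "v w = v y * p y w + v b * p b w"
      by (rule observable_on_plane[OF S(1) b(1,2) vo _ b(3)]) (rule y(9), rule planeD(1))
    have 2: "v b = - v y * p y' b"
    proof (cases "b = y'")
      case True
      then show ?thesis using y(11) p_self[OF S(2)] by simp
    next
      case False
      then have ne': "y' \<noteq> b" by simp
      obtain c where c: "c \<in> S" "p y' c = 0" "b \<in> plane y' c"
        and cf: "\<And>f. f \<in> S \<Longrightarrow> p f y' = 0 \<Longrightarrow> p f b = 0 \<Longrightarrow> p f c = 0"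
        by (rule plane_through[OF S(2) b(1) ne']) (rule that)
      have "p y c = 0" by (rule cf[OF S(1) y(5) b(2)])
      then have "p c y = 0" "p c y' = 0" using c(2) p_sym[OF c(1) S(1)] p_sym[OF c(1) S(2)] by simp_all
      then have "p c a = 0" by (rule plane_orth[OF S y(5) apl c(1)])
      then have "v c = 0" by (rule v0[OF c(1)])
      moreover have "v b = v y' * p y' b + v c * p c b"
        by (rule observable_on_plane_min[OF S(2) c(1,2) vo _ c(3)]) (rule min, rule planeD(1))
      ultimately show ?thesis using y(11) by simp
    qed
    have 3: "p y' w = p y' b * p b w"
      by (rule plane_transfer[OF S(1) b(1,2,3) S(2) y'y])
    show ?thesis unfolding 1 2 3 by (simp add: algebra_simps)
  qed
  show thesis by (rule that[OF y(10) y(1-8) val])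
qed

end

section \<open>Tangent coordinates in a frame\<close>

text \<open>The axes \<open>f j\<close>, \<open>g j\<close> are arbitrary choices in the planes
  through the pole, without any consistency of orientation. The pole keeps the index
  \<open>k\<close>, so tangent vectors live in the final coordinate space with entry 0
  there.\<close>

locale framed_system = transition_system S p N
  for S :: "'a set" and p :: "'a \<Rightarrow> 'a \<Rightarrow> real" and N :: nat +
  fixes x :: "'n::finite \<Rightarrow> 'a" and k :: 'n and f g :: "'n \<Rightarrow> 'a"
  assumes frame: "inj x" "range x \<subseteq> S" "orth (range x)" "CARD('n) = N"
    and axV: "axiom_V S p"
    and axes: "\<And>j. j \<noteq> k \<Longrightarrow> plane_axes (x k) (x j) (f j) (g j)"
begin

abbreviation "pole \<equiv> x k"

lemma x_in: "x j \<in> S"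
  using frame(2) by blast

lemma x_orth: "i \<noteq> j \<Longrightarrow> p (x i) (x j) = 0"
  using frame(1,3) by (simp add: orth_iff inj_def) blast

lemma x_sum: "z \<in> S \<Longrightarrow> (\<Sum>j\<in>UNIV. p z (x j)) = 1"
  using frame_sum[of "range x" z] frame
  by (simp add: sum.reindex card_image)

text \<open>Row \<open>k\<close> of the density matrix off the diagonal, each entry possibly
  conjugated by the choice of axes.\<close>

definition W :: "'a \<Rightarrow> complex ^ 'n" where
  "W z = (\<chi> j. if j = k then 0 else Complex (offset pole (x j) (f j) z) (offset pole (x j) (g j) z))"

lemma W_nth: "W z $ j = (if j = k then 0 else Complex (offset pole (x j) (f j) z) (offset pole (x j) (g j) z))"
  by (simp add: W_def)

lemma W_norm:
  assumes "z \<in> S" "j \<noteq> k"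
  shows "(cmod (W z $ j))\<^sup>2 = p z pole * p z (x j)"
proof -
  have "(offset pole (x j) (f j) z)\<^sup>2 + (offset pole (x j) (g j) z)\<^sup>2 = p z pole * p z (x j)"
    using axes[OF assms(2)] assms(1) unfolding plane_axes_def by blast
  then show ?thesis using assms(2) by (simp add: W_nth cmod_power2)
qed

lemma W_zero:
  assumes "z \<in> S" "j = k \<or> p z pole = 0 \<or> p z (x j) = 0"
  shows "W z $ j = 0"
  using W_norm[OF assms(1), of j] assms(2) by (cases "j = k") (auto simp: W_nth)

lemma W_perp: "z \<in> S \<Longrightarrow> p z pole = 0 \<Longrightarrow> W z = 0"
  by (simp add: vec_eq_iff W_zero)

lemma W_pole: "W pole = 0"
  using W_zero[OF x_in, of _ k] x_orth[of k] by (simp add: vec_eq_iff) metis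

lemma x_plane: "j \<noteq> k \<Longrightarrow> y \<in> plane pole (x j) \<Longrightarrow> i \<noteq> k \<Longrightarrow> i \<noteq> j \<Longrightarrow> p y (x i) = 0"
  using plane_orth[OF x_in x_in x_orth _ x_in x_orth x_orth, of k j y i] p_sym[OF x_in planeD(1), of y pole "x j" i]
  by simp

lemma W_inner_plane:
  assumes "j \<noteq> k" "y \<in> plane pole (x j)"
  shows "w \<bullet> W y = (w $ j) \<bullet> (W y $ j)"
proof -
  have "W y $ i = 0" if "i \<noteq> j" for i
    using x_plane[OF assms, of i] that planeD(1)[OF assms(2)] by (intro W_zero) auto
  then have "w \<bullet> W y = (\<Sum>i\<in>UNIV. if i = j then (w $ j) \<bullet> (W y $ j) else 0)"
    unfolding inner_vec_def by (intro sum.cong) auto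
  then show ?thesis by simp
qed

lemma W_plane:
  assumes "j \<noteq> k" "y \<in> plane pole (x j)" "z \<in> S"
  shows "p z y = p z pole * p pole y + p z (x j) * p (x j) y + 2 * (W z \<bullet> W y)"
  using axes[OF assms(1)] assms unfolding W_inner_plane[OF assms(1,2)] plane_axes_def
  by (simp add: W_nth inner_complex_def)

text \<open>Identities between vectors \<open>W z\<close> are proved by pairing with all
  \<open>w\<close>; this supplies the observable for each pairing.\<close>

lemma W_observable:
  obtains v where "observable v" "\<And>z. z \<in> S \<Longrightarrow> v z = w \<bullet> W z"
proof -
  have "\<exists>h. observable h \<and> (\<forall>z\<in>S. h z = (w $ j) \<bullet> (W z $ j))" for j
  proof (cases "j = k")
    case True
    have "observable (\<lambda>z. 0 * p pole z)" by (intro observable.intros x_in)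
    then show ?thesis using True by (intro exI[of _ "\<lambda>z. 0 * p pole z"]) (simp add: W_nth)
  next
    case False
    then have S: "f j \<in> S" "g j \<in> S"
      using axes[OF False] planeD(1) unfolding plane_axes_def by blast+
    obtain F where F: "observable F" "\<And>z. z \<in> S \<Longrightarrow> F z = offset pole (x j) (f j) z"
      by (rule observable_offset[OF x_in x_in S(1)]) (rule that)
    obtain G where G: "observable G" "\<And>z. z \<in> S \<Longrightarrow> G z = offset pole (x j) (g j) z"
      by (rule observable_offset[OF x_in x_in S(2)]) (rule that)
    have "observable (\<lambda>z. Re (w $ j) * F z + Im (w $ j) * G z)"
      using F(1) G(1) by (intro observable.intros)
    then show ?thesis using False F(2) G(2)
      by (intro exI[of _ "\<lambda>z. Re (w $ j) * F z + Im (w $ j) * G z"])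
        (simp add: W_nth inner_complex_def)
  qed
  then obtain h where h: "\<And>j. observable (h j)" "\<And>j z. z \<in> S \<Longrightarrow> h j z = (w $ j) \<bullet> (W z $ j)"
    by metis
  show thesis
  proof (rule that[of "\<lambda>z. \<Sum>j\<in>UNIV. h j z"])
    show "observable (\<lambda>z. \<Sum>j\<in>UNIV. h j z)"
      by (rule observable_sum) (use x_in h(1) in auto)
    show "\<And>z. z \<in> S \<Longrightarrow> (\<Sum>j\<in>UNIV. h j z) = w \<bullet> W z"
      by (simp add: h(2) inner_vec_def)
  qed
qed

lemma W_pair_sum:
  assumes "a \<in> S" "b \<in> S" "c \<in> S" "d \<in> S"
    and "\<And>h. h \<in> S \<Longrightarrow> p a h + p b h = p c h + p d h"
  shows "W a + W b = W c + W d"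
proof -
  have "w \<bullet> (W a + W b) = w \<bullet> (W c + W d)" for w
  proof -
    obtain v where v: "observable v" "\<And>z. z \<in> S \<Longrightarrow> v z = w \<bullet> W z"
      by (rule W_observable) (rule that)
    have "v a + v b = v c + v d" by (rule observable_pair_sum[OF v(1) assms])
    then show ?thesis using v(2) assms(1-4) by (simp add: inner_add_right)
  qed
  then show ?thesis using vector_eq_ldot by blast
qed

lemma pole_perp_positive:
  assumes u: "u \<in> S" "p u pole = 0"
  obtains j where "j \<noteq> k" "0 < p u (x j)"
proof -
  have "\<exists>j. p u (x j) \<noteq> 0"
  proof (rule ccontr)
    assume "\<nexists>j. p u (x j) \<noteq> 0"
    then show False using x_sum[OF u(1)] by simp
  qed
  then obtain j where j: "p u (x j) \<noteq> 0" by blast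
  then have "j \<noteq> k" using u(2) by auto
  then show thesis using that j p_nonneg[OF u(1) x_in, of j] by simp
qed

text \<open>Tangent observables are determined on the coordinate planes. If \<open>v\<close> were
  positive somewhere, its extreme states \<open>y\<close> and \<open>y'\<close> would agree on these
  planes although \<open>W y' = - W y\<close>. So \<open>W y\<close> would vanish at every index,
  but where \<open>u\<close> has positive weight so has \<open>y\<close>, and the pole has weight
  1/2.\<close>

lemma tangent_nonpos:
  assumes v: "tangent pole v" and 0: "\<And>j y. j \<noteq> k \<Longrightarrow> y \<in> plane pole (x j) \<Longrightarrow> v y = 0"
    and z: "z \<in> S"
  shows "v z \<le> 0"
proof (rule ccontr)
  assume "\<not> v z \<le> 0"
  then have pos: "0 < v z" by simp
  obtain \<kappa> y y' u where y: "0 < \<kappa>" "u \<in> S" "p pole u = 0" "y \<in> plane pole u" "y' \<in> plane pole u" "p y y' = 0"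
    "p y pole = 1/2" "p y' pole = 1/2" and sum: "\<And>z. z \<in> S \<Longrightarrow> p y z + p y' z = p pole z + p u z"
    and val: "\<And>z. z \<in> S \<Longrightarrow> v z = \<kappa> * (p y z - p y' z)"
    by (rule tangent_structure[OF v x_in z pos]) (rule that)
  have S: "y \<in> S" "y' \<in> S" using y(4,5) planeD(1) by auto
  have uo: "p u pole = 0" using y(3) p_sym[OF x_in y(2), of k] by simp
  obtain j where j: "j \<noteq> k" "0 < p u (x j)" by (rule pole_perp_positive[OF y(2) uo]) (rule that)
  have ax: "f j \<in> plane pole (x j)" "g j \<in> plane pole (x j)"
    using axes[OF j(1)] unfolding plane_axes_def by auto
  have eq: "p y h = p y' h" if "h \<in> plane pole (x j)" for h
    using val[OF planeD(1)[OF that]] 0[OF j(1) that] y(1) by simp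
  have fj: "f j \<in> S" "g j \<in> S" using ax planeD(1) by auto
  note ends = plane_ends[OF x_in x_in x_orth[OF j(1)[symmetric]]]
  have sy: "p h y = p h y'" if "h \<in> plane pole (x j)" for h
    using eq[OF that] p_sym[OF S(1) planeD(1)[OF that]] p_sym[OF S(2) planeD(1)[OF that]] by simp
  have "W y $ j = W y' $ j"
    unfolding W_nth offset_def using eq[OF ax(1)] eq[OF ax(2)] eq[OF ends(1)] eq[OF ends(2)] by simp
  moreover have "W y + W y' = W pole + W u"
    by (rule W_pair_sum[OF S x_in y(2) sum])
  then have "W y $ j + W y' $ j = 0"
    using W_pole W_perp[OF y(2) uo] by (metis add_0 vector_add_component zero_index)
  ultimately have "W y $ j = 0" by simp
  then have "p y (x j) = 0" using W_norm[OF S(1) j(1)] y(7) by simp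
  moreover have "p (x j) y = p (x j) u * p u y"
    by (rule plane_transfer[OF x_in y(2,3,4) x_in x_orth[OF j(1)]])
  moreover have "p u y = 1/2"
    using planeD(2)[OF y(4)] y(7) p_sym[OF S(1) x_in, of k] by simp
  ultimately show False using j(2) p_sym[OF S(1) x_in, of j] p_sym[OF y(2) x_in, of j] by simp
qed

section \<open>Transition probabilities in tangent coordinates\<close>

lemma tangent_zero:
  assumes v: "tangent pole v" and 0: "\<And>j y. j \<noteq> k \<Longrightarrow> y \<in> plane pole (x j) \<Longrightarrow> v y = 0"
    and z: "z \<in> S"
  shows "v z = 0"
  using tangent_nonpos[OF v 0 z] tangent_nonpos[OF tangent_uminus[OF v] _ z] 0 by force

text \<open>The difference of both sides, as a function of \<open>h\<close>, is a tangent observable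
  that vanishes on the coordinate planes.\<close>

lemma state_formula_half:
  assumes z: "z \<in> plane pole u" and u: "u \<in> S" "p pole u = 0" and h: "h \<in> S"
  shows "p z h = p z pole * p pole h + p z u * p u h + 2 * (W z \<bullet> W h)"
proof -
  have zS: "z \<in> S" using planeD(1)[OF z] .
  have uo: "p u pole = 0" using u p_sym[OF x_in u(1), of k] by simp
  obtain w where w: "observable w" "\<And>h. h \<in> S \<Longrightarrow> w h = W z \<bullet> W h"
    by (rule W_observable) (rule that)
  define v where "v h = p z h - (p z pole * p pole h + p z u * p u h + 2 * w h)" for h
  have "observable v"
    unfolding v_def using w(1) zS u(1) x_in by (intro observable_diff observable.intros)
  moreover have "v pole = 0" using w(2)[OF x_in] W_pole uo p_self[OF x_in] by (simp add: v_def)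
  moreover have "v h = 0" if hS: "h \<in> S" and ho: "p h pole = 0" for h
  proof -
    have "p h z = p h u * p u z" by (rule plane_transfer[OF x_in u z hS ho])
    then show ?thesis
      using w(2)[OF hS] W_perp[OF hS ho] ho p_sym[OF hS zS] p_sym[OF hS u(1)] p_sym[OF zS u(1)]
        p_sym[OF hS x_in, of k] by (simp add: v_def)
  qed
  ultimately have tan: "tangent pole v" by (simp add: tangent_def)
  have "v h = 0"
  proof (rule tangent_zero[OF tan _ h])
    fix j y assume j: "j \<noteq> k" and y: "y \<in> plane pole (x j)"
    have yS: "y \<in> S" using planeD(1)[OF y] .
    have 1: "p u y = p u (x j) * p (x j) y"
      by (rule plane_transfer[OF x_in x_in x_orth[OF j[symmetric]] y u(1) uo])
    have 2: "p (x j) z = p (x j) u * p u z"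
      by (rule plane_transfer[OF x_in u z x_in x_orth[OF j]])
    have "p z u * p u y = p z (x j) * p (x j) y"
      using 1 2 p_sym[OF zS x_in, of j] p_sym[OF u(1) x_in, of j] p_sym[OF zS u(1)] by simp
    then show "v y = 0" using W_plane[OF j y zS] w(2)[OF yS] by (simp add: v_def)
  qed
  then show ?thesis using w(2)[OF h] by (simp add: v_def)
qed

text \<open>This is an expanded squared modulus: \<open>p u u'\<close> is the contribution of the
  complement of the pole, and \<open>W z \<bullet> W z'\<close> is the cross term.\<close>

lemma state_formula:
  assumes z: "z \<in> plane pole u" and u: "u \<in> S" "p pole u = 0"
    and z': "z' \<in> plane pole u'" and u': "u' \<in> S" "p pole u' = 0"
  shows "p z z' = p z pole * p z' pole + (1 - p z pole) * (1 - p z' pole) * p u u' + 2 * (W z \<bullet> W z')"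
proof -
  have S: "z \<in> S" "z' \<in> S" using planeD(1) z z' by auto
  have uo: "p u pole = 0" using u p_sym[OF x_in u(1), of k] by simp
  have "p u z' = p u u' * p u' z'" by (rule plane_transfer[OF x_in u' z' u(1) uo])
  moreover have "p u' z' = 1 - p z' pole" using planeD(2)[OF z'] p_sym[OF x_in S(2), of k] by simp
  moreover have "p z u = 1 - p z pole"
    using planeD(2)[OF z] p_sym[OF x_in S(1), of k] p_sym[OF u(1) S(1)] by simp
  ultimately show ?thesis
    using state_formula_half[OF z u S(2)] p_sym[OF x_in S(2), of k] by simp
qed

text \<open>The Born formula of \<open>plane_axes\<close> writes \<open>z\<close>, against all
  \<open>h\<close>, as a combination of \<open>pole\<close>, \<open>u\<close>, \<open>f'\<close>,
  \<open>g'\<close>. The identity passes to \<open>W\<close>, which vanishes at the first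
  two.\<close>

lemma W_expand:
  assumes u: "u \<in> S" "p pole u = 0" and ax: "plane_axes pole u f' g'" and z: "z \<in> plane pole u"
  shows "W z = (2 * offset pole u f' z) *\<^sub>R W f' + (2 * offset pole u g' z) *\<^sub>R W g'"
proof -
  define cf cg where "cf = offset pole u f' z" and "cg = offset pole u g' z"
  have uo: "p u pole = 0" using u p_sym[OF x_in u(1), of k] by simp
  have S: "z \<in> S" "f' \<in> S" "g' \<in> S" using z ax planeD(1) unfolding plane_axes_def by blast+
  have "w \<bullet> W z = w \<bullet> ((2 * cf) *\<^sub>R W f' + (2 * cg) *\<^sub>R W g')" for w
  proof -
    obtain v where v: "observable v" "\<And>h. h \<in> S \<Longrightarrow> v h = w \<bullet> W h"
      by (rule W_observable) (rule that)
    \<comment> \<open>Each \<open>offset\<close> contains half of the weights at \<open>pole\<close>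
      and \<open>u\<close>; collecting these shifts both coefficients by
      \<open>- cf - cg\<close>.\<close>
    define \<Phi> where "\<Phi> F = F z - ((p pole z - cf - cg) * F pole + (p u z - cf - cg) * F u
      + 2 * cf * F f' + 2 * cg * F g')" for F :: "'a \<Rightarrow> real"
    have "\<Phi> v = 0"
    proof (rule observable_annihilator[OF v(1)])
      fix h assume "h \<in> S"
      then have "p h z = p h pole * p pole z + p h u * p u z
          + 2 * (offset pole u f' h * cf + offset pole u g' h * cg)"
        using ax z unfolding plane_axes_def cf_def cg_def by blast
      then show "\<Phi> (p h) = 0" unfolding \<Phi>_def offset_def by (simp add: field_simps)
    qed (simp_all add: \<Phi>_def algebra_simps)
    then show ?thesis
      using v(2)[OF S(1)] v(2)[OF S(2)] v(2)[OF S(3)] v(2)[OF x_in] v(2)[OF u(1)] W_pole W_perp[OF u(1) uo]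
      by (simp add: \<Phi>_def inner_add_right)
  qed
  then show ?thesis unfolding cf_def cg_def using vector_eq_ldot by blast
qed

text \<open>Equatorial states have \<open>W\<close> of length 1/2, the source of the factor in the
  unit vectors \<open>2 *\<^sub>R W f'\<close>.\<close>

lemma axes_orthonormal:
  assumes u: "u \<in> S" "p pole u = 0" and ax: "plane_axes pole u f' g'"
  shows "W f' \<bullet> W f' = 1/4" "W g' \<bullet> W g' = 1/4" "W f' \<bullet> W g' = 0"
proof -
  have pl: "f' \<in> plane pole u" "g' \<in> plane pole u" and h: "p f' pole = 1/2" "p g' pole = 1/2" "p f' g' = 1/2"
    using ax unfolding plane_axes_def by auto
  show "W f' \<bullet> W f' = 1/4"
    using state_formula[OF pl(1) u pl(1) u] h p_self[OF u(1)] p_self[OF planeD(1)[OF pl(1)]] by simp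
  show "W g' \<bullet> W g' = 1/4"
    using state_formula[OF pl(2) u pl(2) u] h p_self[OF u(1)] p_self[OF planeD(1)[OF pl(2)]] by simp
  show "W f' \<bullet> W g' = 0"
    using state_formula[OF pl(1) u pl(2) u] h p_self[OF u(1)] by simp
qed

lemma axes_inner:
  assumes u: "u \<in> S" "p pole u = 0" and ax: "plane_axes pole u f' g'" and h: "h \<in> S"
  shows "(2 *\<^sub>R W f') \<bullet> W h = offset pole u f' h" "(2 *\<^sub>R W g') \<bullet> W h = offset pole u g' h"
proof -
  have pl: "f' \<in> plane pole u" "g' \<in> plane pole u" and hf: "p f' pole = 1/2" "p g' pole = 1/2"
    using ax unfolding plane_axes_def by auto
  have *: "(2 *\<^sub>R W y) \<bullet> W h = offset pole u y h" if y: "y \<in> plane pole u" "p y pole = 1/2" for y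
  proof -
    have yS: "y \<in> S" using planeD(1)[OF y(1)] .
    have yu: "p y u = 1/2"
      using planeD(2)[OF y(1)] y(2) p_sym[OF yS x_in, of k] p_sym[OF yS u(1)] by simp
    show ?thesis
      using state_formula_half[OF y(1) u h, unfolded y(2) yu] p_sym[OF h yS] p_sym[OF h x_in, of k] p_sym[OF h u(1)]
      by (simp add: offset_def field_simps)
  qed
  show "(2 *\<^sub>R W f') \<bullet> W h = offset pole u f' h" "(2 *\<^sub>R W g') \<bullet> W h = offset pole u g' h"
    by (rule *; use pl hf in simp)+
qed

text \<open>\<open>v\<close> runs through the unit circle of the real plane spanned by the equator
  over \<open>u\<close>, and \<open>w\<close> is either of the two unit vectors perpendicular to it,
  selected by \<open>c\<close>. It is a relation because neither a point of the circle nor an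
  orientation is canonical.\<close>

definition fibre :: "'a \<Rightarrow> complex ^ 'n \<Rightarrow> complex ^ 'n \<Rightarrow> bool" where
  "fibre u v w \<longleftrightarrow> u \<in> S \<and> p pole u = 0 \<and> (\<exists>f g a b c. plane_axes pole u f g \<and> a\<^sup>2 + b\<^sup>2 = 1 \<and> c\<^sup>2 = 1 \<and>
     v = a *\<^sub>R (2 *\<^sub>R W f) + b *\<^sub>R (2 *\<^sub>R W g) \<and>
     w = c *\<^sub>R (b *\<^sub>R (2 *\<^sub>R W f) - a *\<^sub>R (2 *\<^sub>R W g)))"

lemma fibreE:
  assumes "fibre u v w"
  obtains f' g' a b c where "u \<in> S" "p pole u = 0" "plane_axes pole u f' g'" "a\<^sup>2 + b\<^sup>2 = 1" "c\<^sup>2 = 1"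
     "v = a *\<^sub>R (2 *\<^sub>R W f') + b *\<^sub>R (2 *\<^sub>R W g')" "w = c *\<^sub>R (b *\<^sub>R (2 *\<^sub>R W f') - a *\<^sub>R (2 *\<^sub>R W g'))"
  using assms unfolding fibre_def by blast

lemma fibre_neg: "fibre u v w \<Longrightarrow> fibre u v (- w)"
proof (erule fibreE)
  fix f g a b c
  assume *: "u \<in> S" "p pole u = 0" "plane_axes pole u f g" "a\<^sup>2 + b\<^sup>2 = 1" "c\<^sup>2 = 1"
     "v = a *\<^sub>R (2 *\<^sub>R W f) + b *\<^sub>R (2 *\<^sub>R W g)" "w = c *\<^sub>R (b *\<^sub>R (2 *\<^sub>R W f) - a *\<^sub>R (2 *\<^sub>R W g))"
  have "(- c)\<^sup>2 = 1" "- w = (- c) *\<^sub>R (b *\<^sub>R (2 *\<^sub>R W f) - a *\<^sub>R (2 *\<^sub>R W g))" using * by simp_all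
  then show "fibre u v (- w)" unfolding fibre_def using *(1-4,6) by blast
qed

lemma fibre_rotate:
  assumes "fibre u v w" "r\<^sup>2 + s\<^sup>2 = 1"
  shows "fibre u (r *\<^sub>R v + s *\<^sub>R w) (s *\<^sub>R v - r *\<^sub>R w)"
  using assms(1)
proof (rule fibreE)
  fix f g a b c
  assume *: "u \<in> S" "p pole u = 0" "plane_axes pole u f g" "a\<^sup>2 + b\<^sup>2 = 1" "c\<^sup>2 = 1"
     "v = a *\<^sub>R (2 *\<^sub>R W f) + b *\<^sub>R (2 *\<^sub>R W g)" "w = c *\<^sub>R (b *\<^sub>R (2 *\<^sub>R W f) - a *\<^sub>R (2 *\<^sub>R W g))"
  \<comment> \<open>Coordinates of the new first vector. The transformation with rows (r, s) and (s,
    -r) is a reflection, which is why the sign \<open>c\<close> becomes \<open>- c\<close>.\<close>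
  define a' b' where "a' = r * a + s * c * b" and "b' = r * b - s * c * a"
  have cc: "c * c = 1" using *(5) by (simp add: power2_eq_square)
  have "a'\<^sup>2 + b'\<^sup>2 = (r\<^sup>2 + (c * c) * s\<^sup>2) * (a\<^sup>2 + b\<^sup>2)"
    by (simp add: a'_def b'_def power2_eq_square algebra_simps)
  then have 1: "a'\<^sup>2 + b'\<^sup>2 = 1" using assms(2) *(4) cc by simp
  have 2: "r *\<^sub>R v + s *\<^sub>R w = a' *\<^sub>R (2 *\<^sub>R W f) + b' *\<^sub>R (2 *\<^sub>R W g)"
    unfolding *(6,7) a'_def b'_def by (simp add: algebra_simps)
  have ca: "(- c) * a' = - (r * c * a) - (c * c) * (s * b)" and cb: "(- c) * b' = - (r * c * b) + (c * c) * (s * a)"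
    by (simp_all add: a'_def b'_def algebra_simps)
  have "s *\<^sub>R v - r *\<^sub>R w
      = (s * a - r * c * b) *\<^sub>R (2 *\<^sub>R W f) + (s * b + r * c * a) *\<^sub>R (2 *\<^sub>R W g)"
    unfolding *(6,7) by (simp add: algebra_simps)
  also have "s * a - r * c * b = (- c) * b'" unfolding cb cc by simp
  also have "s * b + r * c * a = - ((- c) * a')" unfolding ca cc by simp
  finally have 3: "s *\<^sub>R v - r *\<^sub>R w = (- c) *\<^sub>R (b' *\<^sub>R (2 *\<^sub>R W f) - a' *\<^sub>R (2 *\<^sub>R W g))"
    by (simp add: algebra_simps)
  have "(- c)\<^sup>2 = 1" using *(5) by simp
  then show ?thesis unfolding fibre_def using *(1-3) 1 2 3 by blast
qed

lemma fibre_unit: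
  assumes "fibre u v w"
  shows "v \<bullet> v = 1" "w \<bullet> w = 1" "v \<bullet> w = 0" "v $ k = 0" "w $ k = 0"
proof -
  obtain f g a b c where *: "u \<in> S" "p pole u = 0" "plane_axes pole u f g" "a\<^sup>2 + b\<^sup>2 = 1" "c\<^sup>2 = 1"
     "v = a *\<^sub>R (2 *\<^sub>R W f) + b *\<^sub>R (2 *\<^sub>R W g)" "w = c *\<^sub>R (b *\<^sub>R (2 *\<^sub>R W f) - a *\<^sub>R (2 *\<^sub>R W g))"
    by (rule fibreE[OF assms]) (rule that)
  define P Q where "P = 2 *\<^sub>R W f" and "Q = 2 *\<^sub>R W g"
  note o = axes_orthonormal[OF *(1-3)]
  have PQ: "P \<bullet> P = 1" "Q \<bullet> Q = 1" "P \<bullet> Q = 0" "Q \<bullet> P = 0"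
    using o inner_commute[of "W g" "W f"] by (simp_all add: P_def Q_def)
  have vw: "v = a *\<^sub>R P + b *\<^sub>R Q" "w = c *\<^sub>R (b *\<^sub>R P - a *\<^sub>R Q)" using *(6,7) by (simp_all add: P_def Q_def)
  show "v \<bullet> v = 1" using *(4) unfolding vw
    by (simp add: inner_add_left inner_add_right PQ power2_eq_square)
  have "w \<bullet> w = (c * c) * (a\<^sup>2 + b\<^sup>2)" unfolding vw
    by (simp add: inner_diff_left inner_diff_right PQ power2_eq_square algebra_simps)
  then show "w \<bullet> w = 1" using *(4,5) by (simp add: power2_eq_square)
  show "v \<bullet> w = 0" unfolding vw
    by (simp add: inner_add_left inner_diff_right PQ)
  show "v $ k = 0" "w $ k = 0" unfolding *(6,7) by (simp_all add: W_nth)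
qed

text \<open>The left side is the squared length of the projection of \<open>W h\<close> to the plane
  of the fibre, so it may be computed in the axes, where it is a clause of
  \<open>plane_axes\<close>.\<close>

lemma fibre_inner_sq:
  assumes "fibre u v w" "h \<in> S"
  shows "(v \<bullet> W h)\<^sup>2 + (w \<bullet> W h)\<^sup>2 = p h pole * p h u"
proof -
  obtain f g a b c where *: "u \<in> S" "p pole u = 0" "plane_axes pole u f g" "a\<^sup>2 + b\<^sup>2 = 1" "c\<^sup>2 = 1"
     "v = a *\<^sub>R (2 *\<^sub>R W f) + b *\<^sub>R (2 *\<^sub>R W g)" "w = c *\<^sub>R (b *\<^sub>R (2 *\<^sub>R W f) - a *\<^sub>R (2 *\<^sub>R W g))"
    by (rule fibreE[OF assms(1)]) (rule that)
  define F G where "F = offset pole u f h" and "G = offset pole u g h"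
  have vh: "v \<bullet> W h = a * F + b * G" and wh: "w \<bullet> W h = c * (b * F - a * G)"
    unfolding *(6,7) inner_add_left inner_diff_left inner_scaleR_left[of a] inner_scaleR_left[of b]
      inner_scaleR_left[of c] axes_inner[OF *(1-3) assms(2)] F_def G_def by simp_all
  have "(v \<bullet> W h)\<^sup>2 + (w \<bullet> W h)\<^sup>2 = (a * F + b * G)\<^sup>2 + c\<^sup>2 * (b * F - a * G)\<^sup>2"
    unfolding vh wh by (simp add: power_mult_distrib)
  also have "\<dots> = (a\<^sup>2 + b\<^sup>2) * (F\<^sup>2 + G\<^sup>2)"
    unfolding *(5) by (simp add: power2_eq_square algebra_simps)
  also have "\<dots> = p h pole * p h u"
    using *(3) assms(2) unfolding *(4) F_def G_def plane_axes_def by simp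
  finally show ?thesis .
qed

text \<open>The equatorial state \<open>z\<close> over \<open>u'\<close> in direction
  \<open>v'\<close> has \<open>W z\<close> equal to half of \<open>v'\<close>. Since
  \<open>p z pole = 1/2\<close> and \<open>p z u = p u u' / 2\<close>, the factors 1/4 on both sides
  cancel.\<close>

lemma fibre_transition:
  assumes "fibre u v w" "fibre u' v' w'"
  shows "p u u' = (v \<bullet> v')\<^sup>2 + (w \<bullet> v')\<^sup>2"
proof -
  have u: "u \<in> S" "p pole u = 0" using assms(1) by (auto simp: fibre_def)
  have uo: "p u pole = 0" using u p_sym[OF x_in u(1), of k] by simp
  obtain f g a b c where *: "u' \<in> S" "p pole u' = 0" "plane_axes pole u' f g" "a\<^sup>2 + b\<^sup>2 = 1" "c\<^sup>2 = 1"
     "v' = a *\<^sub>R (2 *\<^sub>R W f) + b *\<^sub>R (2 *\<^sub>R W g)" "w' = c *\<^sub>R (b *\<^sub>R (2 *\<^sub>R W f) - a *\<^sub>R (2 *\<^sub>R W g))"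
    by (rule fibreE[OF assms(2)]) (rule that)
  obtain z where z: "z \<in> plane pole u'" "p z pole = 1/2" "offset pole u' f z = a / 2" "offset pole u' g z = b / 2"
    using *(3,4) unfolding plane_axes_def by blast
  have zS: "z \<in> S" using planeD(1)[OF z(1)] .
  have Wz: "W z = (1/2) *\<^sub>R v'"
    unfolding W_expand[OF *(1-3) z(1)] z(3,4) *(6) by (simp add: scaleR_add_right)
  have "p u z = p u u' * p u' z" by (rule plane_transfer[OF x_in *(1,2) z(1) u(1) uo])
  moreover have "p u' z = 1/2" using planeD(2)[OF z(1)] z(2) p_sym[OF x_in zS, of k] by simp
  ultimately have "p z u = p u u' / 2" using p_sym[OF zS u(1)] by simp
  then show ?thesis
    using fibre_inner_sq[OF assms(1) zS] z(2) unfolding Wz by (simp add: power_divide)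
qed

text \<open>Polar decomposition of \<open>W z\<close> in the plane of the fibre. Where the length is
  0, at the two poles of the sphere, the direction is arbitrary.\<close>

lemma fibre_state:
  assumes u: "u \<in> S" "p pole u = 0" and z: "z \<in> plane pole u"
  obtains v w where "fibre u v w" "W z = sqrt (p z pole * (1 - p z pole)) *\<^sub>R v"
proof -
  obtain f g where ax: "plane_axes pole u f g"
    by (rule plane_axes_exist[OF x_in u axV]) (rule that)
  have zS: "z \<in> S" using planeD(1)[OF z] .
  have zu: "p z u = 1 - p z pole"
    using planeD(2)[OF z] p_sym[OF x_in zS, of k] p_sym[OF u(1) zS] by simp
  define q F G where "q = sqrt (p z pole * (1 - p z pole))"
    and "F = offset pole u f z" and "G = offset pole u g z"
  have "0 \<le> p z pole * (1 - p z pole)" using p_nonneg[OF zS x_in] p_le_1[OF zS x_in] by simp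
  then have q2: "q\<^sup>2 = p z pole * (1 - p z pole)" by (simp add: q_def)
  have FG: "F\<^sup>2 + G\<^sup>2 = q\<^sup>2"
    using ax zS unfolding plane_axes_def F_def G_def q2 zu[symmetric] by blast
  obtain a b where ab: "a\<^sup>2 + b\<^sup>2 = 1" "F = q * a" "G = q * b"
  proof (cases "q = 0")
    case True
    then have "F = 0" "G = 0" using FG by (simp_all add: sum_power2_eq_zero_iff)
    then show ?thesis using that[of 1 0] True by simp
  next
    case False
    then have "(F / q)\<^sup>2 + (G / q)\<^sup>2 = 1" using FG by (simp add: power_divide flip: add_divide_distrib)
    then show ?thesis using that[of "F / q" "G / q"] False by simp
  qed
  define v where "v = a *\<^sub>R (2 *\<^sub>R W f) + b *\<^sub>R (2 *\<^sub>R W g)"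
  define w where "w = 1 *\<^sub>R (b *\<^sub>R (2 *\<^sub>R W f) - a *\<^sub>R (2 *\<^sub>R W g))"
  have "fibre u v w"
    unfolding fibre_def using u ax ab(1) v_def w_def by (metis power_one)
  moreover have "W z = q *\<^sub>R v"
    unfolding W_expand[OF u ax z] F_def[symmetric] G_def[symmetric] ab(2,3) v_def
    by (simp add: algebra_simps)
  ultimately show thesis using that unfolding q_def by blast
qed

lemma fibre_axis:
  assumes j: "j \<noteq> k"
  shows "fibre (x j) (axis j 1) (axis j \<i>)"
proof -
  have ax: "plane_axes pole (x j) (f j) (g j)" by (rule axes[OF j])
  have pl: "f j \<in> plane pole (x j)" "g j \<in> plane pole (x j)" and h: "p (f j) pole = 1/2" "p (g j) pole = 1/2" "p (f j) (g j) = 1/2"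
    using ax unfolding plane_axes_def by auto
  have S: "f j \<in> S" "g j \<in> S" using pl planeD(1) by auto
  have hx: "p (f j) (x j) = 1/2" "p (g j) (x j) = 1/2"
    using planeD(2)[OF pl(1)] planeD(2)[OF pl(2)] h p_sym[OF S(1) x_in, of k] p_sym[OF S(2) x_in, of k]
      p_sym[OF S(1) x_in, of j] p_sym[OF S(2) x_in, of j] by simp_all
  have off: "offset pole (x j) (f j) (f j) = 1/2" "offset pole (x j) (g j) (f j) = 0"
    "offset pole (x j) (f j) (g j) = 0" "offset pole (x j) (g j) (g j) = 1/2"
    using h hx p_self[OF S(1)] p_self[OF S(2)] p_sym[OF S] by (simp_all add: offset_def)
  have other: "W y $ i = 0" if "y \<in> plane pole (x j)" "i \<noteq> j" for y i
    using x_plane[OF j that(1), of i] that planeD(1)[OF that(1)] by (intro W_zero) auto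
  have f: "2 *\<^sub>R W (f j) = axis j 1"
    unfolding vec_eq_iff
  proof
    fix i show "(2 *\<^sub>R W (f j)) $ i = axis j 1 $ i"
      by (cases "i = j") (use j off other[OF pl(1)] in \<open>simp_all add: W_nth axis_def complex_eq_iff\<close>)
  qed
  have g: "2 *\<^sub>R W (g j) = axis j \<i>"
    unfolding vec_eq_iff
  proof
    fix i show "(2 *\<^sub>R W (g j)) $ i = axis j \<i> $ i"
      by (cases "i = j") (use j off other[OF pl(2)] in \<open>simp_all add: W_nth axis_def complex_eq_iff\<close>)
  qed
  show ?thesis
    unfolding fibre_def
  proof (intro conjI exI)
    show "plane_axes pole (x j) (f j) (g j)" by fact
    \<comment> \<open>The second vector is \<open>c\<close> times \<open>b\<close> first axis minus
      \<open>a\<close> second axis; with \<open>a = 1\<close> and \<open>b = 0\<close> the sign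
      \<open>c = -1\<close> gives plus the second axis.\<close>
    show "(1::real)\<^sup>2 + 0\<^sup>2 = 1" "(-1::real)\<^sup>2 = 1" by simp_all
    show "axis j 1 = 1 *\<^sub>R (2 *\<^sub>R W (f j)) + 0 *\<^sub>R (2 *\<^sub>R W (g j))"
      "axis j \<i> = (-1) *\<^sub>R (0 *\<^sub>R (2 *\<^sub>R W (f j)) - 1 *\<^sub>R (2 *\<^sub>R W (g j)))"
      unfolding f g by simp_all
  qed (use j x_in x_orth in auto)
qed

lemma W_spans:
  assumes "c $ k = 0" "\<And>z. z \<in> S \<Longrightarrow> c \<bullet> W z = 0"
  shows "c = 0"
  unfolding vec_eq_iff
proof
  fix j show "c $ j = 0 $ j"
  proof (cases "j = k")
    case False
    have *: "c \<bullet> v = 0" if fib: "fibre u v w" for u v w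
    proof -
      obtain f g a b d where *: "plane_axes pole u f g" "v = a *\<^sub>R (2 *\<^sub>R W f) + b *\<^sub>R (2 *\<^sub>R W g)"
        by (rule fibreE[OF fib]) (rule that)
      then have "f \<in> S" "g \<in> S" using planeD(1) unfolding plane_axes_def by blast+
      then show ?thesis using assms(2) *(2) by (simp add: inner_add_right)
    qed
    note F = fibre_axis[OF False]
    have "c \<bullet> axis j 1 = 0" by (rule *[OF F])
    moreover have "c \<bullet> axis j \<i> = 0" using *[OF fibre_rotate[OF F, of 0 1]] by simp
    ultimately show ?thesis by (simp add: inner_axis inner_complex_def complex_eq_iff)
  qed (use assms(1) in simp)
qed

text \<open>Pairing with \<open>v\<close> is a tangent observable, so it is \<kappa> times
  \<open>p y - p y'\<close>, which by the state formula is pairing with \<open>4 * \<kappa>\<close>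
  times \<open>W y\<close>. Hence \<open>v\<close> is the direction of an equatorial state.\<close>

lemma fibre_surjective:
  assumes v: "v \<bullet> v = 1" "v $ k = 0"
  obtains u w where "fibre u v w"
proof -
  obtain V where V: "observable V" "\<And>z. z \<in> S \<Longrightarrow> V z = v \<bullet> W z"
    by (rule W_observable) (rule that)
  have tan: "tangent pole V"
    unfolding tangent_def using V(1) V(2)[OF x_in] V(2) W_pole W_perp by simp
  \<comment> \<open>A nonzero tangent observable takes both signs, because its values at
    \<open>y\<close> and \<open>y'\<close> in \<open>tangent_max\<close> are opposite.\<close>
  have "\<exists>z\<in>S. V z > 0"
  proof (rule ccontr)
    assume no: "\<not> ?thesis"
    have "v \<bullet> W z = 0" if z: "z \<in> S" for z
    proof (rule ccontr)
      assume "v \<bullet> W z \<noteq> 0"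
      then have "0 < - V z" using no z V(2)[OF z] by force
      then obtain y y' where y: "y' \<in> S" "V y' > 0"
        using tangent_max[OF tangent_uminus[OF tan] x_in z] planeD(1)
        by (metis add.inverse_inverse)
      then show False using no by blast
    qed
    then have "v = 0" by (rule W_spans[OF v(2)])
    then show False using v(1) by simp
  qed
  then obtain z where z: "z \<in> S" "0 < V z" by blast
  obtain \<kappa> y y' u where y: "0 < \<kappa>" "u \<in> S" "p pole u = 0" "y \<in> plane pole u" "y' \<in> plane pole u" "p y y' = 0"
    "p y pole = 1/2" "p y' pole = 1/2" and sum: "\<And>z. z \<in> S \<Longrightarrow> p y z + p y' z = p pole z + p u z"
    and val: "\<And>z. z \<in> S \<Longrightarrow> V z = \<kappa> * (p y z - p y' z)"
    by (rule tangent_structure[OF tan x_in z]) (rule that)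
  have S: "y \<in> S" "y' \<in> S" using y(4,5) planeD(1) by auto
  have uo: "p u pole = 0" using y(3) p_sym[OF x_in y(2), of k] by simp
  have hu: "p y u = 1/2" "p y' u = 1/2"
    using planeD(2)[OF y(4)] planeD(2)[OF y(5)] y(7,8) p_sym[OF S(1) x_in, of k] p_sym[OF S(2) x_in, of k]
      p_sym[OF S(1) y(2)] p_sym[OF S(2) y(2)] by simp_all
  have "W y + W y' = W pole + W u" by (rule W_pair_sum[OF S x_in y(2) sum])
  then have Wy': "W y' = - W y" using W_pole W_perp[OF y(2) uo] by (simp add: eq_neg_iff_add_eq_0 add.commute)
  have eq: "(v - (4 * \<kappa>) *\<^sub>R W y) \<bullet> W z = 0" if z: "z \<in> S" for z
  proof -
    have "p y z - p y' z = 4 * (W y \<bullet> W z)"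
      using state_formula_half[OF y(4) y(2,3) z] state_formula_half[OF y(5) y(2,3) z] y(7,8) hu Wy' by simp
    then have "v \<bullet> W z = \<kappa> * (4 * (W y \<bullet> W z))" using val[OF z] V(2)[OF z] by simp
    then show ?thesis by (simp add: inner_diff_left)
  qed
  have "v - (4 * \<kappa>) *\<^sub>R W y = 0"
    by (rule W_spans[OF _ eq]) (use v(2) in \<open>simp add: W_nth\<close>)
  then have ve: "v = (4 * \<kappa>) *\<^sub>R W y" by simp
  obtain v' w where F: "fibre u v' w" "W y = sqrt (p y pole * (1 - p y pole)) *\<^sub>R v'"
    by (rule fibre_state[OF y(2,3,4)]) (rule that)
  \<comment> \<open>Since \<open>W y\<close> has length 1/2, the normalisation of \<open>v\<close>
    forces \<open>2 * \<kappa> = 1\<close>.\<close>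
  have "sqrt (1/2 * (1 - 1/2)) = (1/2 :: real)" using real_sqrt_abs2[of "1/2"] by simp
  then have "W y = (1/2) *\<^sub>R v'" using F(2) unfolding y(7) by simp
  then have v2: "v = (2 * \<kappa>) *\<^sub>R v'" using ve by simp
  have "(2 * \<kappa>)\<^sup>2 = 1" using v(1) fibre_unit(1)[OF F(1)] unfolding v2 by (simp add: power2_eq_square)
  then have "2 * \<kappa> = 1 \<or> 2 * \<kappa> = -1" by (simp only: power2_eq_1_iff)
  then have "2 * \<kappa> = 1" using y(1) by linarith
  then have "v = v'" using v2 by simp
  then show thesis using F(1) that by blast
qed

end

section \<open>Isoclinic circle fibrations are complex\<close>

lemma hermitian_dot_Re_Im:
  "Re (hermitian_dot u v) = u \<bullet> v" "Im (hermitian_dot u v) = (\<i> *s u) \<bullet> v"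
  by (simp_all add: hermitian_dot_def inner_vec_def inner_complex_def algebra_simps)

lemma hermitian_dot_add_left: "hermitian_dot (u + v) w = hermitian_dot u w + hermitian_dot v w"
  by (simp add: hermitian_dot_def algebra_simps sum.distrib)

lemma hermitian_dot_scaleR_left: "hermitian_dot (r *\<^sub>R u) w = r *\<^sub>R hermitian_dot u w"
  by (simp add: hermitian_dot_def scaleR_sum_right)

lemma hermitian_dot_axis: "hermitian_dot (axis j 1) w = w $ j"
proof -
  have "hermitian_dot (axis j 1) w = (\<Sum>i\<in>UNIV. if i = j then w $ j else 0)"
    unfolding hermitian_dot_def by (intro sum.cong) (auto simp: axis_def)
  then show ?thesis by simp
qed

lemma cmod_hermitian_dot: "(cmod (hermitian_dot u v))\<^sup>2 = (u \<bullet> v)\<^sup>2 + ((\<i> *s u) \<bullet> v)\<^sup>2"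
  by (simp add: cmod_power2 hermitian_dot_Re_Im)

text \<open>The squares leave a separate sign for each component; the product condition couples the
  two signs, which excludes the reflected values i conj(a) and -i conj(a) unless they agree with the
  others.\<close>

lemma quarter_turn:
  fixes a b :: complex
  assumes "(Re b)\<^sup>2 = (Im a)\<^sup>2" "(Im b)\<^sup>2 = (Re a)\<^sup>2" "Re b * Im b = - (Re a * Im a)"
  shows "b = \<i> * a \<or> b = - (\<i> * a)"
proof -
  have "Re b = Im a \<or> Re b = - Im a" "Im b = Re a \<or> Im b = - Re a"
    using assms(1,2) by (simp_all add: power2_eq_iff)
  then show ?thesis using assms(3) by (auto simp: complex_eq_iff)
qed

text \<open>\<open>L u v w\<close> lists orthonormal bases of the plane over \<open>u\<close>, and
  \<open>trans\<close> is isoclinicity: the length of a projection does not depend on the position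
  of the unit vector \<open>v'\<close> in its plane. Abstracting from \<open>fibre\<close> allows a
  second instance after conjugating coordinates.\<close>

locale circle_fibration =
  fixes L :: "'u \<Rightarrow> complex ^ 'n \<Rightarrow> complex ^ 'n::finite \<Rightarrow> bool" and K :: "'u \<Rightarrow> 'u \<Rightarrow> real" and k :: 'n
  assumes unit: "L u v w \<Longrightarrow> v \<bullet> v = 1" "L u v w \<Longrightarrow> w \<bullet> w = 1" "L u v w \<Longrightarrow> v \<bullet> w = 0"
      "L u v w \<Longrightarrow> v $ k = 0" "L u v w \<Longrightarrow> w $ k = 0"
    and trans: "L u v w \<Longrightarrow> L u' v' w' \<Longrightarrow> K u u' = (v \<bullet> v')\<^sup>2 + (w \<bullet> v')\<^sup>2"
    and sym: "L u v w \<Longrightarrow> L u' v' w' \<Longrightarrow> K u u' = K u' u"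
    and neg: "L u v w \<Longrightarrow> L u v (- w)"
    and rot: "L u v w \<Longrightarrow> r\<^sup>2 + s\<^sup>2 = 1 \<Longrightarrow> L u (r *\<^sub>R v + s *\<^sub>R w) (s *\<^sub>R v - r *\<^sub>R w)"
    and surj: "v \<bullet> v = 1 \<Longrightarrow> v $ k = 0 \<Longrightarrow> \<exists>u w. L u v w"
    and axis: "j \<noteq> k \<Longrightarrow> \<exists>u. L u (axis j 1) (axis j \<i>)"
begin

text \<open>\<open>K u u'\<close> is both the squared length of the projection of \<open>v\<close>
  to the complex line of \<open>h\<close> and, by symmetry, that of any unit vector of this line to
  the plane of \<open>v\<close>, \<open>w\<close>. The second quadratic form is therefore constant
  on a circle, so its squares agree and its mixed term vanishes.\<close>

lemma complex_probe:
  assumes L: "L u v w" and h: "L u' h (\<i> *s h)"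
  shows "hermitian_dot h w = \<i> * hermitian_dot h v \<or> hermitian_dot h w = - (\<i> * hermitian_dot h v)"
proof (rule quarter_turn)
  define a b c d where "a = h \<bullet> v" and "b = (\<i> *s h) \<bullet> v" and "c = h \<bullet> w" and "d = (\<i> *s h) \<bullet> w"
  have K1: "K u u' = a\<^sup>2 + b\<^sup>2"
    using trans[OF h L] sym[OF L h] by (simp add: a_def b_def)
  have K2: "K u u' = (r * a + s * b)\<^sup>2 + (r * c + s * d)\<^sup>2" if "r\<^sup>2 + s\<^sup>2 = 1" for r s
    using trans[OF L rot[OF h that]]
    by (simp add: a_def b_def c_def d_def inner_add_right inner_commute)
  have 1: "c\<^sup>2 = b\<^sup>2" using K1 K2[of 1 0] by simp
  have 2: "d\<^sup>2 = a\<^sup>2" using K1 K2[of 0 1] by simp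
  \<comment> \<open>The diagonal direction isolates the mixed term of the quadratic form.\<close>
  have s: "(1 / sqrt 2)\<^sup>2 + (1 / sqrt 2)\<^sup>2 = (1::real)" by (simp add: power_divide)
  have "K u u' = (a + b)\<^sup>2 / 2 + (c + d)\<^sup>2 / 2"
    using K2[OF s] by (simp add: power_divide flip: add_divide_distrib)
  moreover have "(a + b)\<^sup>2 = a\<^sup>2 + b\<^sup>2 + 2 * (a * b)" "(c + d)\<^sup>2 = c\<^sup>2 + d\<^sup>2 + 2 * (c * d)"
    by (simp_all add: power2_sum)
  ultimately have 3: "c * d = - (a * b)" using K1 1 2 by linarith
  show "(Re (hermitian_dot h w))\<^sup>2 = (Im (hermitian_dot h v))\<^sup>2"
    "(Im (hermitian_dot h w))\<^sup>2 = (Re (hermitian_dot h v))\<^sup>2"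
    "Re (hermitian_dot h w) * Im (hermitian_dot h w) = - (Re (hermitian_dot h v) * Im (hermitian_dot h v))"
    unfolding hermitian_dot_Re_Im using 1 2 3 by (simp_all add: a_def b_def c_def d_def)
qed

text \<open>The sign may still depend on \<open>j\<close>; making it uniform is the remaining
  task.\<close>

lemma axis_probe:
  assumes L: "L u v w" shows "w $ j = \<i> * v $ j \<or> w $ j = - (\<i> * v $ j)"
proof (cases "j = k")
  case True
  then show ?thesis using unit(4,5)[OF L] by simp
next
  case False
  then obtain u' where "L u' (axis j 1) (axis j \<i>)" using axis by blast
  moreover have "axis j \<i> = \<i> *s (axis j 1 :: complex ^ 'n)" by (simp add: vec_eq_iff axis_def)
  ultimately have "L u' (axis j 1) (\<i> *s axis j 1)" by simp
  then show ?thesis using complex_probe[OF L, of u' "axis j 1"] unfolding hermitian_dot_axis by blast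
qed

text \<open>A probe that couples the coordinates \<open>b\<close> and \<open>j\<close> and so
  compares their signs.\<close>

definition diag :: "'n \<Rightarrow> 'n \<Rightarrow> complex ^ 'n" where
  "diag b j = (1 / sqrt 2) *\<^sub>R (axis b 1 + axis j 1)"

lemma hermitian_dot_diag: "hermitian_dot (diag b j) w = (1 / sqrt 2) *\<^sub>R (w $ b + w $ j)"
  by (simp add: diag_def hermitian_dot_scaleR_left hermitian_dot_add_left hermitian_dot_axis
    del: scaleR_add_right)

end

locale oriented_circle_fibration = circle_fibration L K k
  for L :: "'u \<Rightarrow> complex ^ 'n \<Rightarrow> complex ^ 'n::finite \<Rightarrow> bool" and K and k +
  fixes b :: 'n
  assumes b: "b \<noteq> k"
    and oriented: "j \<noteq> k \<Longrightarrow> j \<noteq> b \<Longrightarrow> \<exists>u. L u (diag b j) (\<i> *s diag b j)"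
begin

text \<open>Once the sign at \<open>b\<close> is fixed, the axis probe and the diagonal probe each
  leave two values at \<open>j\<close>. Their wrong values coincide only if
  \<open>v $ b = 0\<close>.\<close>

lemma complex_line_generic:
  assumes L: "L u v w" and vb: "v $ b \<noteq> 0"
  shows "w = \<i> *s v \<or> w = - (\<i> *s v)"
proof -
  have main: "w = \<i> *s v" if L: "L u v w" and wb: "w $ b = \<i> * v $ b" for w
    unfolding vec_eq_iff
  proof
    fix j show "w $ j = (\<i> *s v) $ j"
    proof (cases "j = k \<or> j = b")
      case True
      then show ?thesis using wb unit(4,5)[OF L] by auto
    next
      case False
      then obtain u' where "L u' (diag b j) (\<i> *s diag b j)" using oriented by blast
      then have d: "hermitian_dot (diag b j) w = \<i> * hermitian_dot (diag b j) v
          \<or> hermitian_dot (diag b j) w = - (\<i> * hermitian_dot (diag b j) v)"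
        by (rule complex_probe[OF L])
      have "w $ b + w $ j = \<i> * (v $ b + v $ j) \<or> w $ b + w $ j = - (\<i> * (v $ b + v $ j))"
      proof -
        have "(1 / sqrt 2) *\<^sub>R (w $ b + w $ j) = (1 / sqrt 2) *\<^sub>R (\<i> * (v $ b + v $ j))
          \<or> (1 / sqrt 2) *\<^sub>R (w $ b + w $ j) = (1 / sqrt 2) *\<^sub>R (- (\<i> * (v $ b + v $ j)))"
          using d unfolding hermitian_dot_diag mult_scaleR_right scaleR_minus_right .
        then show ?thesis unfolding scaleR_cancel_left by simp
      qed
      then have "w $ j = \<i> * v $ j \<or> w $ j = - (\<i> * (2 * v $ b + v $ j))"
        unfolding wb by (elim disj_forward) (simp_all add: algebra_simps eq_neg_iff_add_eq_0)
      then consider "w $ j = \<i> * v $ j" | "w $ j = - (\<i> * (2 * v $ b + v $ j))" "w $ j = - (\<i> * v $ j)"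
        using axis_probe[OF L, of j] by blast
      then show ?thesis
      proof cases
        case 2
        then show ?thesis using vb by (simp add: algebra_simps)
      qed simp
    qed
  qed
  show ?thesis
  proof (cases "w $ b = \<i> * v $ b")
    case True
    then show ?thesis using main[OF L] by simp
  next
    case False
    then have "(- w) $ b = \<i> * v $ b" using axis_probe[OF L, of b] by simp
    then have "- w = \<i> *s v" by (rule main[OF neg[OF L]])
    then show ?thesis by (metis minus_minus)
  qed
qed

lemma i_vec_inner: "(\<i> *s v) \<bullet> (\<i> *s w) = v \<bullet> (w :: complex ^ 'n)"
  by (simp add: inner_vec_def inner_complex_def algebra_simps)

text \<open>If \<open>v $ b = 0\<close>, the vector \<open>h\<close> mixes \<open>w\<close> with the
  reference axis, so the fibre through \<open>h\<close> is a complex line and can serve as a probe.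
  It shows that the inner product of i w and v is 1 or -1, the equality case of
  Cauchy-Schwarz.\<close>

lemma complex_line:
  assumes L: "L u v w"
  shows "w = \<i> *s v \<or> w = - (\<i> *s v)"
proof (cases "v $ b = 0")
  case False
  then show ?thesis by (rule complex_line_generic[OF L])
next
  case True
  then have wb: "w $ b = 0" using axis_probe[OF L, of b] by auto
  define h where "h = (1 / sqrt 2) *\<^sub>R (w + axis b 1)"
  have hb: "h $ b \<noteq> 0" by (simp add: h_def wb)
  have "h \<bullet> h = 1"
    using unit(2)[OF L] wb
    by (simp add: h_def inner_add_left inner_add_right inner_axis inner_axis' inner_axis_axis)
  moreover have "h $ k = 0" using unit(5)[OF L] b by (simp add: h_def axis_def)
  ultimately obtain u' w' where h: "L u' h w'" using surj by blast
  have hi: "L u' h (\<i> *s h)"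
    using complex_line_generic[OF h hb] h neg[OF h] by auto
  have hw: "hermitian_dot h w = (1 / sqrt 2) *\<^sub>R hermitian_dot w w"
    and hv: "hermitian_dot h v = (1 / sqrt 2) *\<^sub>R hermitian_dot w v"
    using True wb by (simp_all add: h_def hermitian_dot_scaleR_left hermitian_dot_add_left
      hermitian_dot_axis del: scaleR_add_right)
  have "hermitian_dot w w = \<i> * hermitian_dot w v \<or> hermitian_dot w w = - (\<i> * hermitian_dot w v)"
  proof -
    have "(1 / sqrt 2) *\<^sub>R hermitian_dot w w = (1 / sqrt 2) *\<^sub>R (\<i> * hermitian_dot w v)
        \<or> (1 / sqrt 2) *\<^sub>R hermitian_dot w w = (1 / sqrt 2) *\<^sub>R (- (\<i> * hermitian_dot w v))"
      using complex_probe[OF L hi] unfolding hw hv mult_scaleR_right scaleR_minus_right .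
    then show ?thesis unfolding scaleR_cancel_left by simp
  qed
  then have "Re (hermitian_dot w w) = - Im (hermitian_dot w v) \<or> Re (hermitian_dot w w) = Im (hermitian_dot w v)"
    by auto
  then have "(\<i> *s w) \<bullet> v = -1 \<or> (\<i> *s w) \<bullet> v = 1"
    unfolding hermitian_dot_Re_Im unit(2)[OF L] by auto
  moreover define q where "q = \<i> *s w"
  have qq: "q \<bullet> q = 1" "v \<bullet> v = 1" "v \<bullet> q = q \<bullet> v"
    using unit(1,2)[OF L] by (simp_all add: q_def i_vec_inner inner_commute)
  have "(q + v) \<bullet> (q + v) = 2 + 2 * (q \<bullet> v)" "(q - v) \<bullet> (q - v) = 2 - 2 * (q \<bullet> v)"
    by (simp_all add: inner_add_left inner_add_right inner_diff_left inner_diff_right qq)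
  ultimately have "(q + v) \<bullet> (q + v) = 0 \<or> (q - v) \<bullet> (q - v) = 0"
    unfolding q_def by auto
  then have "\<i> *s w = - v \<or> \<i> *s w = v" unfolding q_def by (auto simp: eq_neg_iff_add_eq_0)
  then have "w = - (\<i> *s v) \<or> w = \<i> *s v"
  proof
    assume e: "\<i> *s w = - v"
    have "\<i> *s (\<i> *s w) = - w" by (simp add: vec_eq_iff)
    then show ?thesis unfolding e by (simp add: vec_eq_iff)
  next
    assume e: "\<i> *s w = v"
    have "\<i> *s (\<i> *s w) = - w" by (simp add: vec_eq_iff)
    then show ?thesis unfolding e by (metis minus_minus)
  qed
  then show ?thesis by blast
qed

lemma transition_hermitian:
  assumes "L u v w" "L u' v' w'"
  shows "K u u' = (cmod (hermitian_dot v v'))\<^sup>2"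
  unfolding cmod_hermitian_dot trans[OF assms]
  using complex_line[OF assms(1)] by auto

end

section \<open>Normalisation by conjugating coordinates\<close>

definition conjugate_on :: "'n set \<Rightarrow> complex ^ 'n \<Rightarrow> complex ^ 'n::finite" where
  "conjugate_on E v = (\<chi> j. if j \<in> E then cnj (v $ j) else v $ j)"

lemma conjugate_on_nth: "conjugate_on E v $ j = (if j \<in> E then cnj (v $ j) else v $ j)"
  by (simp add: conjugate_on_def)

lemma conjugate_on_involution: "conjugate_on E (conjugate_on E v) = v"
  by (simp add: vec_eq_iff conjugate_on_nth)

lemma conjugate_on_inner: "conjugate_on E v \<bullet> conjugate_on E w = v \<bullet> w"
  unfolding inner_vec_def by (intro sum.cong) (auto simp: conjugate_on_nth inner_complex_def)

lemma conjugate_on_linear: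
  "conjugate_on E (- v) = - conjugate_on E v"
  "conjugate_on E (r *\<^sub>R v + s *\<^sub>R w) = r *\<^sub>R conjugate_on E v + s *\<^sub>R conjugate_on E w"
  "conjugate_on E (r *\<^sub>R v - s *\<^sub>R w) = r *\<^sub>R conjugate_on E v - s *\<^sub>R conjugate_on E w"
  by (auto simp: vec_eq_iff conjugate_on_nth)

context circle_fibration begin

text \<open>Conjugation of coordinates is a real isometry, and all conditions but
  \<open>axis\<close> only involve real inner products, real combinations and the entry at
  \<open>k\<close>. In \<open>axis\<close> it may reverse the second vector, which
  \<open>neg\<close> absorbs.\<close>

lemma conjugate_circle_fibration:
  assumes "k \<notin> E"
  shows "circle_fibration (\<lambda>u v w. L u (conjugate_on E v) (conjugate_on E w)) K k"
proof
  fix u v w assume L: "L u (conjugate_on E v) (conjugate_on E w)"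
  show "v \<bullet> v = 1" "w \<bullet> w = 1" "v \<bullet> w = 0"
    using unit(1-3)[OF L] by (simp_all add: conjugate_on_inner)
  show "v $ k = 0" "w $ k = 0"
    using unit(4,5)[OF L] assms by (simp_all add: conjugate_on_nth)
  show "L u (conjugate_on E v) (conjugate_on E (- w))"
    using neg[OF L] by (simp add: conjugate_on_linear)
  show "L u (conjugate_on E (r *\<^sub>R v + s *\<^sub>R w)) (conjugate_on E (s *\<^sub>R v - r *\<^sub>R w))"
    if "r\<^sup>2 + s\<^sup>2 = 1" for r s
    using rot[OF L that] by (simp only: conjugate_on_linear)
  fix u' v' w' assume L': "L u' (conjugate_on E v') (conjugate_on E w')"
  show "K u u' = (v \<bullet> v')\<^sup>2 + (w \<bullet> v')\<^sup>2"
    using trans[OF L L'] by (simp add: conjugate_on_inner)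
  show "K u u' = K u' u" by (rule sym[OF L L'])
next
  fix v :: "complex ^ 'n" assume v: "v \<bullet> v = 1" "v $ k = 0"
  have "\<exists>u w. L u (conjugate_on E v) w"
    by (rule surj) (use v assms in \<open>simp_all add: conjugate_on_inner conjugate_on_nth\<close>)
  then show "\<exists>u w. L u (conjugate_on E v) (conjugate_on E w)"
    by (metis conjugate_on_involution)
next
  fix j assume "j \<noteq> k"
  then obtain u where u: "L u (axis j 1) (axis j \<i>)" using axis by blast
  have 1: "conjugate_on E (axis j 1) = axis j 1"
    by (simp add: vec_eq_iff conjugate_on_nth axis_def)
  have 2: "conjugate_on E (axis j \<i>) = axis j \<i> \<or> conjugate_on E (axis j \<i>) = - axis j \<i>"
    by (cases "j \<in> E") (auto simp: vec_eq_iff conjugate_on_nth axis_def)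
  show "\<exists>u. L u (conjugate_on E (axis j 1)) (conjugate_on E (axis j \<i>))"
    unfolding 1 using 2 u neg[OF u] by auto
qed

text \<open>The axis probes leave only the relative sign of the entries at \<open>b\<close> and
  \<open>j\<close> open; if equal signs are excluded, opposite ones occur.\<close>

lemma diag_fibre:
  assumes j: "j \<noteq> k" "j \<noteq> b" and b: "b \<noteq> k" and no: "\<not> (\<exists>u. L u (diag b j) (\<i> *s diag b j))"
  shows "\<exists>u. L u (diag b j) ((1 / sqrt 2) *\<^sub>R (axis b \<i> - axis j \<i>))"
proof -
  have nth: "diag b j $ i = (if i = b \<or> i = j then (1 / sqrt 2) *\<^sub>R 1 else 0)" for i
    using j(2) by (simp add: diag_def axis_def)
  have "diag b j \<bullet> diag b j = 1"
    using j(2) by (simp add: diag_def inner_add_left inner_add_right inner_axis_axis)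
  moreover have "diag b j $ k = 0" using j(1) b nth by auto
  ultimately obtain u w where L: "L u (diag b j) w" using surj by blast
  have main: "w = (1 / sqrt 2) *\<^sub>R (axis b \<i> - axis j \<i>)"
    if L: "L u (diag b j) w" and wb: "w $ b = \<i> * diag b j $ b" for w
  proof -
    have wi: "w $ i = 0" if "i \<noteq> b" "i \<noteq> j" for i
      using axis_probe[OF L, of i] nth that by auto
    have "w $ j \<noteq> \<i> * diag b j $ j"
    proof
      assume wj: "w $ j = \<i> * diag b j $ j"
      have "w = \<i> *s diag b j"
        unfolding vec_eq_iff
      proof
        fix i show "w $ i = (\<i> *s diag b j) $ i"
          using wi[of i] wj wb nth[of i] by (cases "i = b \<or> i = j") auto
      qed
      then show False using no L by blast
    qed
    then have wj: "w $ j = - (\<i> * diag b j $ j)" using axis_probe[OF L, of j] by blast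
    show ?thesis
      unfolding vec_eq_iff
    proof
      fix i show "w $ i = ((1 / sqrt 2) *\<^sub>R (axis b \<i> - axis j \<i>)) $ i"
        using wi[of i] wj wb nth[of b] nth[of j] j(2)
        by (cases "i = b"; cases "i = j") (auto simp: axis_def)
    qed
  qed
  show ?thesis
  proof (cases "w $ b = \<i> * diag b j $ b")
    case True
    then show ?thesis using main[OF L] L by blast
  next
    case False
    then have "(- w) $ b = \<i> * diag b j $ b" using axis_probe[OF L, of b] by simp
    then have "- w = (1 / sqrt 2) *\<^sub>R (axis b \<i> - axis j \<i>)" by (rule main[OF neg[OF L]])
    then show ?thesis using neg[OF L] by metis
  qed
qed

text \<open>\<open>E\<close> collects the indices whose orientation differs from that of the
  reference \<open>b\<close>. Conjugating them turns every diagonal fibre into a complex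
  line.\<close>

lemma hermitian_coordinates:
  assumes b: "b \<noteq> k"
  obtains E where "k \<notin> E" "\<And>u v w u' v' w'. L u v w \<Longrightarrow> L u' v' w' \<Longrightarrow>
    K u u' = (cmod (hermitian_dot (conjugate_on E v) (conjugate_on E v')))\<^sup>2"
proof -
  define E where "E = {j. j \<noteq> k \<and> j \<noteq> b \<and> \<not> (\<exists>u. L u (diag b j) (\<i> *s diag b j))}"
  define M where "M u v w = L u (conjugate_on E v) (conjugate_on E w)" for u v w
  have kE: "k \<notin> E" by (simp add: E_def)
  interpret M: circle_fibration M K k
    unfolding M_def by (rule conjugate_circle_fibration[OF kE])
  interpret M: oriented_circle_fibration M K k b
  proof
    show "b \<noteq> k" by (rule b)
    fix j assume j: "j \<noteq> k" "j \<noteq> b"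
    have 1: "conjugate_on E (diag b j) = diag b j"
      by (simp add: vec_eq_iff conjugate_on_nth diag_def axis_def)
    have bE: "b \<notin> E" by (simp add: E_def)
    show "\<exists>u. M u (M.diag b j) (\<i> *s M.diag b j)"
    proof (cases "j \<in> E")
      case False
      then obtain u where u: "L u (diag b j) (\<i> *s diag b j)" using j by (auto simp: E_def)
      have "conjugate_on E (\<i> *s diag b j) = \<i> *s diag b j"
        using bE False by (auto simp: vec_eq_iff conjugate_on_nth diag_def axis_def)
      then show ?thesis using u 1 unfolding M_def M.diag_def diag_def by auto
    next
      case True
      then have "\<not> (\<exists>u. L u (diag b j) (\<i> *s diag b j))" by (simp add: E_def)
      then obtain u where u: "L u (diag b j) ((1 / sqrt 2) *\<^sub>R (axis b \<i> - axis j \<i>))"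
        using diag_fibre[OF j b] by blast
      have "conjugate_on E (\<i> *s diag b j) = (1 / sqrt 2) *\<^sub>R (axis b \<i> - axis j \<i>)"
        using bE True j by (auto simp: vec_eq_iff conjugate_on_nth diag_def axis_def)
      then show ?thesis using u 1 unfolding M_def M.diag_def diag_def by auto
    qed
  qed
  show thesis
  proof (rule that[OF kE])
    fix u v w u' v' w' assume "L u v w" "L u' v' w'"
    then have "M u (conjugate_on E v) (conjugate_on E w)" "M u' (conjugate_on E v') (conjugate_on E w')"
      by (simp_all add: M_def conjugate_on_involution)
    then show "K u u' = (cmod (hermitian_dot (conjugate_on E v) (conjugate_on E v')))\<^sup>2"
      by (rule M.transition_hermitian)
  qed
qed

end

section \<open>The Born rule\<close>

lemma hermitian_dot_cnj: "cnj (hermitian_dot u v) = hermitian_dot v u"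
  by (simp add: hermitian_dot_def mult.commute)

lemma hermitian_dot_add_right: "hermitian_dot u (v + w) = hermitian_dot u v + hermitian_dot u w"
  by (simp add: hermitian_dot_def algebra_simps sum.distrib)

lemma hermitian_dot_scaleR_right: "hermitian_dot u (r *\<^sub>R v) = r *\<^sub>R hermitian_dot u v"
  by (simp add: hermitian_dot_def scaleR_sum_right)

lemma cmod_hermitian_dot_scale:
  "cmod (hermitian_dot (c *s u) (d *s v)) = cmod c * cmod d * cmod (hermitian_dot u v)"
proof -
  have "hermitian_dot (c *s u) (d *s v) = (cnj c * d) * hermitian_dot u v"
    by (simp add: hermitian_dot_def sum_distrib_left algebra_simps)
  then show ?thesis by (simp add: norm_mult)
qed

lemma norm_complex_vector_scale:
  fixes u :: "complex ^ 'n"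
  shows "norm (c *s u) = cmod c * norm u"
proof -
  have "(norm (c *s u))\<^sup>2 = (\<Sum>i\<in>UNIV. (cmod (c * u $ i))\<^sup>2)"
    by (simp add: power2_norm_eq_inner inner_vec_def)
  also have "\<dots> = (cmod c * norm u)\<^sup>2"
    by (simp add: norm_mult power_mult_distrib sum_distrib_left power2_norm_eq_inner inner_vec_def)
  finally show ?thesis by (simp add: power2_eq_iff_nonneg)
qed

text \<open>Every normalised representative of the class of \<open>\<xi> z\<close> is
  \<open>\<xi> z\<close> times a phase, which the modulus ignores.\<close>

lemma projective_map:
  fixes \<xi> :: "'a \<Rightarrow> complex ^ 'n"
  assumes unit: "\<And>z. z \<in> S \<Longrightarrow> norm (\<xi> z) = 1"
    and born: "\<And>x y. x \<in> S \<Longrightarrow> y \<in> S \<Longrightarrow> p x y = (cmod (hermitian_dot (\<xi> x) (\<xi> y)))\<^sup>2"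
  shows "\<exists>zbar :: 'a \<Rightarrow> (complex ^ 'n) set.
           zbar ` S \<subseteq> complex_projective_space \<and>
           (\<forall>x\<in>S. \<forall>y\<in>S. \<forall>u\<in>zbar x. \<forall>v\<in>zbar y.
              p x y = (cmod (hermitian_dot (unit_representative u) (unit_representative v)))\<^sup>2)"
proof -
  let ?r = "{(u, v). \<exists>c. c \<noteq> 0 \<and> v = c *s u} :: ((complex ^ 'n) \<times> (complex ^ 'n)) set"
  define zbar where "zbar z = ?r `` {\<xi> z}" for z
  have proj: "P \<in> complex_projective_space" if P: "P \<in> zbar ` S" for P
  proof -
    obtain z where z: "z \<in> S" "P = zbar z" using P by blast
    have "\<xi> z \<in> - {0}" using unit[OF z(1)] by auto
    then show ?thesis unfolding complex_projective_space_def z(2) zbar_def by (rule quotientI)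
  qed
  have rep: "\<exists>c. cmod c = 1 \<and> unit_representative u = c *s \<xi> z" if z: "z \<in> S" and u: "u \<in> zbar z" for z u
  proof -
    obtain c where c: "c \<noteq> 0" "u = c *s \<xi> z" using u by (auto simp: zbar_def)
    have n: "norm u = cmod c" using c(2) unit[OF z] by (simp add: norm_complex_vector_scale)
    have "unit_representative u = (c /\<^sub>R cmod c) *s \<xi> z"
      unfolding unit_representative_def n unfolding c(2) by (simp add: vec_eq_iff)
    moreover have "cmod (c /\<^sub>R cmod c) = 1" using c(1) by simp
    ultimately show ?thesis by blast
  qed
  have "p x y = (cmod (hermitian_dot (unit_representative u) (unit_representative v)))\<^sup>2"
    if xy: "x \<in> S" "y \<in> S" and uv: "u \<in> zbar x" "v \<in> zbar y" for x y u v
  proof -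
    obtain c d where "cmod c = 1" "unit_representative u = c *s \<xi> x"
      "cmod d = 1" "unit_representative v = d *s \<xi> y"
      using rep[OF xy(1) uv(1)] rep[OF xy(2) uv(2)] by blast
    then show ?thesis using born[OF xy] by (simp add: cmod_hermitian_dot_scale)
  qed
  then show ?thesis using proj by (intro exI[of _ zbar]) blast
qed

lemma cmod_add_scaled:
  "(cmod (of_real \<alpha> + of_real \<beta> * h))\<^sup>2 = \<alpha>\<^sup>2 + \<beta>\<^sup>2 * (cmod h)\<^sup>2 + 2 * \<alpha> * \<beta> * Re h"
proof -
  have "Re (of_real \<alpha> + of_real \<beta> * h) = \<alpha> + \<beta> * Re h" "Im (of_real \<alpha> + of_real \<beta> * h) = \<beta> * Im h"
    by simp_all
  then show ?thesis
    unfolding cmod_power2[of "of_real \<alpha> + of_real \<beta> * h"] cmod_power2[of h]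
    by (simp add: power2_eq_square algebra_simps)
qed

section \<open>Amplitudes relative to the pole\<close>

context framed_system begin

lemma circle_fibration_fibre: "circle_fibration fibre p k"
proof
  fix u v w assume L: "fibre u v w"
  show "v \<bullet> v = 1" "w \<bullet> w = 1" "v \<bullet> w = 0" "v $ k = 0" "w $ k = 0"
    by (rule fibre_unit[OF L])+
  show "fibre u v (- w)" by (rule fibre_neg[OF L])
  show "fibre u (r *\<^sub>R v + s *\<^sub>R w) (s *\<^sub>R v - r *\<^sub>R w)" if "r\<^sup>2 + s\<^sup>2 = 1" for r s
    by (rule fibre_rotate[OF L that])
  fix u' v' w' assume L': "fibre u' v' w'"
  show "p u u' = (v \<bullet> v')\<^sup>2 + (w \<bullet> v')\<^sup>2" by (rule fibre_transition[OF L L'])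
  have "u \<in> S" "u' \<in> S" using L L' by (simp_all add: fibre_def)
  then show "p u u' = p u' u" by (rule p_sym)
next
  fix v :: "complex ^ 'n" assume "v \<bullet> v = 1" "v $ k = 0"
  then show "\<exists>u w. fibre u v w" by (rule fibre_surjective) blast
next
  fix j assume "j \<noteq> k"
  then show "\<exists>u. fibre u (axis j 1) (axis j \<i>)" using fibre_axis by blast
qed

text \<open>The amplitude at the pole is the nonnegative root of \<open>p z pole\<close>, which
  fixes the phase; the rest is the conjugated fibre vector along \<open>W z\<close>. The modulus of
  the inner product of two such vectors gives \<open>p (U y) (U z)\<close>, and its real part gives
  the cross term of \<open>state_formula\<close>.\<close>

lemma unit_vector_representation:
  assumes b: "b \<noteq> k"
  obtains \<xi> :: "'a \<Rightarrow> complex ^ 'n" where "\<And>z. z \<in> S \<Longrightarrow> norm (\<xi> z) = 1"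
    "\<And>y z. y \<in> S \<Longrightarrow> z \<in> S \<Longrightarrow> p y z = (cmod (hermitian_dot (\<xi> y) (\<xi> z)))\<^sup>2"
proof -
  interpret circle_fibration fibre p k by (rule circle_fibration_fibre)
  obtain E where E: "k \<notin> E" and herm: "\<And>u v w u' v' w'. fibre u v w \<Longrightarrow> fibre u' v' w' \<Longrightarrow>
    p u u' = (cmod (hermitian_dot (conjugate_on E v) (conjugate_on E v')))\<^sup>2"
    by (rule hermitian_coordinates[OF b]) (rule that)
  define Q where "Q z u v w \<longleftrightarrow> u \<in> S \<and> p pole u = 0 \<and> z \<in> plane pole u \<and> fibre u v w \<and>
      W z = sqrt (p z pole * (1 - p z pole)) *\<^sub>R v" for z u v w
  have "\<exists>t. Q z (fst t) (fst (snd t)) (snd (snd t))" if z: "z \<in> S" for z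
  proof -
    \<comment> \<open>At the pole itself any orthogonal \<open>u\<close> will do, since the
      coefficient of \<open>C z\<close> in \<open>\<xi> z\<close> is 0 there.\<close>
    obtain u where u: "u \<in> S" "p pole u = 0" "z \<in> plane pole u"
    proof (cases "z = pole")
      case True
      have "pole \<in> plane pole (x b)" by (rule plane_ends[OF x_in x_in x_orth[OF b[symmetric]]])
      then show ?thesis using that[OF x_in x_orth[OF b[symmetric]]] True by simp
    next
      case False
      then have ne: "pole \<noteq> z" by simp
      show ?thesis by (rule plane_through[OF x_in z ne]) (rule that)
    qed
    obtain v w where "fibre u v w" "W z = sqrt (p z pole * (1 - p z pole)) *\<^sub>R v"
      by (rule fibre_state[OF u]) (rule that)
    then have "Q z u v w" using u by (simp add: Q_def)
    then show ?thesis by (intro exI[of _ "(u, v, w)"]) simp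
  qed
  then have "\<forall>z\<in>S. \<exists>t. Q z (fst t) (fst (snd t)) (snd (snd t))" by (rule ballI)
  from bchoice[OF this] obtain T where T: "\<forall>z\<in>S. Q z (fst (T z)) (fst (snd (T z))) (snd (snd (T z)))"
    by (rule exE)
  define U V V' where "U z = fst (T z)" and "V z = fst (snd (T z))" and "V' z = snd (snd (T z))" for z
  have UV: "\<And>z. z \<in> S \<Longrightarrow> U z \<in> S" "\<And>z. z \<in> S \<Longrightarrow> p pole (U z) = 0"
    "\<And>z. z \<in> S \<Longrightarrow> z \<in> plane pole (U z)" "\<And>z. z \<in> S \<Longrightarrow> fibre (U z) (V z) (V' z)"
    "\<And>z. z \<in> S \<Longrightarrow> W z = sqrt (p z pole * (1 - p z pole)) *\<^sub>R V z"
    using T unfolding Q_def U_def V_def V'_def by blast+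
  define C where "C z = conjugate_on E (V z)" for z
  define \<xi> where "\<xi> z = sqrt (p z pole) *\<^sub>R axis k 1 + sqrt (1 - p z pole) *\<^sub>R C z" for z
  have dot: "hermitian_dot (\<xi> y) (\<xi> z) = of_real (sqrt (p y pole) * sqrt (p z pole))
      + of_real (sqrt (1 - p y pole) * sqrt (1 - p z pole)) * hermitian_dot (C y) (C z)"
    if y: "y \<in> S" and z: "z \<in> S" for y z
  proof -
    have Ck: "C w $ k = 0" if "w \<in> S" for w
      using fibre_unit(4)[OF UV(4)[OF that]] E by (simp add: C_def conjugate_on_nth)
    have "hermitian_dot (axis k 1) (C z) = 0" using Ck[OF z] by (simp add: hermitian_dot_axis)
    moreover have "hermitian_dot (C y) (axis k 1) = 0"
      using Ck[OF y] hermitian_dot_cnj[of "axis k 1" "C y"] by (simp add: hermitian_dot_axis)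
    moreover have "hermitian_dot (axis k 1) (axis k 1 :: complex ^ 'n) = 1"
      by (simp add: hermitian_dot_axis)
    ultimately show ?thesis
      unfolding \<xi>_def hermitian_dot_add_left hermitian_dot_add_right hermitian_dot_scaleR_left
        hermitian_dot_scaleR_right by (simp add: scaleR_conv_of_real)
  qed
  \<comment> \<open>Conjugating coordinates changes the complex inner product but not its real part,
    so the cross term computed from \<open>W\<close> survives.\<close>
  have ReC: "Re (hermitian_dot (C y) (C z)) = V y \<bullet> V z" for y z
    by (simp add: hermitian_dot_Re_Im C_def conjugate_on_inner)
  have range: "0 \<le> p z pole" "0 \<le> 1 - p z pole" if "z \<in> S" for z
    using p_nonneg[OF that x_in] p_le_1[OF that x_in] by simp_all
  show thesis
  proof (rule that[of \<xi>])
    fix z assume z: "z \<in> S"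
    have "(norm (\<xi> z))\<^sup>2 = Re (hermitian_dot (\<xi> z) (\<xi> z))"
      by (simp add: power2_norm_eq_inner hermitian_dot_Re_Im)
    also have "\<dots> = 1"
      unfolding dot[OF z z] using range[OF z] ReC[of z z] fibre_unit(1)[OF UV(4)[OF z]] by simp
    finally have "norm (\<xi> z) = 1 \<or> norm (\<xi> z) = -1" by (simp only: power2_eq_1_iff)
    then show "norm (\<xi> z) = 1" using norm_ge_zero[of "\<xi> z"] by linarith
  next
    fix y z assume y: "y \<in> S" and z: "z \<in> S"
    define r s where "r = p y pole" and "s = p z pole"
    have rs: "0 \<le> r" "0 \<le> 1 - r" "0 \<le> s" "0 \<le> 1 - s"
      using range[OF y] range[OF z] by (simp_all add: r_def s_def)
    define \<alpha> \<beta> where "\<alpha> = sqrt r * sqrt s" and "\<beta> = sqrt (1 - r) * sqrt (1 - s)"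
    have "p y z = r * s + (1 - r) * (1 - s) * p (U y) (U z) + 2 * (W y \<bullet> W z)"
      unfolding r_def s_def by (rule state_formula[OF UV(3,1,2)[OF y] UV(3,1,2)[OF z]])
    moreover have "W y \<bullet> W z = \<alpha> * \<beta> * (V y \<bullet> V z)"
      unfolding UV(5)[OF y] UV(5)[OF z] by (simp add: \<alpha>_def \<beta>_def r_def s_def real_sqrt_mult)
    moreover have "r * s = \<alpha>\<^sup>2" "(1 - r) * (1 - s) = \<beta>\<^sup>2"
      using rs by (simp_all add: \<alpha>_def \<beta>_def power_mult_distrib)
    moreover have "p (U y) (U z) = (cmod (hermitian_dot (C y) (C z)))\<^sup>2"
      unfolding C_def by (rule herm[OF UV(4)[OF y] UV(4)[OF z]])
    ultimately show "p y z = (cmod (hermitian_dot (\<xi> y) (\<xi> z)))\<^sup>2"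
      unfolding dot[OF y z] cmod_add_scaled ReC r_def[symmetric] s_def[symmetric] \<alpha>_def[symmetric] \<beta>_def[symmetric]
      by simp
  qed
qed

end

text \<open>For \<open>N = 1\<close> there is no reference index besides the pole; then all states
  coincide and any unit vector represents them.\<close>

lemma (in transition_system) unit_vectors_exist:
  assumes N: "N = CARD('n::finite)" and V: "axiom_V S p"
  shows "\<exists>\<xi> :: 'a \<Rightarrow> complex ^ 'n. (\<forall>z\<in>S. norm (\<xi> z) = 1) \<and>
    (\<forall>y\<in>S. \<forall>z\<in>S. p y z = (cmod (hermitian_dot (\<xi> y) (\<xi> z)))\<^sup>2)"
proof -
  have "orth {}" by (simp add: orth_iff)
  then obtain F where F: "F \<subseteq> S" "orth F" "finite F" "card F = N"
    "\<And>a. a \<in> S \<Longrightarrow> (\<Sum>x\<in>F. p a x) = 1"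
    by (rule frame_ext[OF empty_subsetI]) (rule that)
  show ?thesis
  proof (cases "N = 1")
    case True
    then obtain e where e: "F = {e}" using F(4) by (auto simp: card_1_singleton_iff)
    have eS: "e \<in> S" using e F(1) by blast
    have all: "z = e" if "z \<in> S" for z
      using F(5)[OF that] p_eq_1_iff[OF that eS] by (simp add: e)
    have 1: "hermitian_dot (axis undefined 1) (axis undefined 1 :: complex ^ 'n) = 1"
      by (simp add: hermitian_dot_axis)
    have "p y z = 1" if "y \<in> S" "z \<in> S" for y z
      using all[OF that(1)] all[OF that(2)] p_self[OF eS] by simp
    then show ?thesis
      by (intro exI[of _ "\<lambda>_. axis undefined 1"]) (simp add: 1)
  next
    case False
    have "card (UNIV :: 'n set) = card F" using F(4) N by simp
    from finite_same_card_bij[OF finite F(3) this]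
    obtain x :: "'n \<Rightarrow> 'a" where x: "bij_betw x UNIV F" by (rule exE)
    have inj: "inj x" and range: "range x = F" using x by (auto simp: bij_betw_def)
    define k :: 'n where "k = undefined"
    have "\<exists>b. b \<noteq> k"
    proof (rule ccontr)
      assume "\<nexists>b. b \<noteq> k"
      then have "(UNIV :: 'n set) = {k}" by blast
      then have "CARD('n) = card {k}" by (rule arg_cong)
      then show False using False N by simp
    qed
    then obtain b where b: "b \<noteq> k" by blast
    have xS: "x j \<in> S" for j using range F(1) by blast
    have ax: "\<exists>t. j \<noteq> k \<longrightarrow> plane_axes (x k) (x j) (fst t) (snd t)" for j
    proof (cases "j = k")
      case False
      have "x k \<noteq> x j" using injD[OF inj, of k j] False by blast
      moreover have "x k \<in> F" "x j \<in> F" using range by blast+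
      ultimately have "p (x k) (x j) = 0" using F(2) by (simp add: orth_iff)
      then obtain f g where "plane_axes (x k) (x j) f g"
        by (rule plane_axes_exist[OF xS xS _ V]) (rule that)
      then show ?thesis by (intro exI[of _ "(f, g)"]) simp
    qed simp
    then have "\<forall>j. \<exists>t. j \<noteq> k \<longrightarrow> plane_axes (x k) (x j) (fst t) (snd t)" by (rule allI)
    from choice[OF this] obtain t where t: "\<forall>j. j \<noteq> k \<longrightarrow> plane_axes (x k) (x j) (fst (t j)) (snd (t j))"
      by (rule exE)
    define f g where "f j = fst (t j)" and "g j = snd (t j)" for j
    interpret framed_system S p N x k f g
    proof
      show "inj x" by (rule inj)
      show "range x \<subseteq> S" "orth (range x)" unfolding range by (rule F(1,2))+
      show "CARD('n) = N" using N by simp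
      show "axiom_V S p" by (rule V)
      show "plane_axes (x k) (x j) (f j) (g j)" if "j \<noteq> k" for j
        using t that by (simp add: f_def g_def)
    qed
    obtain \<xi> :: "'a \<Rightarrow> complex ^ 'n" where "\<And>z. z \<in> S \<Longrightarrow> norm (\<xi> z) = 1"
      "\<And>y z. y \<in> S \<Longrightarrow> z \<in> S \<Longrightarrow> p y z = (cmod (hermitian_dot (\<xi> y) (\<xi> z)))\<^sup>2"
      by (rule unit_vector_representation[OF b]) (rule that)
    then show ?thesis by (intro exI[of _ \<xi>] conjI ballI)
  qed
qed

theorem mainTheorem1:
  fixes S :: "'a set" and p :: "'a \<Rightarrow> 'a \<Rightarrow> real"
  assumes "probability_function S p"
    and "axiom_I S p"
    and "axiom_II S p"
    and "axiom_III S p"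
    and "axiom_IV S p"
    and "axiom_V S p"
    and "has_dimension p S CARD('n::finite)"
  shows "\<exists>zbar :: 'a \<Rightarrow> (complex ^ 'n) set.
           zbar ` S \<subseteq> complex_projective_space \<and>
           (\<forall>x\<in>S. \<forall>y\<in>S. \<forall>u\<in>zbar x. \<forall>v\<in>zbar y.
              p x y = (cmod (hermitian_dot (unit_representative u) (unit_representative v)))\<^sup>2)"
proof -
  have "transition_system S p CARD('n)"
    by (rule transition_system.intro) (rule assms)+
  from transition_system.unit_vectors_exist[OF this refl assms(6)]
  obtain \<xi> :: "'a \<Rightarrow> complex ^ 'n" where \<xi>: "\<forall>z\<in>S. norm (\<xi> z) = 1"
    "\<forall>y\<in>S. \<forall>z\<in>S. p y z = (cmod (hermitian_dot (\<xi> y) (\<xi> z)))\<^sup>2"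
    by (elim exE conjE)
  show ?thesis by (rule projective_map[of S \<xi> p]) (use \<xi> in blast)+
qed

end
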